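(* Let $G$ be any connected planar graph on at least 2 vertices. If $G$ does not contain any 4-cycle (as a subgraph, not necessarily induced), then $$\rho_2(G) > \frac{1}{21}.$$
   Context: All graphs are finite and simple. Firefighter problem: let $G$ be a connected graph on at least 2 vertices and $k$ a positive integer. A fire breaks out at a vertex $v \in V(G)$. Then, in each turn (round), the firefighters first choose at most $k$ vertices not yet on fire and protect them (protection is permanent, and protected vertices never burn); next the fire spreads to all unprotected neighbours of vertices already on fire. The process ends when the fire can no longer spread. A vertex is saved if it is not on fire at the end. Let $sn_k(G,v)$ denote the maximum number of vertices of $G$ that can be saved with $k$ firefighters when the fire breaks out at $v$. The $k$-surviving rate of $G$ is $$\rho_k(G) = \frac{1}{|V(G)|^2}\sum_{v \in V(G)} sn_k(G,v).$$ *)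

theory Defs
  imports "HOL-Analysis.Analysis" "Graph_Theory.Graph_Theory"
begin

text \<open>
  A finite simple graph is a \<^locale>\<open>pair_graph\<close>: a finite vertex set with a symmetric,
  irreflexive arc relation. An undirected edge is the two-element set of its endpoints.
\<close>

definition edges :: "'a pair_pre_digraph \<Rightarrow> 'a set set" where
  "edges G = {{u, w} | u w. (u, w) \<in> parcs G}"

text \<open>
  Planarity means having a drawing in the plane (here \<^typ>\<open>complex\<close>): vertices are distinct
  points, and an edge is a simple arc joining its endpoints. The last two conditions say that
  an edge passes through no vertex other than its endpoints, and that two edges meet only in
  common endpoints.
\<close>

definition plane_drawing ::
  "'a pair_pre_digraph \<Rightarrow> ('a \<Rightarrow> complex) \<Rightarrow> ('a set \<Rightarrow> real \<Rightarrow> complex) \<Rightarrow> bool" where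
  "plane_drawing G p \<gamma> \<longleftrightarrow>
     inj_on p (pverts G) \<and>
     (\<forall>e\<in>edges G. arc (\<gamma> e) \<and> {pathstart (\<gamma> e), pathfinish (\<gamma> e)} = p ` e) \<and>
     (\<forall>e\<in>edges G. path_image (\<gamma> e) \<inter> p ` pverts G = p ` e) \<and>
     (\<forall>e\<in>edges G. \<forall>f\<in>edges G. e \<noteq> f \<longrightarrow>
        path_image (\<gamma> e) \<inter> path_image (\<gamma> f) \<subseteq> p ` (e \<inter> f))"

definition planar :: "'a pair_pre_digraph \<Rightarrow> bool" where
  "planar G \<longleftrightarrow> (\<exists>p \<gamma>. plane_drawing G p \<gamma>)"

text \<open>
  A strategy \<open>D\<close> lists the sets of vertices newly protected in rounds \<open>0, 1, 2, \<dots>\<close>;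
  \<open>burning G D v t\<close> is the set of vertices on fire after \<open>t\<close> rounds. In each round protection
  comes before the spread, so the spread in round \<open>t\<close> is blocked by \<open>D 0, \<dots>, D t\<close>.
\<close>

fun burning :: "'a pair_pre_digraph \<Rightarrow> (nat \<Rightarrow> 'a set) \<Rightarrow> 'a \<Rightarrow> nat \<Rightarrow> 'a set" where
  "burning G D v 0 = {v}"
| "burning G D v (Suc t) = burning G D v t \<union>
     {w. (\<exists>u \<in> burning G D v t. (u, w) \<in> parcs G) \<and> w \<notin> (\<Union>s\<le>t. D s)}"

definition strategy :: "'a pair_pre_digraph \<Rightarrow> nat \<Rightarrow> 'a \<Rightarrow> (nat \<Rightarrow> 'a set) \<Rightarrow> bool" where
  "strategy G k v D \<longleftrightarrow>
     (\<forall>t. D t \<subseteq> pverts G - burning G D v t \<and> card (D t) \<le> k)"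

text \<open>
  The process is run for all rounds: rounds after the fire has stopped spreading have no effect
  on the set of burnt vertices.
\<close>

definition saved :: "'a pair_pre_digraph \<Rightarrow> (nat \<Rightarrow> 'a set) \<Rightarrow> 'a \<Rightarrow> 'a set" where
  "saved G D v = pverts G - (\<Union>t. burning G D v t)"

definition sn :: "nat \<Rightarrow> 'a pair_pre_digraph \<Rightarrow> 'a \<Rightarrow> nat" where
  "sn k G v = Max {card (saved G D v) | D. strategy G k v D}"

definition surviving_rate :: "nat \<Rightarrow> 'a pair_pre_digraph \<Rightarrow> real" where
  "surviving_rate k G = (\<Sum>v\<in>pverts G. real (sn k G v)) / (real (card (pverts G)))\<^sup>2"

end

theory Submission
  imports Defs "HOL-Complex_Analysis.Complex_Analysis"
begin

text \<open>
  Let \<open>n\<close> be the number of vertices. Every vertex satisfies \<open>sn \<ge> 1\<close>, since a vertex can be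
  protected at once; this settles \<open>n \<le> 20\<close>. For \<open>n \<ge> 21\<close> the bound is an average over vertices:
  a fire that starts at a vertex of small degree can be confined, and a plane graph without
  4-cycles has enough such vertices.

  Sparseness. Count arcs, so that an edge counts twice. A bounded face of a plane
  graph without 4-cycles is a triangle or has length at least 5, and two triangles share no edge; this gives
  \<open>9 card E \<le> 2 card (triangle_arcs E) + 30 (n - 1)\<close> (\<open>edge_bound\<close>). With \<open>d\<close> the degree and
  \<open>\<tau>\<close> the number of neighbours that form a triangle with the vertex, the weights
  \<open>18 d - 4 \<tau> - 60\<close> therefore sum to at most \<open>-60\<close>. Vertices of degree at least 5 pass a little weight to
  small neighbours in triangles, and every vertex pays its leaves; after that the charge of a vertex
  satisfies \<open>n (2 - charge) \<le> 42 (sn + 1)\<close> (\<open>charge_saves\<close>). Summation over all vertices gives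
  \<open>n (2 n + 60) \<le> 42 (\<Sum>sn) + 42 n\<close>, so that \<open>21 \<Sum>sn > n\<^sup>2\<close>.

  Confinement. The fire needs at least \<open>k\<close> rounds to reach a vertex of depth \<open>k\<close> of a
  breadth-first tree. A root path has one vertex on each level, so two firefighters can protect two root
  paths ahead of the fire, one level per round. Two root paths of a breadth-first tree of
  a plane graph can be chosen such that they split the rest into parts \<open>A\<close> and \<open>B\<close>, with no edge
  between, each with at most \<open>2 n / 3\<close> vertices (\<open>balanced_separator\<close>). The fire is then kept
  out of a part and of the paths, which saves about a third of the graph. The constraint is the first
  round, when all neighbours of the source in the saved set must be protected. Leaves are given up,
  three other neighbours cause no difficulty, and four can be handled if all lie in triangles
  and one of the triangles has small degrees (\<open>saves_third_deg3\<close>, \<open>saves_third_deg4\<close>).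

  Planarity. Both consequences of planarity are read off from one combinatorial object, so that
  neither faces nor Euler's formula occur. A walk around a spanning tree, following the
  rotation at every vertex, passes each tree arc once and sees each chord once from either end; it
  is recorded as a cyclic word of arcs (locale \<open>contour\<close>). Chords do not cross in this word
  (\<open>noncrossing\<close>): a chord and the tree path between its ends form a simple closed
  curve, and between the two occurrences of the chord the word stays on one side of it. The sides
  are told apart by winding numbers (\<open>side_function\<close>), after the drawing has been
  straightened near the vertices (\<open>star_drawing_exists\<close>). Hence the chords form a
  bracket structure, and the edge bound and the separator are both obtained from
  the intervals of the word that contain both or neither of the two occurrences of each chord.
\<close>

section \<open>Cyclic order\<close>

text \<open>
  The three numbers occur in this order when an interval is traversed cyclically; for angles in
  \<open>[0, 2 pi)\<close> this is the counterclockwise order of three directions.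
\<close>

definition cyc :: "real \<Rightarrow> real \<Rightarrow> real \<Rightarrow> bool" where
  "cyc a b c \<longleftrightarrow> a < b \<and> b < c \<or> b < c \<and> c < a \<or> c < a \<and> a < b"

lemma cyc_swap: "a \<noteq> b \<Longrightarrow> b \<noteq> c \<Longrightarrow> a \<noteq> c \<Longrightarrow> cyc a b c \<longleftrightarrow> \<not> cyc c b a"
  unfolding cyc_def by linarith

text \<open>
  Sorting \<open>N\<close> by \<open>f\<close> and closing up gives a permutation whose only nonempty invariant set is
  \<open>N\<close>. Applied to the angles at a vertex, it is the rotation of a plane drawing.
\<close>

lemma cyclic_successor:
  fixes f :: "'a \<Rightarrow> real"
  assumes fin: "finite N" and inj: "inj_on f N"
  obtains s where "bij_betw s N N"
    and "\<And>x y. x \<in> N \<Longrightarrow> y \<in> N \<Longrightarrow> \<not> cyc (f x) (f y) (f (s x))"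
    and "\<And>A. A \<subseteq> N \<Longrightarrow> A \<noteq> {} \<Longrightarrow> (\<And>x. x \<in> A \<Longrightarrow> s x \<in> A) \<Longrightarrow> A = N"
proof (cases "N = {}")
  case True
  show ?thesis by (rule that[of id]) (auto simp: True)
next
  case False
  define n where "n = card N"
  have n0: "n > 0" using False fin by (simp add: n_def card_gt_0_iff)
  define ys where "ys = sorted_list_of_set (f ` N)"
  define xs where "xs = map (inv_into N f) ys"
  have ys: "set ys = f ` N" "sorted_wrt (<) ys" using fin strict_sorted_list_of_set by (simp_all add: ys_def)
  have len: "length xs = n" "length ys = n"
    using inj by (auto simp: xs_def n_def ys_def card_image)
  have setxs: "set xs = N" using inj by (simp add: xs_def ys(1))
  have dist: "distinct xs" using setxs len by (metis card_distinct n_def)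
  have fx: "f (xs ! i) = ys ! i" if "i < n" for i
    using that len ys(1) nth_mem[of i ys] by (simp add: xs_def f_inv_into_f)
  have mono: "f (xs ! i) < f (xs ! j)" if "i < j" "j < n" for i j
    using that ys(2) len by (simp add: fx sorted_wrt_iff_nth_less)
  have lt_iff: "f (xs ! i) < f (xs ! j) \<longleftrightarrow> i < j" if "i < n" "j < n" for i j
    using mono[of i j] mono[of j i] that by (metis linorder_neqE_nat order_less_asym order_less_irrefl)
  define ix where "ix = inv_into {..<n} ((!) xs)"
  have bijx: "bij_betw ((!) xs) {..<n} N"
    using bij_betw_nth[OF dist] len setxs by blast
  have ix: "ix (xs ! i) = i" if "i < n" for i
    using that bijx by (auto simp: ix_def bij_betw_def)
  have ixN: "ix x < n" "xs ! ix x = x" if "x \<in> N" for x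
    using that bijx unfolding ix_def
    by (metis bij_betw_def inv_into_into lessThan_iff, metis bij_betw_def f_inv_into_f)
  define s where "s x = xs ! (Suc (ix x) mod n)" for x
  have sx: "s (xs ! i) = xs ! (Suc i mod n)" if "i < n" for i by (simp add: s_def ix that)
  have sN: "s x \<in> N" if "x \<in> N" for x
    using n0 len setxs nth_mem[of "Suc (ix x) mod n" xs] by (simp add: s_def)
  have surj: "\<exists>x\<in>N. s x = y" if "y \<in> N" for y
  proof -
    let ?i = "ix y"
    have "s (xs ! ((?i + n - 1) mod n)) = xs ! (Suc ((?i + n - 1) mod n) mod n)"
      using n0 by (intro sx) auto
    also have "Suc ((?i + n - 1) mod n) mod n = ?i"
      using n0 ixN(1)[OF that] by (simp add: mod_Suc_eq)
    finally have "s (xs ! ((?i + n - 1) mod n)) = y" using ixN[OF that] by simp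
    moreover have "xs ! ((?i + n - 1) mod n) \<in> N" using n0 len setxs by (metis mod_less_divisor nth_mem)
    ultimately show ?thesis by blast
  qed
  have bij: "bij_betw s N N"
  proof -
    have "s ` N = N" using sN surj by blast
    thus ?thesis using fin by (simp add: bij_betw_def eq_card_imp_inj_on)
  qed
  show ?thesis
  proof (rule that[OF bij])
    fix x y assume xy: "x \<in> N" "y \<in> N"
    define i j where "i = ix x" and "j = ix y"
    have ij: "i < n" "j < n" "x = xs ! i" "y = xs ! j" using ixN xy by (auto simp: i_def j_def)
    show "\<not> cyc (f x) (f y) (f (s x))"
    proof (cases "Suc i = n")
      case True
      have "s x = xs ! 0" using sx[OF ij(1)] True ij(3) by simp
      then show ?thesis using ij n0 True by (auto simp: cyc_def lt_iff)
    next
      case False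
      hence "Suc i < n" using ij by simp
      have "s x = xs ! Suc i" using sx[OF ij(1)] \<open>Suc i < n\<close> ij(3) by simp
      then show ?thesis using ij \<open>Suc i < n\<close> by (auto simp: cyc_def lt_iff)
    qed
  next
    fix A assume A: "A \<subseteq> N" "A \<noteq> {}" and cl: "\<And>x. x \<in> A \<Longrightarrow> s x \<in> A"
    obtain x where x: "x \<in> A" using A by blast
    define i where "i = ix x"
    have i: "i < n" "xs ! i = x" using ixN x A by (auto simp: i_def)
    have *: "xs ! ((i + k) mod n) \<in> A" for k
    proof (induction k)
      case 0 thus ?case using i x by simp
    next
      case (Suc k)
      have "s (xs ! ((i + k) mod n)) = xs ! (Suc ((i + k) mod n) mod n)" using n0 by (intro sx) auto
      thus ?case using cl[OF Suc] by (simp add: mod_Suc_eq)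
    qed
    show "A = N"
    proof
      show "N \<subseteq> A"
      proof
        fix y assume y: "y \<in> N"
        have "(i + (n - i + ix y)) mod n = ix y" using i ixN(1)[OF y] by simp
        thus "y \<in> A" using *[of "n - i + ix y"] ixN(2)[OF y] by simp
      qed
    qed (rule A)
  qed
qed

section \<open>Drawings with straight spokes\<close>

text \<open>
  Take the last visit to \<open>S\<close> and then the first visit to \<open>T\<close>. For discs around the two ends of
  an edge this cuts out the part of the edge between the discs.
\<close>

lemma crossing_subarc:
  fixes g :: "real \<Rightarrow> complex"
  assumes g: "arc g" and S: "closed S" and T: "closed T" and ST: "S \<inter> T = {}"
    and gS: "pathstart g \<in> S" and gT: "pathfinish g \<in> T"
  obtains k where "arc k" "path_image k \<subseteq> path_image g" "path_image k \<inter> S = {pathstart k}"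
    "path_image k \<inter> T = {pathfinish k}"
proof -
  have cont: "continuous_on {0..1} g" using g by (simp add: arc_def path_def)
  have inj: "inj_on g {0..1}" using g by (simp add: arc_def)
  define X where "X = {0..1} \<inter> g -` S"
  have "compact X" unfolding X_def
    using continuous_closed_preimage[OF cont _ S] by (simp add: compact_eq_bounded_closed bounded_Int)
  moreover have "X \<noteq> {}" using gS unfolding X_def pathstart_def by force
  ultimately obtain s where s: "s \<in> X" "\<And>t. t \<in> X \<Longrightarrow> t \<le> s"
    using compact_attains_sup[of X] by blast
  define Y where "Y = {s..1} \<inter> g -` T"
  have s01: "0 \<le> s" "s \<le> 1" "g s \<in> S" using s by (auto simp: X_def)
  have "continuous_on {s..1} g" using cont s01 continuous_on_subset by fastforce
  hence "compact Y" unfolding Y_def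
    using continuous_closed_preimage[OF _ closed_atLeastAtMost T] by (simp add: compact_eq_bounded_closed bounded_Int)
  moreover have "Y \<noteq> {}" using gT s01 unfolding Y_def pathfinish_def by force
  ultimately obtain t where t: "t \<in> Y" "\<And>t'. t' \<in> Y \<Longrightarrow> t \<le> t'"
    using compact_attains_inf[of Y] by blast
  have t01: "s \<le> t" "t \<le> 1" "g t \<in> T" using t by (auto simp: Y_def)
  have "s \<noteq> t" using s01 t01 ST by blast
  hence st: "s < t" using t01 by simp
  have img: "path_image (subpath s t g) = g ` {s..t}" using st by (simp add: path_image_subpath)
  show ?thesis
  proof (rule that[of "subpath s t g"])
    show "arc (subpath s t g)" using g s01 t01 st by (intro arc_subpath_arc) auto
    show "path_image (subpath s t g) \<subseteq> path_image g"
      using s01 t01 unfolding img by (auto simp: path_image_def)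
    show "path_image (subpath s t g) \<inter> S = {pathstart (subpath s t g)}"
    proof -
      have "u = s" if "u \<in> {s..t}" "g u \<in> S" for u
        using s(2)[of u] that s01 t01 by (auto simp: X_def)
      hence "g ` {s..t} \<inter> S \<subseteq> {g s}" by blast
      thus ?thesis unfolding img using s01 st by auto
    qed
    show "path_image (subpath s t g) \<inter> T = {pathfinish (subpath s t g)}"
    proof -
      have "u = t" if "u \<in> {s..t}" "g u \<in> T" for u
        using t(2)[of u] that s01 t01 by (auto simp: Y_def)
      hence "g ` {s..t} \<inter> T \<subseteq> {g t}" by blast
      thus ?thesis unfolding img using t01 st by auto
    qed
  qed
qed

text \<open>
  Inside a disc of radius \<open>r\<close> around a vertex, each edge at the vertex is a radius and no other
  edge enters. Hence the edges at a vertex have well defined directions \<open>ang\<close>, which a drawing by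
  arbitrary arcs need not provide. Every edge is drawn once from either end; the two arcs
  \<open>\<delta> x y\<close> and \<open>\<delta> y x\<close> have the same image.
\<close>

locale star_drawing =
  fixes V :: "'a set" and E :: "('a \<times> 'a) set" and p :: "'a \<Rightarrow> complex" and r :: real
    and ang :: "'a \<Rightarrow> 'a \<Rightarrow> real" and \<delta> :: "'a \<Rightarrow> 'a \<Rightarrow> real \<Rightarrow> complex"
  assumes EV: "(x, y) \<in> E \<Longrightarrow> x \<in> V \<and> y \<in> V"
    and Esym: "(x, y) \<in> E \<Longrightarrow> (y, x) \<in> E"
    and Eirr: "(x, x) \<notin> E"
    and r0: "r > 0"
    and discs: "x \<in> V \<Longrightarrow> y \<in> V \<Longrightarrow> x \<noteq> y \<Longrightarrow> cball (p x) r \<inter> cball (p y) r = {}"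
    and arc: "(x, y) \<in> E \<Longrightarrow> arc (\<delta> x y)"
    and start: "(x, y) \<in> E \<Longrightarrow> pathstart (\<delta> x y) = p x"
    and finish: "(x, y) \<in> E \<Longrightarrow> pathfinish (\<delta> x y) = p y"
    and image_sym: "(x, y) \<in> E \<Longrightarrow> path_image (\<delta> x y) = path_image (\<delta> y x)"
    and ang: "(x, y) \<in> E \<Longrightarrow> 0 \<le> ang x y \<and> ang x y < 2 * pi"
    and spoke: "(x, y) \<in> E \<Longrightarrow>
      path_image (\<delta> x y) \<inter> cball (p x) r = closed_segment (p x) (p x + r * cis (ang x y))"
    and away: "(x, y) \<in> E \<Longrightarrow> z \<in> V \<Longrightarrow> z \<noteq> x \<Longrightarrow> z \<noteq> y \<Longrightarrow> path_image (\<delta> x y) \<inter> cball (p z) r = {}"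
    and first_piece: "(x, y) \<in> E \<Longrightarrow> \<exists>k. path k \<and> pathstart k = p x + r * cis (ang x y) \<and>
      path_image k \<inter> ball (p x) r = {} \<and> \<delta> x y = linepath (p x) (p x + r * cis (ang x y)) +++ k"
    and meet: "(x, y) \<in> E \<Longrightarrow> (u, w) \<in> E \<Longrightarrow> {x, y} \<noteq> {u, w} \<Longrightarrow>
      path_image (\<delta> x y) \<inter> path_image (\<delta> u w) \<subseteq> p ` ({x, y} \<inter> {u, w})"

lemma seg_cball:
  fixes a c :: complex
  shows "r > 0 \<Longrightarrow> dist a c = r \<Longrightarrow> closed_segment a c \<subseteq> cball a r"
  by (rule closed_segment_subset) auto

lemma seg_sphere:
  fixes a c :: complex
  assumes "dist a c = r" "z \<in> closed_segment a c" "dist a z = r" shows "z = c"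
proof -
  obtain u where u: "0 \<le> u" "u \<le> 1" "z = (1 - u) *\<^sub>R a + u *\<^sub>R c" using assms(2) by (auto simp: in_segment)
  have "a - z = u *\<^sub>R (a - c)" by (simp add: u algebra_simps)
  hence "dist a z = u * r" using u(1) assms(1) by (simp add: dist_norm)
  hence "r = u * r" using assms(3) by simp
  thus ?thesis using u assms by (cases "r = 0") auto
qed

lemma seg_spokes_disjoint:
  fixes a c :: complex
  assumes "r > 0" "dist a c = r" "dist a d = r" "c \<noteq> d"
  shows "closed_segment a c \<inter> closed_segment a d \<subseteq> {a}"
proof
  fix z assume z: "z \<in> closed_segment a c \<inter> closed_segment a d"
  obtain u where u: "0 \<le> u" "z = (1 - u) *\<^sub>R a + u *\<^sub>R c" using z by (auto simp: in_segment)
  obtain v where v: "0 \<le> v" "z = (1 - v) *\<^sub>R a + v *\<^sub>R d" using z by (auto simp: in_segment)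
  have 1: "a - z = u *\<^sub>R (a - c)" by (simp add: u algebra_simps)
  have 2: "a - z = v *\<^sub>R (a - d)" by (simp add: v algebra_simps)
  have "dist a z = u * r" using u(1) assms by (simp add: 1 dist_norm)
  moreover have "dist a z = v * r" using v(1) assms by (simp add: 2 dist_norm)
  ultimately have "u = v" using assms by simp
  hence "u = 0 \<or> a - c = a - d" using 1 2 by (metis real_vector.scale_left_imp_eq)
  thus "z \<in> {a}" using assms u by auto
qed

text \<open>
  For small \<open>r\<close> the disc around a vertex meets only the edges at that vertex. Keep of each edge
  the part \<open>\<kappa>\<close> between the discs of its ends, and join its end points to the centres by
  radii. The kept parts of different edges are disjoint, so they end at different points
  of the circle and the radii do not collide either.
\<close>

lemma star_drawing_exists:
  fixes p :: "'a \<Rightarrow> complex" and \<gamma> :: "'a set \<Rightarrow> real \<Rightarrow> complex"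
  assumes fin: "finite V" and EV: "E \<subseteq> V \<times> V"
    and Esym: "\<And>x y. (x, y) \<in> E \<Longrightarrow> (y, x) \<in> E" and Eirr: "\<And>x. (x, x) \<notin> E"
    and inj: "inj_on p V"
    and arcs: "\<And>x y. (x, y) \<in> E \<Longrightarrow> arc (\<gamma> {x, y}) \<and> {pathstart (\<gamma> {x, y}), pathfinish (\<gamma> {x, y})} = {p x, p y}"
    and verts: "\<And>x y. (x, y) \<in> E \<Longrightarrow> path_image (\<gamma> {x, y}) \<inter> p ` V = {p x, p y}"
    and meets: "\<And>x y u w. (x, y) \<in> E \<Longrightarrow> (u, w) \<in> E \<Longrightarrow> {x, y} \<noteq> {u, w} \<Longrightarrow>
      path_image (\<gamma> {x, y}) \<inter> path_image (\<gamma> {u, w}) \<subseteq> p ` ({x, y} \<inter> {u, w})"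
  obtains r ang \<delta> where "star_drawing V E p r ang \<delta>"
proof -
  have finE: "finite E" using fin EV finite_subset by fastforce
  have ev1: "\<forall>\<^sub>F r in at_right 0. cball (p x) r \<inter> cball (p y) r = {}"
    if "x \<in> V" "y \<in> V" "x \<noteq> y" for x y
  proof -
    have "dist (p x) (p y) > 0" using that inj by (auto simp: inj_on_def)
    moreover have "cball (p x) r \<inter> cball (p y) r = {}" if "r < dist (p x) (p y) / 2" for r
    proof -
      have False if "z \<in> cball (p x) r" "z \<in> cball (p y) r" for z
        using that \<open>r < dist (p x) (p y) / 2\<close> dist_triangle2[of "p x" "p y" z]
        by (simp add: dist_commute)
      thus ?thesis by blast
    qed
    ultimately show ?thesis unfolding eventually_at_right_field
      by (intro exI[of _ "dist (p x) (p y) / 2"]) auto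
  qed
  have ev2: "\<forall>\<^sub>F r in at_right 0. path_image (\<gamma> {x, y}) \<inter> cball (p z) r = {}"
    if "(x, y) \<in> E" "z \<in> V" "z \<noteq> x" "z \<noteq> y" for x y z
  proof -
    have "p z \<notin> path_image (\<gamma> {x, y})" using verts[OF that(1)] that inj EV
      by (auto simp: inj_on_def)
    moreover have "closed (path_image (\<gamma> {x, y}))" using arcs[OF that(1)] by (simp add: arc_imp_path closed_path_image)
    ultimately obtain e where e: "e > 0" "cball (p z) e \<inter> path_image (\<gamma> {x, y}) = {}"
      by (meson Compl_iff disjoint_eq_subset_Compl open_Compl open_contains_cball)
    have "path_image (\<gamma> {x, y}) \<inter> cball (p z) r = {}" if "r < e" for r
      using e(2) that by (auto simp: disjoint_iff)
    thus ?thesis unfolding eventually_at_right_field using e(1) by blast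
  qed
  have "\<forall>\<^sub>F r in at_right 0. \<forall>x\<in>V. \<forall>y\<in>V. x \<noteq> y \<longrightarrow> cball (p x) r \<inter> cball (p y) r = {}"
    using fin ev1 by (intro eventually_ball_finite ballI) (auto intro: eventually_mono)
  moreover have "\<forall>\<^sub>F r in at_right 0. \<forall>e\<in>E. \<forall>z\<in>V. z \<noteq> fst e \<longrightarrow> z \<noteq> snd e \<longrightarrow>
      path_image (\<gamma> {fst e, snd e}) \<inter> cball (p z) r = {}"
    using fin finE ev2 by (intro eventually_ball_finite ballI) (auto intro: eventually_mono)
  moreover have "\<forall>\<^sub>F r in at_right 0. (r::real) > 0" by (simp add: eventually_at_right_less)
  ultimately have "\<forall>\<^sub>F r in at_right 0. r > 0 \<and> (\<forall>x\<in>V. \<forall>y\<in>V. x \<noteq> y \<longrightarrow> cball (p x) r \<inter> cball (p y) r = {}) \<and>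
     (\<forall>e\<in>E. \<forall>z\<in>V. z \<noteq> fst e \<longrightarrow> z \<noteq> snd e \<longrightarrow> path_image (\<gamma> {fst e, snd e}) \<inter> cball (p z) r = {})"
    by (intro eventually_conj)
  note ev = this
  obtain r where rr: "r > 0 \<and> (\<forall>x\<in>V. \<forall>y\<in>V. x \<noteq> y \<longrightarrow> cball (p x) r \<inter> cball (p y) r = {}) \<and>
     (\<forall>e\<in>E. \<forall>z\<in>V. z \<noteq> fst e \<longrightarrow> z \<noteq> snd e \<longrightarrow> path_image (\<gamma> {fst e, snd e}) \<inter> cball (p z) r = {})"
    using eventually_happens'[OF trivial_limit_at_right_real ev] by (elim exE) (rule that)
  have r0: "r > 0"
    and r1: "\<And>x y. x \<in> V \<Longrightarrow> y \<in> V \<Longrightarrow> x \<noteq> y \<Longrightarrow> cball (p x) r \<inter> cball (p y) r = {}"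
    and r2: "\<And>x y z. (x, y) \<in> E \<Longrightarrow> z \<in> V \<Longrightarrow> z \<noteq> x \<Longrightarrow> z \<noteq> y \<Longrightarrow>
       path_image (\<gamma> {x, y}) \<inter> cball (p z) r = {}"
    using rr by (simp_all, force)
  \<comment> \<open>The middle part of an edge: it touches either disc in a single point of the circle.\<close>
  define K where "K x y k \<longleftrightarrow> arc k \<and> path_image k \<subseteq> path_image (\<gamma> {x, y}) \<and>
     path_image k \<inter> cball (p x) r = {pathstart k} \<and> path_image k \<inter> cball (p y) r = {pathfinish k} \<and>
     dist (p x) (pathstart k) = r \<and> dist (p y) (pathfinish k) = r" for x y k
  have Kex: "\<exists>k. K x y k" if xy: "(x, y) \<in> E" for x y
  proof -
    let ?g = "\<gamma> {x, y}"
    define g where "g = (if pathstart ?g = p x then ?g else reversepath ?g)"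
    have V: "x \<in> V" "y \<in> V" "x \<noteq> y" using EV xy Eirr by auto
    have pne: "p x \<noteq> p y" using V inj by (auto simp: inj_on_def)
    have g: "arc g" "path_image g = path_image ?g" "pathstart g = p x" "pathfinish g = p y"
      using arcs[OF xy] pne by (auto simp: g_def arc_reversepath doubleton_eq_iff)
    obtain k where k: "arc k" "path_image k \<subseteq> path_image g" "path_image k \<inter> cball (p x) r = {pathstart k}"
      "path_image k \<inter> cball (p y) r = {pathfinish k}"
      using crossing_subarc[OF g(1) closed_cball closed_cball r1[OF V]] g(3,4) r0
      by (metis centre_in_cball less_imp_le)
    \<comment> \<open>A path that leaves the disc crosses the circle, and it has only one point in the disc.\<close>
    have bd: "dist a w = r" if "path_image h \<inter> cball a r = {w}" "path h" "u \<in> path_image h" "u \<noteq> w"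
      for h :: "real \<Rightarrow> complex" and a w u
    proof (rule ccontr)
      assume "dist a w \<noteq> r"
      hence w: "w \<in> ball a r" using that(1) by force
      have "Topological_Spaces.connected (path_image h)" using that(2) by (rule connected_path_image)
      moreover have "u \<notin> ball a r" using that by (metis Int_iff ball_subset_cball singletonD subsetD)
      moreover have "w \<in> path_image h" using that(1) by blast
      ultimately have "path_image h \<inter> frontier (ball a r) \<noteq> {}"
        using connected_Int_frontier[of "path_image h" "ball a r"] w that(3) by blast
      then obtain q where q: "q \<in> path_image h" "q \<in> sphere a r"
        unfolding frontier_ball[OF r0] by blast
      hence "q \<in> path_image h \<inter> cball a r" by simp
      hence "q = w" unfolding that(1) by simp
      thus False using q(2) \<open>dist a w \<noteq> r\<close> by simp
    qed
    have ne: "pathstart k \<noteq> pathfinish k" using arc_distinct_ends[OF k(1)] by (rule not_sym)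
    have "dist (p x) (pathstart k) = r"
      using bd[OF k(3) arc_imp_path[OF k(1)], of "pathfinish k"] ne by (simp add: pathfinish_in_path_image)
    moreover have "dist (p y) (pathfinish k) = r"
      using bd[OF k(4) arc_imp_path[OF k(1)], of "pathstart k"] ne by (simp add: pathstart_in_path_image)
    ultimately show ?thesis using k g unfolding K_def by metis
  qed
  define kk where "kk x y = (SOME k. K x y k)" for x y
  \<comment> \<open>One end of each edge is singled out, so that the middle parts chosen for \<open>(x, y)\<close> and
    \<open>(y, x)\<close> are reverses of each other.\<close>
  define piv where "piv e = (SOME x. x \<in> e)" for e :: "'a set"
  define \<kappa> where "\<kappa> x y = (if x = piv {x, y} then kk x y else reversepath (kk y x))" for x y
  have Kk: "K x y (kk x y)" if "(x, y) \<in> E" for x y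
    unfolding kk_def using Kex[OF that] by (rule someI_ex)
  have pivin: "piv {x, y} \<in> {x, y}" for x y unfolding piv_def by (rule someI[of _ x]) simp
  have K\<kappa>: "K x y (\<kappa> x y)" if xy: "(x, y) \<in> E" for x y
  proof (cases "x = piv {x, y}")
    case True thus ?thesis using Kk[OF xy] by (simp add: \<kappa>_def)
  next
    case False
    thus ?thesis using Kk[OF Esym[OF xy]] by (auto simp: \<kappa>_def K_def insert_commute arc_reversepath)
  qed
  have \<kappa>rev: "\<kappa> y x = reversepath (\<kappa> x y)" if "(x, y) \<in> E" for x y
  proof -
    have "x \<noteq> y" using that Eirr by auto
    thus ?thesis using pivin[of x y] by (auto simp: \<kappa>_def insert_commute)
  qed
  define c where "c x y = pathstart (\<kappa> x y)" for x y
  have c_fin: "pathfinish (\<kappa> x y) = c y x" if "(x, y) \<in> E" for x y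
    using \<kappa>rev[OF that] by (simp add: c_def)
  define ang where "ang x y = Arg2pi (c x y - p x)" for x y
  define \<delta> where "\<delta> x y = linepath (p x) (c x y) +++ (\<kappa> x y +++ linepath (c y x) (p y))" for x y
  have cd: "dist (p x) (c x y) = r" if "(x, y) \<in> E" for x y
    using K\<kappa>[OF that] by (simp add: K_def c_def)
  have c_eq: "p x + r * cis (ang x y) = c x y" if "(x, y) \<in> E" for x y
  proof -
    have "c x y - p x = of_real (cmod (c x y - p x)) * exp (\<i> * of_real (Arg2pi (c x y - p x)))"
      by (rule Arg2pi_eq)
    moreover have "cmod (c x y - p x) = r" using cd[OF that] by (simp add: dist_norm norm_minus_commute)
    ultimately show ?thesis by (simp add: ang_def cis_conv_exp algebra_simps)
  qed
  have \<kappa>1: "arc (\<kappa> x y)" "path_image (\<kappa> x y) \<subseteq> path_image (\<gamma> {x, y})"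
    "path_image (\<kappa> x y) \<inter> cball (p x) r = {c x y}" "path_image (\<kappa> x y) \<inter> cball (p y) r = {c y x}"
    "pathstart (\<kappa> x y) = c x y" "pathfinish (\<kappa> x y) = c y x"
    if "(x, y) \<in> E" for x y
    using K\<kappa>[OF that] c_fin[OF that] by (auto simp: K_def c_def)
  have \<kappa>ctr: "p z \<notin> path_image (\<kappa> x y)" if "(x, y) \<in> E" "z \<in> V" for x y z
  proof (cases "z = x \<or> z = y")
    case True
    thus ?thesis using \<kappa>1(3,4)[OF that(1)] cd[OF that(1)] cd[OF Esym[OF that(1)]] r0
      by (metis IntI centre_in_cball dist_self less_irrefl less_imp_le singletonD)
  next
    case False
    thus ?thesis using r2[OF that(1), of z] that \<kappa>1(2)[OF that(1)] r0
      by (metis IntI centre_in_cball empty_iff less_imp_le subsetD)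
  qed
  have seg: "closed_segment (p x) (c x y) \<subseteq> cball (p x) r" if "(x, y) \<in> E" for x y
    using seg_cball[OF r0 cd[OF that]] .
  have img: "path_image (\<delta> x y) = closed_segment (p x) (c x y) \<union> path_image (\<kappa> x y) \<union> closed_segment (p y) (c y x)"
    if "(x, y) \<in> E" for x y
    using \<kappa>1[OF that] by (simp add: \<delta>_def path_image_join Un_assoc closed_segment_commute)
  have pne: "p x \<noteq> c x y" if "(x, y) \<in> E" for x y using cd[OF that] r0 by auto
  have arc2: "arc (\<kappa> x y +++ linepath (c y x) (p y))" if xy: "(x, y) \<in> E" for x y
  proof (rule arc_join)
    show "path_image (\<kappa> x y) \<inter> path_image (linepath (c y x) (p y)) \<subseteq> {pathstart (linepath (c y x) (p y))}"
      using seg[OF Esym[OF xy]] \<kappa>1(4)[OF xy] by (auto simp: closed_segment_commute)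
  qed (use \<kappa>1[OF xy] pne[OF Esym[OF xy]] in auto)
  have arc: "arc (\<delta> x y)" if xy: "(x, y) \<in> E" for x y
    unfolding \<delta>_def
  proof (rule arc_join)
    have "closed_segment (p x) (c x y) \<inter> closed_segment (p y) (c y x) = {}"
      using seg[OF xy] seg[OF Esym[OF xy]] r1[of x y] xy EV Eirr by blast
    thus "path_image (linepath (p x) (c x y)) \<inter> path_image (\<kappa> x y +++ linepath (c y x) (p y))
      \<subseteq> {pathstart (\<kappa> x y +++ linepath (c y x) (p y))}"
      using seg[OF xy] \<kappa>1[OF xy] by (auto simp: path_image_join closed_segment_commute)
  qed (use \<kappa>1[OF xy] pne[OF xy] arc2[OF xy] in auto)
  have "star_drawing V E p r ang \<delta>"
  proof
    fix x y assume xy: "(x, y) \<in> E"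
    show "x \<in> V \<and> y \<in> V" using EV xy by blast
    show "(y, x) \<in> E" by (rule Esym[OF xy])
    show "Path_Connected.arc (\<delta> x y)" by (rule arc[OF xy])
    show "pathstart (\<delta> x y) = p x" "pathfinish (\<delta> x y) = p y" by (simp_all add: \<delta>_def)
    show "path_image (\<delta> x y) = path_image (\<delta> y x)"
      using \<kappa>rev[OF xy] by (auto simp: img[OF xy] img[OF Esym[OF xy]])
    show "0 \<le> ang x y \<and> ang x y < 2 * pi" by (simp add: ang_def Arg2pi_ge_0 Arg2pi_lt_2pi)
    have "x \<in> V" "y \<in> V" "x \<noteq> y" using xy EV Eirr by auto
    note disj = r1[OF this]
    have yx: "closed_segment (p y) (c y x) \<inter> cball (p x) r = {}"
      using seg[OF Esym[OF xy]] disj by blast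
    thus "path_image (\<delta> x y) \<inter> cball (p x) r = closed_segment (p x) (p x + r * cis (ang x y))"
      unfolding img[OF xy] c_eq[OF xy] Int_Un_distrib2
      using seg[OF xy] \<kappa>1(3)[OF xy] by auto
    show "\<exists>k. path k \<and> pathstart k = p x + r * cis (ang x y) \<and>
      path_image k \<inter> ball (p x) r = {} \<and> \<delta> x y = linepath (p x) (p x + r * cis (ang x y)) +++ k"
      unfolding c_eq[OF xy]
    proof (intro exI[of _ "\<kappa> x y +++ linepath (c y x) (p y)"] conjI)
      show "path (\<kappa> x y +++ linepath (c y x) (p y))" using arc2[OF xy] arc_imp_path by blast
      have "c x y \<notin> ball (p x) r" using cd[OF xy] by simp
      moreover have "path_image (\<kappa> x y) \<inter> ball (p x) r \<subseteq> {c x y}"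
        unfolding \<kappa>1(3)[OF xy, symmetric] by (intro Int_mono subset_refl ball_subset_cball)
      ultimately have "path_image (\<kappa> x y) \<inter> ball (p x) r = {}" by blast
      moreover have "closed_segment (p y) (c y x) \<inter> ball (p x) r \<subseteq> {}"
        unfolding yx[symmetric] by (intro Int_mono subset_refl ball_subset_cball)
      ultimately show "path_image (\<kappa> x y +++ linepath (c y x) (p y)) \<inter> ball (p x) r = {}"
        using \<kappa>1[OF xy] by (auto simp: path_image_join closed_segment_commute)
    qed (use \<kappa>1[OF xy] in \<open>auto simp: \<delta>_def\<close>)
  next
    fix x y z assume xy: "(x, y) \<in> E" and z: "z \<in> V" "z \<noteq> x" "z \<noteq> y"
    show "path_image (\<delta> x y) \<inter> cball (p z) r = {}"
    proof -
      have V: "x \<in> V" "y \<in> V" using xy EV by auto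
      have "closed_segment (p x) (c x y) \<inter> cball (p z) r = {}"
        using seg[OF xy] r1[OF V(1) z(1)] z(2) by blast
      moreover have "closed_segment (p y) (c y x) \<inter> cball (p z) r = {}"
        using seg[OF Esym[OF xy]] r1[OF V(2) z(1)] z(3) by blast
      moreover have "path_image (\<kappa> x y) \<inter> cball (p z) r = {}" using \<kappa>1(2)[OF xy] r2[OF xy z] by blast
      ultimately show ?thesis unfolding img[OF xy] Int_Un_distrib2 by simp
    qed
  next
    fix x y u w assume xy: "(x, y) \<in> E" and uw: "(u, w) \<in> E" and ne: "{x, y} \<noteq> {u, w}"
    have Vs: "x \<in> V" "y \<in> V" "u \<in> V" "w \<in> V" "x \<noteq> y" "u \<noteq> w" using xy uw EV Eirr by auto
    have kk: "path_image (\<kappa> x y) \<inter> path_image (\<kappa> u w) = {}"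
    proof -
      have "path_image (\<kappa> x y) \<inter> path_image (\<kappa> u w) \<subseteq> p ` V"
        using meets[OF xy uw ne] \<kappa>1(2)[OF xy] \<kappa>1(2)[OF uw] Vs by blast
      thus ?thesis using \<kappa>ctr[OF xy] by blast
    qed
    have ks: "path_image (\<kappa> u w) \<inter> closed_segment (p a) (c a b) = {}"
      if ab: "(a, b) \<in> E" and uw: "(u, w) \<in> E" and ne: "{a, b} \<noteq> {u, w}"
        and kk: "path_image (\<kappa> a b) \<inter> path_image (\<kappa> u w) = {}" for a b u w
    proof -
      have aV: "a \<in> V" "u \<in> V" "w \<in> V" using ab uw EV by auto
      have cab: "c a b \<notin> path_image (\<kappa> u w)" using kk \<kappa>1(3)[OF ab] by blast
      show ?thesis
      proof (rule ccontr)
        assume "\<not> ?thesis"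
        then obtain z where z: "z \<in> path_image (\<kappa> u w)" "z \<in> closed_segment (p a) (c a b)" by blast
        hence zb: "z \<in> cball (p a) r" using seg[OF ab] by blast
        have "z \<in> path_image (\<gamma> {u, w})" using z \<kappa>1(2)[OF uw] by blast
        hence "a = u \<or> a = w" using r2[OF uw, of a] aV zb by blast
        hence "z = c u w \<and> a = u \<or> z = c w u \<and> a = w" using \<kappa>1(3,4)[OF uw] z zb by blast
        hence "dist (p a) z = r" using cd[OF uw] cd[OF Esym[OF uw]] by auto
        hence "z = c a b" using seg_sphere[OF cd[OF ab] z(2)] by simp
        thus False using z cab by simp
      qed
    qed
    have ss: "closed_segment (p a) (c a b) \<inter> closed_segment (p u) (c u w) \<subseteq> p ` ({a, b} \<inter> {u, w})"
      if ab: "(a, b) \<in> E" and uw: "(u, w) \<in> E" 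
        and kk: "path_image (\<kappa> a b) \<inter> path_image (\<kappa> u w) = {}" for a b u w
    proof (cases "a = u")
      case True
      have "c a b \<noteq> c u w" using kk \<kappa>1(3)[OF ab] \<kappa>1(3)[OF uw] by blast
      thus ?thesis using seg_spokes_disjoint[OF r0 cd[OF ab], of "c u w"] cd[OF uw] True by auto
    next
      case False
      thus ?thesis using seg[OF ab] seg[OF uw] r1[of a u] ab uw EV by blast
    qed
    have sw: "path_image (\<kappa> a b) = path_image (\<kappa> b a)" if "(a, b) \<in> E" for a b
      using \<kappa>rev[OF that] by simp
    have e1: "closed_segment (p x) (c x y) \<inter> closed_segment (p u) (c u w) \<subseteq> p ` ({x, y} \<inter> {u, w})"
      by (rule ss[OF xy uw kk])
    have e2: "closed_segment (p x) (c x y) \<inter> closed_segment (p w) (c w u) \<subseteq> p ` ({x, y} \<inter> {u, w})"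
      using ss[OF xy Esym[OF uw]] kk sw[OF uw] by (simp add: insert_commute)
    have e3: "closed_segment (p y) (c y x) \<inter> closed_segment (p u) (c u w) \<subseteq> p ` ({x, y} \<inter> {u, w})"
      using ss[OF Esym[OF xy] uw] kk sw[OF xy] by (simp add: insert_commute)
    have e4: "closed_segment (p y) (c y x) \<inter> closed_segment (p w) (c w u) \<subseteq> p ` ({x, y} \<inter> {u, w})"
      using ss[OF Esym[OF xy] Esym[OF uw]] kk sw[OF xy] sw[OF uw] by (simp add: insert_commute)
    have f1: "closed_segment (p x) (c x y) \<inter> path_image (\<kappa> u w) = {}"
      using ks[OF xy uw ne kk] by (simp add: Int_commute)
    have f2: "closed_segment (p y) (c y x) \<inter> path_image (\<kappa> u w) = {}"
      using ks[OF Esym[OF xy] uw] ne kk sw[OF xy] by (simp add: insert_commute Int_commute)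
    have f3: "path_image (\<kappa> x y) \<inter> closed_segment (p u) (c u w) = {}"
      using ks[OF uw xy] ne kk by (simp add: Int_commute eq_commute)
    have f4: "path_image (\<kappa> x y) \<inter> closed_segment (p w) (c w u) = {}"
      using ks[OF Esym[OF uw] xy] ne kk sw[OF uw] by (simp add: insert_commute Int_commute eq_commute)
    show "path_image (\<delta> x y) \<inter> path_image (\<delta> u w) \<subseteq> p ` ({x, y} \<inter> {u, w})"
      unfolding img[OF xy] img[OF uw] Int_Un_distrib Int_Un_distrib2 Un_subset_iff
      by (simp add: e1 e2 e3 e4 f1 f2 f3 f4 kk)
  next
    show "r > 0" by (rule r0)
    show "(x, x) \<notin> E" for x by (rule Eirr)
    show "cball (p x) r \<inter> cball (p y) r = {}" if "x \<in> V" "y \<in> V" "x \<noteq> y" for x y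
      using that by (rule r1)
  qed
  thus ?thesis using that by blast
qed

section \<open>The two sides of a cycle\<close>

text \<open>
  A right-angled triangle with one leg along the direction \<open>\<beta>\<close>, turned counterclockwise: the point just
  to the left of that leg is inside, the point just to its right outside. This is the local model
  for the jump of the winding number across an edge.
\<close>

lemma winding_number_triangle_unit:
  fixes a :: complex and r \<beta> e :: real
  assumes r: "r > 0" and e: "0 < e" "e < pi / 2"
  defines "b \<equiv> a + r * cis \<beta>" and "c \<equiv> a + r * cis \<beta> * \<i>"
  shows "winding_number (linepath a b +++ linepath b c +++ linepath c a) (a + r / 2 * cis (\<beta> + e)) = 1"
    and "winding_number (linepath a b +++ linepath b c +++ linepath c a) (a + r / 2 * cis (\<beta> - e)) = 0"
proof -
  define h where "h w = a + r * cis \<beta> * w" for w :: complex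
  have h3: "a = h 0" "b = h 1" "c = h \<i>" by (simp_all add: h_def b_def c_def)
  have se: "sin e > 0" "cos e > 0" "cos e < 1" "sin e \<le> 1"
    using e sin_gt_zero[of e] cos_gt_zero[of e] cos_monotone_0_pi[of 0 e] by auto
  have pt: "a + r / 2 * cis (\<beta> + t) = h (cis t / 2)" for t by (simp add: h_def cis_mult)
  have hcomb: "x *\<^sub>R h u + y *\<^sub>R h v + z *\<^sub>R h w = h (x *\<^sub>R u + y *\<^sub>R v + z *\<^sub>R w)" if "x + y + z = 1" for x y z u v w
  proof -
    have "x *\<^sub>R a + y *\<^sub>R a + z *\<^sub>R a = a" using that by (metis scaleR_add_left scaleR_one)
    thus ?thesis by (simp add: h_def scaleR_conv_of_real algebra_simps)
  qed
  have ne: "h u \<noteq> h v" if "u \<noteq> v" for u v using that r by (simp add: h_def)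
  have ncol: "\<not> collinear {a, b, c}"
  proof
    assume "collinear {a, b, c}"
    hence "collinear {0, b - a, c - a}" by (simp add: collinear_3[of b a c, symmetric] insert_commute)
    then obtain t where "c - a = t *\<^sub>R (b - a) \<or> b - a = 0 \<or> c - a = 0"
      unfolding collinear_lemma by blast
    hence "r * cis \<beta> * \<i> = r * cis \<beta> * of_real t"
      using r by (auto simp: b_def c_def scaleR_conv_of_real)
    hence "\<i> = of_real t" using r by simp
    thus False by (simp add: complex_eq_iff)
  qed
  have 1: "h (cis e / 2) \<in> interior (convex hull {a, b, c})"
  proof -
    define x y z where "x = 1 - cos e / 2 - sin e / 2" and "y = cos e / 2" and "z = sin e / 2"
    have "0 < x" "0 < y" "0 < z" "x + y + z = 1" using se unfolding x_def y_def z_def by linarith+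
    moreover have "x *\<^sub>R a + y *\<^sub>R b + z *\<^sub>R c = h (cis e / 2)"
      unfolding h3 hcomb[OF \<open>x + y + z = 1\<close>]
      by (rule arg_cong[where f = h]) (simp add: complex_eq_iff y_def z_def)
    moreover have "interior (convex hull {a, b, c}) =
      {v. \<exists>x y z. 0 < x \<and> 0 < y \<and> 0 < z \<and> x + y + z = 1 \<and> x *\<^sub>R a + y *\<^sub>R b + z *\<^sub>R c = v}"
      by (rule interior_convex_hull_3_minimal[OF ncol]) simp
    ultimately show ?thesis by auto
  qed
  have 2: "Im ((b - a) * cnj (b - h (cis e / 2))) > 0"
  proof -
    have "(b - a) * cnj (b - h (cis e / 2)) = r^2 * (cis \<beta> * cnj (cis \<beta>)) * cnj (1 - cis e / 2)"
      by (simp add: b_def h_def algebra_simps power2_eq_square)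
    also have "cis \<beta> * cnj (cis \<beta>) = 1" by (simp add: cis_cnj cis_mult)
    finally show ?thesis using r se by simp
  qed
  have "winding_number (linepath a b +++ linepath b c +++ linepath c a) (h (cis e / 2)) = 1"
    by (simp only: winding_number_triangle[OF 1] 2 if_True)
  thus "winding_number (linepath a b +++ linepath b c +++ linepath c a) (a + r / 2 * cis (\<beta> + e)) = 1"
    by (simp only: pt)
  define H where "H = {z. Im ((z - a) * cnj (cis \<beta>)) \<ge> 0}"
  have Hh: "h w \<in> H \<longleftrightarrow> Im w \<ge> 0" for w
  proof -
    have "(h w - a) * cnj (cis \<beta>) = r * w * (cis \<beta> * cnj (cis \<beta>))" by (simp add: h_def)
    also have "cis \<beta> * cnj (cis \<beta>) = 1" by (simp add: cis_cnj cis_mult)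
    finally have "(h w - a) * cnj (cis \<beta>) = r * w" by simp
    thus ?thesis using r by (simp only: H_def mem_Collect_eq) (simp add: zero_le_mult_iff)
  qed
  have "convex H"
  proof -
    have "H = {z. cos \<beta> * Im z - sin \<beta> * Re z \<ge> cos \<beta> * Im a - sin \<beta> * Re a}"
      by (auto simp: H_def algebra_simps)
    also have "\<dots> = {z. inner (Complex (- sin \<beta>) (cos \<beta>)) z \<ge> cos \<beta> * Im a - sin \<beta> * Re a}"
      by (simp add: inner_complex_def algebra_simps)
    finally show ?thesis by (simp add: convex_halfspace_ge)
  qed
  moreover have "path_image (linepath a b +++ linepath b c +++ linepath c a) \<subseteq> H"
    using closed_segment_subset[OF _ _ \<open>convex H\<close>] Hh
    by (simp add: path_image_join h3)
  moreover have "h (cis (- e) / 2) \<notin> H" using se by (simp add: Hh)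
  ultimately have "winding_number (linepath a b +++ linepath b c +++ linepath c a) (h (cis (- e) / 2)) = 0"
    by (intro winding_number_zero_outside) auto
  thus "winding_number (linepath a b +++ linepath b c +++ linepath c a) (a + r / 2 * cis (\<beta> - e)) = 0"
    using pt[of "- e"] by (simp only: diff_conv_add_uminus)
qed

text \<open>
  A cycle of length \<open>m\<close>, continued periodically: successor and predecessor then need no case
  distinction at the end of the period.
\<close>

definition is_cycle :: "('a \<times> 'a) set \<Rightarrow> nat \<Rightarrow> (nat \<Rightarrow> 'a) \<Rightarrow> bool" where
  "is_cycle E m v \<longleftrightarrow> 3 \<le> m \<and> (\<forall>i. v (i + m) = v i) \<and> inj_on v {..<m} \<and> (\<forall>i. (v i, v (Suc i)) \<in> E)"

lemma cycle_edges_distinct: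
  assumes cy: "is_cycle E m v" and "i < j" "j < m"
  shows "{v i, v (Suc i)} \<noteq> {v j, v (Suc j)}"
proof -
  have inj: "v a = v b \<longleftrightarrow> a = b" if "a < m" "b < m" for a b
    using cy that by (auto simp: is_cycle_def inj_on_def)
  have m: "3 \<le> m" "v m = v 0" using cy by (auto simp: is_cycle_def dest: spec[of _ 0])
  show ?thesis
  proof (cases "Suc j = m")
    case True
    thus ?thesis using inj[of i j] inj[of "Suc i" j] inj[of "Suc i" 0] inj[of i 0] m assms(2,3)
      by (auto simp: doubleton_eq_iff)
  next
    case False
    thus ?thesis using inj[of i j] inj[of "Suc i" j] inj[of i "Suc j"] m assms(2,3)
      by (auto simp: doubleton_eq_iff)
  qed
qed

lemma cycle_index:
  assumes cy: "is_cycle E m v"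
  shows "v i = v j \<longleftrightarrow> i mod m = j mod m"
proof -
  have m: "m > 0" "\<And>i. v (i + m) = v i" "inj_on v {..<m}" using cy by (auto simp: is_cycle_def)
  have per: "v (i mod m) = v i" for i
  proof (induction i rule: less_induct)
    case (less i)
    show ?case
    proof (cases "i < m")
      case False
      hence "v ((i - m) mod m) = v (i - m)" using less[of "i - m"] m(1) by simp
      moreover have "v (i - m) = v i" using m(2)[of "i - m"] False by simp
      moreover have "(i - m) mod m = i mod m" using False by (simp add: le_mod_geq)
      ultimately show ?thesis by simp
    qed simp
  qed
  have "v i = v j \<longleftrightarrow> v (i mod m) = v (j mod m)" by (simp only: per)
  also have "\<dots> \<longleftrightarrow> i mod m = j mod m" using m by (simp add: inj_on_eq_iff)
  finally show ?thesis .
qed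

lemma cycle_Suc:
  assumes cy: "is_cycle E m v"
  shows "v (Suc i) = v (Suc j) \<longleftrightarrow> v i = v j"
proof
  assume "v i = v j"
  hence "i mod m = j mod m" using cycle_index[OF cy] by blast
  hence "Suc i mod m = Suc j mod m" by (metis mod_Suc_eq)
  thus "v (Suc i) = v (Suc j)" using cycle_index[OF cy] by blast
next
  have m: "m > 0" using cy by (simp add: is_cycle_def)
  assume "v (Suc i) = v (Suc j)"
  hence "Suc i mod m = Suc j mod m" using cycle_index[OF cy] by blast
  hence "(Suc i + (m - 1)) mod m = (Suc j + (m - 1)) mod m" by (metis mod_add_left_eq)
  hence "(i + m) mod m = (j + m) mod m" using m by simp
  hence "i mod m = j mod m" by simp
  thus "v i = v j" using cycle_index[OF cy] by blast
qed

lemma cycle_prev_next: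
  assumes cy: "is_cycle E m v" shows "v i \<noteq> v (Suc (Suc i))"
proof
  have m: "m \<ge> 3" using cy by (simp add: is_cycle_def)
  assume "v i = v (Suc (Suc i))"
  hence "i mod m = (i + 2) mod m" using cycle_index[OF cy] by simp
  hence "m dvd 2" by (metis add_diff_cancel_left' mod_eq_dvd_iff_nat le_add1)
  thus False using m by (auto dest: dvd_imp_le)
qed

definition on_cycle :: "(nat \<Rightarrow> 'a) \<Rightarrow> 'a \<Rightarrow> 'a \<Rightarrow> bool" where
  "on_cycle v x y \<longleftrightarrow> (\<exists>i. {x, y} = {v i, v (Suc i)})"

text \<open>
  \<open>S x y\<close> says that the arc \<open>(x, y)\<close> leaves \<open>x\<close> on the right-hand side of the directed cycle \<open>v\<close>. An edge
  off the cycle stays on one side, a vertex off the cycle has all its edges on one side, and at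
  a vertex of the cycle the right-hand side is the sector from the incoming to the outgoing edge.
\<close>

definition is_side :: "('a \<times> 'a) set \<Rightarrow> ('a \<Rightarrow> 'a \<Rightarrow> real) \<Rightarrow> (nat \<Rightarrow> 'a) \<Rightarrow> ('a \<Rightarrow> 'a \<Rightarrow> bool) \<Rightarrow> bool" where
  "is_side E ang v S \<longleftrightarrow>
    (\<forall>x y. (x, y) \<in> E \<longrightarrow> \<not> on_cycle v x y \<longrightarrow> S x y = S y x) \<and>
    (\<forall>x y z. (x, y) \<in> E \<longrightarrow> (x, z) \<in> E \<longrightarrow> x \<notin> range v \<longrightarrow> S x y = S x z) \<and>
    (\<forall>i w. (v (Suc i), w) \<in> E \<longrightarrow> w \<noteq> v i \<longrightarrow> w \<noteq> v (Suc (Suc i)) \<longrightarrow>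
      S (v (Suc i)) w = cyc (ang (v (Suc i)) (v i)) (ang (v (Suc i)) w) (ang (v (Suc i)) (v (Suc (Suc i)))))"

context star_drawing begin

primrec chain :: "(nat \<Rightarrow> 'a) \<Rightarrow> nat \<Rightarrow> real \<Rightarrow> complex" where
  "chain v 0 = \<delta> (v 0) (v (Suc 0))"
| "chain v (Suc k) = chain v k +++ \<delta> (v (Suc k)) (v (Suc (Suc k)))"

lemma chain_basic:
  assumes "\<And>i. (v i, v (Suc i)) \<in> E"
  shows "path (chain v k) \<and> pathstart (chain v k) = p (v 0) \<and> pathfinish (chain v k) = p (v (Suc k)) \<and>
    path_image (chain v k) = (\<Union>i\<le>k. path_image (\<delta> (v i) (v (Suc i))))"
proof (induction k)
  case 0
  show ?case using start[OF assms[of 0]] finish[OF assms[of 0]] arc_imp_path[OF arc[OF assms[of 0]]] by simp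
next
  case (Suc k)
  have "path (\<delta> (v (Suc k)) (v (Suc (Suc k))))" by (rule arc_imp_path[OF arc[OF assms[of "Suc k"]]])
  moreover have "{..Suc k} = insert (Suc k) {..k}" by auto
  ultimately show ?case using Suc start[OF assms[of "Suc k"]] finish[OF assms[of "Suc k"]]
    by (auto simp: path_image_join)
qed

lemma winding_chain:
  assumes "\<And>i. (v i, v (Suc i)) \<in> E" "z \<notin> path_image (chain v k)"
  shows "winding_number (chain v k) z = (\<Sum>i\<le>k. winding_number (\<delta> (v i) (v (Suc i))) z)"
  using assms(2)
proof (induction k)
  case (Suc k)
  have *: "path (\<delta> (v (Suc k)) (v (Suc (Suc k))))" by (rule arc_imp_path[OF arc[OF assms(1)[of "Suc k"]]])
  have "z \<notin> path_image (chain v k)" "z \<notin> path_image (\<delta> (v (Suc k)) (v (Suc (Suc k))))"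
    using Suc.prems chain_basic[of v k, OF assms(1)] start[OF assms(1)[of "Suc k"]] by (auto simp: path_image_join)
  thus ?case using Suc.IH * chain_basic[of v k, OF assms(1)] start[OF assms(1)[of "Suc k"]]
    by (simp add: winding_number_join)
qed auto

lemma arc_chain:
  assumes cy: "is_cycle E m v" and "Suc k < m"
  shows "arc (chain v k)"
  using assms(2)
proof (induction k)
  case 0
  show ?case using cy arc by (simp add: is_cycle_def)
next
  case (Suc k)
  have E: "(v i, v (Suc i)) \<in> E" for i using cy by (simp add: is_cycle_def)
  have inj: "v a = v b \<longleftrightarrow> a = b" if "a < m" "b < m" for a b
    using cy that by (auto simp: is_cycle_def inj_on_def)
  have "path_image (\<delta> (v i) (v (Suc i))) \<inter> path_image (\<delta> (v (Suc k)) (v (Suc (Suc k)))) \<subseteq> {p (v (Suc k))}"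
    if "i \<le> k" for i
  proof -
    have "{v i, v (Suc i)} \<inter> {v (Suc k), v (Suc (Suc k))} \<subseteq> {v (Suc k)}"
      using that Suc.prems inj[of i "Suc k"] inj[of i "Suc (Suc k)"] inj[of "Suc i" "Suc (Suc k)"] by auto
    hence sub: "p ` ({v i, v (Suc i)} \<inter> {v (Suc k), v (Suc (Suc k))}) \<subseteq> p ` {v (Suc k)}"
      by (rule image_mono)
    have ik: "i < Suc k" "Suc k < m" using that Suc.prems by linarith+
    show ?thesis
      using order_trans[OF meet[OF E[of i] E[of "Suc k"] cycle_edges_distinct[OF cy ik]] sub]
      by (simp only: image_insert image_empty)
  qed
  hence "path_image (chain v k) \<inter> path_image (\<delta> (v (Suc k)) (v (Suc (Suc k)))) \<subseteq> {p (v (Suc k))}"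
    using chain_basic[of v k, OF E] by blast
  moreover have a: "Path_Connected.arc (chain v k)" by (rule Suc.IH) (use Suc.prems in linarith)
  moreover have s: "pathstart (\<delta> (v (Suc k)) (v (Suc (Suc k)))) = p (v (Suc k))" by (rule start[OF E[of "Suc k"]])
  moreover have "pathfinish (chain v k) = p (v (Suc k))" using chain_basic[of v k, OF E] by simp
  ultimately show ?case unfolding chain.simps by (intro arc_join a arc[OF E[of "Suc k"]]) (simp_all only: s)
qed

lemma simple_chain:
  assumes cy: "is_cycle E m v"
  shows "simple_path (chain v (m - 1))" "pathfinish (chain v (m - 1)) = pathstart (chain v (m - 1))"
proof -
  have E: "(v i, v (Suc i)) \<in> E" for i using cy by (simp add: is_cycle_def)
  have m: "3 \<le> m" "v m = v 0" using cy by (auto simp: is_cycle_def dest: spec[of _ 0])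
  obtain k where k: "m = Suc (Suc k)" using m(1) by (intro that[of "m - 2"]) linarith
  have "path_image (\<delta> (v i) (v (Suc i))) \<inter> path_image (\<delta> (v (Suc k)) (v (Suc (Suc k)))) \<subseteq> {p (v 0), p (v (Suc k))}"
    if "i \<le> k" for i
  proof -
    have ik: "i < Suc k" "Suc k < m" using that k by linarith+
    have vk: "v (Suc (Suc k)) = v 0" using m k by simp
    show ?thesis
      using order_trans[OF meet[OF E[of i] E[of "Suc k"] cycle_edges_distinct[OF cy ik]] image_mono[OF Int_lower2]]
      by (simp only: image_insert image_empty vk insert_commute)
  qed
  hence "path_image (chain v k) \<inter> path_image (\<delta> (v (Suc k)) (v (Suc (Suc k)))) \<subseteq> {p (v 0), p (v (Suc k))}"
    using chain_basic[of v k, OF E] by blast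
  hence "simple_path (chain v k +++ \<delta> (v (Suc k)) (v (Suc (Suc k))))"
    using chain_basic[of v k, OF E] start[OF E[of "Suc k"]] finish[OF E[of "Suc k"]] m k
    by (intro simple_path_join_loop arc_chain[OF cy] arc[OF E]) simp_all
  thus "simple_path (chain v (m - 1))" using k by simp
  show "pathfinish (chain v (m - 1)) = pathstart (chain v (m - 1))"
    using chain_basic[of v "m - 1", OF E] k m by simp
qed

text \<open>
  A point of the half radius in direction \<open>t\<close>, used to probe the winding number around \<open>p x\<close>.
\<close>

definition spot :: "'a \<Rightarrow> real \<Rightarrow> complex" where "spot x t = p x + r / 2 * cis t"

lemma spot_ball: "spot x t \<in> ball (p x) r" "spot x t \<in> cball (p x) r"
  using r0 by (auto simp: spot_def dist_norm norm_mult)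

lemma spot_on:
  assumes xy: "(x, y) \<in> E"
  shows "spot x t \<in> path_image (\<delta> x y) \<longleftrightarrow> cis t = cis (ang x y)"
proof -
  have "spot x t \<in> path_image (\<delta> x y) \<longleftrightarrow> spot x t \<in> closed_segment (p x) (p x + r * cis (ang x y))"
    using spoke[OF xy] spot_ball(2)[of x t] by blast
  also have "\<dots> \<longleftrightarrow> cis t = cis (ang x y)"
  proof
    assume "spot x t \<in> closed_segment (p x) (p x + r * cis (ang x y))"
    then obtain u where u: "0 \<le> u" "spot x t = (1 - u) *\<^sub>R p x + u *\<^sub>R (p x + r * cis (ang x y))"
      by (auto simp: in_segment)
    hence eq: "r / 2 * cis t = u * r * cis (ang x y)"
      by (simp add: spot_def scaleR_conv_of_real algebra_simps)
    have "cmod (r / 2 * cis t) = cmod (u * r * cis (ang x y))" by (rule arg_cong[OF eq])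
    hence u2: "u = 1 / 2" using u(1) r0 by (simp add: norm_mult)
    show "cis t = cis (ang x y)" using eq r0 unfolding u2 by simp
  next
    assume "cis t = cis (ang x y)"
    hence "spot x t = (1 - 1 / 2) *\<^sub>R p x + (1 / 2) *\<^sub>R (p x + r * cis (ang x y))"
      by (simp add: spot_def scaleR_conv_of_real algebra_simps)
    thus "spot x t \<in> closed_segment (p x) (p x + r * cis (ang x y))"
      unfolding in_segment by (intro exI[of _ "1/2"]) simp
  qed
  finally show ?thesis .
qed

lemma cis_eq_near:
  assumes "cis s = cis t" "\<bar>s - t\<bar> < 2 * pi" shows "s = t"
proof -
  have "cis (s - t) = 1" using assms(1) by (simp add: cis_divide[symmetric])
  hence "cos (s - t) = 1" by (simp add: complex_eq_iff)
  then obtain n :: int where n: "s - t = of_int n * 2 * pi" by (auto simp: cos_one_2pi_int)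
  hence "\<bar>of_int n\<bar> * (2 * pi) < 1 * (2 * pi)" using assms(2) by (simp add: abs_mult)
  hence "\<bar>real_of_int n\<bar> < 1" by simp
  hence "n = 0" by linarith
  thus ?thesis using n by simp
qed

lemma ang_inj: "inj_on (ang x) {y. (x, y) \<in> E}"
proof (rule inj_onI)
  fix y z assume yz: "y \<in> {y. (x, y) \<in> E}" "z \<in> {y. (x, y) \<in> E}" "ang x y = ang x z"
  show "y = z"
  proof (rule ccontr)
    assume ne: "y \<noteq> z"
    have "spot x (ang x y) \<in> path_image (\<delta> x y) \<inter> path_image (\<delta> x z)"
      using yz spot_on by simp
    also have "\<dots> \<subseteq> p ` ({x, y} \<inter> {x, z})" using yz ne by (intro meet) (auto simp: doubleton_eq_iff)
    also have "{x, y} \<inter> {x, z} = {x}" using ne yz Eirr by auto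
    finally show False using r0 by (simp add: spot_def)
  qed
qed

lemma cycle_image:
  assumes cy: "is_cycle E m v"
  shows "path_image (chain v (m - 1)) = (\<Union>i. path_image (\<delta> (v i) (v (Suc i))))"
proof -
  have E: "(v i, v (Suc i)) \<in> E" for i using cy by (simp add: is_cycle_def)
  have m: "m > 0" using cy by (simp add: is_cycle_def)
  have "path_image (\<delta> (v i) (v (Suc i))) = path_image (\<delta> (v (i mod m)) (v (Suc (i mod m))))" for i
    using cycle_index[OF cy, of "i mod m" i] cycle_Suc[OF cy, of "i mod m" i] by simp
  moreover have "i mod m \<in> {..m - 1}" for i
    using m mod_less_divisor[of m i] unfolding atMost_iff by linarith
  ultimately show ?thesis using chain_basic[of v "m - 1", OF E] by blast
qed

lemma spot_on_cycle:
  assumes cy: "is_cycle E m v"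
  shows "spot (v (Suc i)) t \<in> path_image (chain v (m - 1)) \<longleftrightarrow>
    cis t = cis (ang (v (Suc i)) (v i)) \<or> cis t = cis (ang (v (Suc i)) (v (Suc (Suc i))))"
proof -
  let ?x = "v (Suc i)"
  have E: "(v i, v (Suc i)) \<in> E" for i using cy by (simp add: is_cycle_def)
  have 1: "spot ?x t \<in> path_image (\<delta> (v i) (v (Suc i))) \<longleftrightarrow> cis t = cis (ang ?x (v i))"
    using spot_on[OF Esym[OF E[of i]]] image_sym[OF E[of i]] by simp
  have 2: "spot ?x t \<in> path_image (\<delta> (v (Suc i)) (v (Suc (Suc i)))) \<longleftrightarrow> cis t = cis (ang ?x (v (Suc (Suc i))))"
    using spot_on[OF E[of "Suc i"]] by simp
  have 3: "v j = v i \<or> v j = ?x" if "spot ?x t \<in> path_image (\<delta> (v j) (v (Suc j)))" for j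
  proof (rule ccontr)
    assume n: "\<not> ?thesis"
    hence "?x \<noteq> v j" "?x \<noteq> v (Suc j)" using cycle_Suc[OF cy, of j i] by auto
    hence "path_image (\<delta> (v j) (v (Suc j))) \<inter> cball (p ?x) r = {}"
      using away[OF E[of j]] EV[OF E[of "Suc i"]] by blast
    thus False using that spot_ball(2) by blast
  qed
  have 4: "spot ?x t \<in> path_image (\<delta> (v j) (v (Suc j))) \<Longrightarrow>
     cis t = cis (ang ?x (v i)) \<or> cis t = cis (ang ?x (v (Suc (Suc i))))" for j
    using 3[of j] 1 2 cycle_Suc[OF cy, of j i] cycle_Suc[OF cy, of j "Suc i"] by auto
  show ?thesis unfolding cycle_image[OF cy] UN_iff using 1 2 4 by blast
qed

text \<open>
  Coordinates with origin \<open>a\<close> in which the direction \<open>\<beta>\<close> becomes 1.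
\<close>

lemma seg_coords:
  fixes a :: complex
  assumes "a + r / 2 * cis (\<beta> + t) \<in> closed_segment (a + r * cis \<beta> * w) (a + r * cis \<beta> * w')"
  obtains u where "0 \<le> u" "u \<le> 1" "cis t / 2 = (1 - u) *\<^sub>R w + u *\<^sub>R w'"
proof -
  obtain u where u: "0 \<le> u" "u \<le> 1"
    "a + r / 2 * cis (\<beta> + t) = (1 - u) *\<^sub>R (a + r * cis \<beta> * w) + u *\<^sub>R (a + r * cis \<beta> * w')"
    using assms by (auto simp: in_segment)
  have "(r * cis \<beta>) * (cis t / 2) = r / 2 * cis (\<beta> + t)" by (simp add: cis_mult[symmetric])
  also have "\<dots> = (r * cis \<beta>) * ((1 - u) *\<^sub>R w + u *\<^sub>R w')"
    using u(3) by (simp add: scaleR_conv_of_real algebra_simps)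
  finally have "cis t / 2 = (1 - u) *\<^sub>R w + u *\<^sub>R w'" using r0 by simp
  thus ?thesis using u that by blast
qed

lemma spot_off_triangle:
  fixes x \<beta> e
  defines "a \<equiv> p x" and "b \<equiv> p x + r * cis \<beta>" and "c \<equiv> p x + r * cis \<beta> * \<i>"
  assumes e: "\<bar>e\<bar> < pi / 2"
  shows "e \<noteq> 0 \<Longrightarrow> spot x (\<beta> + e) \<notin> closed_segment a b"
    "spot x (\<beta> + e) \<notin> closed_segment b c" "spot x (\<beta> + e) \<notin> closed_segment c a"
proof -
  have ce: "cos e > 0" using e cos_gt_zero_pi[of e] by linarith
  have abc: "a = p x + r * cis \<beta> * 0" "b = p x + r * cis \<beta> * 1" by (simp_all add: a_def b_def)
  show "spot x (\<beta> + e) \<notin> closed_segment a b" if "e \<noteq> 0"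
  proof
    assume "spot x (\<beta> + e) \<in> closed_segment a b"
    then obtain u where "cis e / 2 = (1 - u) *\<^sub>R 0 + u *\<^sub>R (1::complex)"
      unfolding abc spot_def by (rule seg_coords)
    hence "sin e = 0" by (auto simp: complex_eq_iff)
    thus False using that e sin_gt_zero[of e] sin_gt_zero[of "- e"] by (cases "e > 0") (auto simp: abs_if)
  qed
  show "spot x (\<beta> + e) \<notin> closed_segment b c"
  proof
    assume "spot x (\<beta> + e) \<in> closed_segment b c"
    then obtain u where u: "cis e / 2 = (1 - u) *\<^sub>R 1 + u *\<^sub>R \<i>"
      unfolding abc c_def spot_def by (rule seg_coords)
    hence "cos e + sin e = 2" by (simp add: complex_eq_iff)
    hence "cos e = 1" "sin e = 1" using cos_le_one[of e] sin_le_one[of e] by linarith+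
    thus False using sin_cos_squared_add[of e] by simp
  qed
  show "spot x (\<beta> + e) \<notin> closed_segment c a"
  proof
    assume "spot x (\<beta> + e) \<in> closed_segment c a"
    then obtain u where u: "cis e / 2 = (1 - u) *\<^sub>R \<i> + u *\<^sub>R 0"
      unfolding abc c_def spot_def by (rule seg_coords)
    thus False using ce by (simp add: complex_eq_iff)
  qed
qed

text \<open>
  When the outgoing spoke at a vertex of the cycle is crossed counterclockwise, the winding number
  increases by 1. Replace the spoke in the winding number of the cycle by the boundary of a triangle along
  it: the difference \<open>F\<close> of the two winding numbers involves only curves that avoid the
  crossing point, so it is continuous there; being an integer off the spoke, it has the same value on both sides. The jump is
  thus that of the triangle.
\<close>

lemma winding_jump:
  fixes i :: nat
  assumes cy: "is_cycle E m v"
  defines "W \<equiv> winding_number (chain v (m - 1))"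
  defines "x \<equiv> v (Suc i)"
  defines "\<beta> \<equiv> ang x (v (Suc (Suc i)))"
  obtains d where "d > 0" "\<And>e. 0 < e \<Longrightarrow> e < d \<Longrightarrow> W (spot x (\<beta> + e)) - W (spot x (\<beta> - e)) = 1"
proof -
  let ?y = "v (Suc (Suc i))"
  have E: "(v i, v (Suc i)) \<in> E" for i using cy by (simp add: is_cycle_def)
  have m: "m > 0" using cy by (simp add: is_cycle_def)
  have xy: "(x, ?y) \<in> E" using E[of "Suc i"] by (simp add: x_def)
  define \<alpha> where "\<alpha> = ang x (v i)"
  have ab: "\<alpha> \<noteq> \<beta>" "\<bar>\<alpha> - \<beta>\<bar> < 2 * pi"
  proof -
    have "(x, v i) \<in> E" using Esym[OF E[of i]] by (simp add: x_def)
    thus "\<alpha> \<noteq> \<beta>" "\<bar>\<alpha> - \<beta>\<bar> < 2 * pi"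
      using ang_inj[of x] xy cycle_prev_next[OF cy, of i] ang[of x "v i"] ang[OF xy]
      by (auto simp: \<alpha>_def \<beta>_def inj_on_def)
  qed
  define k0 where "k0 = Suc i mod m"
  have k0: "v k0 = x" "v (Suc k0) = ?y" "k0 \<in> {..m - 1}"
  proof -
    show "v k0 = x" using cycle_index[OF cy] by (simp add: x_def k0_def)
    thus "v (Suc k0) = ?y" using cycle_Suc[OF cy, of k0 "Suc i"] by (simp add: x_def)
    show "k0 \<in> {..m - 1}" using m mod_less_divisor[of m "Suc i"] unfolding k0_def atMost_iff by linarith
  qed
  define a b c where "a = p x" and "b = p x + r * cis \<beta>" and "c = p x + r * cis \<beta> * \<i>"
  obtain k where k: "path k" "pathstart k = b" "path_image k \<inter> ball (p x) r = {}" "\<delta> x ?y = linepath a b +++ k"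
    using first_piece[OF xy] unfolding a_def b_def \<beta>_def by blast
  define T where "T = linepath a b +++ linepath b c +++ linepath c a"
  define I where "I = {..m - 1} - {k0}"
  \<comment> \<open>\<open>F\<close> is the winding number of the cycle minus that of the triangle; the shared leg cancels.\<close>
  define F where "F z = winding_number k z + (\<Sum>j\<in>I. winding_number (\<delta> (v j) (v (Suc j))) z)
    - winding_number (linepath b c) z - winding_number (linepath c a) z" for z
  have offI: "spot x \<beta> \<notin> path_image (\<delta> (v j) (v (Suc j)))" if j: "j \<in> I" for j
  proof
    assume s: "spot x \<beta> \<in> path_image (\<delta> (v j) (v (Suc j)))"
    have jm: "j < m" "k0 < m" "j \<noteq> k0" using j m k0(3) unfolding I_def by (auto simp: less_Suc_eq_le[symmetric])
    have "v j \<noteq> x" using jm cycle_index[OF cy, of j k0] k0(1) by simp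
    moreover have "x = v j \<or> x = v (Suc j)"
      using away[OF E[of j], of x] EV[OF xy] s spot_ball(2)[of x \<beta>] by blast
    ultimately have "v (Suc j) = x" by blast
    hence "v j = v i" using cycle_Suc[OF cy, of j i] by (simp add: x_def)
    hence "spot x \<beta> \<in> path_image (\<delta> x (v i))" using s \<open>v (Suc j) = x\<close> image_sym[OF E[of j]] by simp
    hence "cis \<beta> = cis \<alpha>" using spot_on[of x "v i"] Esym[OF E[of i]] by (simp add: x_def \<alpha>_def)
    thus False using cis_eq_near[of \<beta> \<alpha>] ab by (simp add: abs_minus_commute)
  qed
  have "isCont F (spot x \<beta>)"
    unfolding F_def
  proof (intro continuous_intros continuous_at_winding_number)
    show "spot x \<beta> \<notin> path_image k" using k(3) spot_ball(1) by blast
    show "spot x \<beta> \<notin> path_image (linepath b c)" "spot x \<beta> \<notin> path_image (linepath c a)"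
      using spot_off_triangle(2,3)[of 0 x \<beta>] by (simp_all add: a_def b_def c_def)
  qed (use k(1) offI arc_imp_path[OF arc[OF E]] in auto)
  moreover have "isCont (spot x) \<beta>" unfolding spot_def cis_conv_exp by (intro continuous_intros)
  ultimately have "isCont (\<lambda>t. F (spot x t)) \<beta>" by (rule isCont_o2[rotated])
  hence "\<exists>d>0. \<forall>t. dist t \<beta> < d \<longrightarrow> dist (F (spot x t)) (F (spot x \<beta>)) < 1 / 2"
    unfolding continuous_at_eps_delta by (rule allE[of _ "1/2"]) simp
  then obtain d1 where "d1 > 0 \<and> (\<forall>t. dist t \<beta> < d1 \<longrightarrow> dist (F (spot x t)) (F (spot x \<beta>)) < 1 / 2)" by (elim exE)
  hence d1: "d1 > 0" "\<And>t. \<bar>t - \<beta>\<bar> < d1 \<Longrightarrow> cmod (F (spot x t) - F (spot x \<beta>)) < 1 / 2"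
    by (simp_all add: dist_norm)
  \<comment> \<open>Within \<open>d\<close> of \<open>\<beta>\<close> the incoming spoke is not met, and the triangle lemma applies.\<close>
  define d where "d = min d1 (min (pi / 2) (min \<bar>\<alpha> - \<beta>\<bar> (2 * pi - \<bar>\<alpha> - \<beta>\<bar>)))"
  have d: "d > 0" using d1 ab by (simp add: d_def)
  have simple: "simple_path (chain v (m - 1))" "pathfinish (chain v (m - 1)) = pathstart (chain v (m - 1))"
    using simple_chain[OF cy] by auto
  have FW: "W (spot x (\<beta> + t)) - winding_number T (spot x (\<beta> + t)) = F (spot x (\<beta> + t)) \<and> W (spot x (\<beta> + t)) \<in> \<int>"
    if t: "t \<noteq> 0" "\<bar>t\<bar> < d" for t
  proof -
    let ?z = "spot x (\<beta> + t)"
    have td: "\<bar>t\<bar> < pi / 2" "\<bar>t\<bar> < \<bar>\<alpha> - \<beta>\<bar>" "\<bar>t\<bar> < 2 * pi - \<bar>\<alpha> - \<beta>\<bar>"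
      using t(2) unfolding d_def by linarith+
    have "\<bar>\<beta> + t - \<beta>\<bar> < 2 * pi" using td(1) pi_gt_zero by linarith
    hence "cis (\<beta> + t) \<noteq> cis \<beta>" using cis_eq_near[of "\<beta> + t" \<beta>] t(1) by auto
    moreover have "cis (\<beta> + t) \<noteq> cis \<alpha>"
    proof
      assume "cis (\<beta> + t) = cis \<alpha>"
      moreover have "\<bar>\<beta> + t - \<alpha>\<bar> < 2 * pi" using td(3) by linarith
      ultimately have "\<beta> + t = \<alpha>" by (rule cis_eq_near)
      thus False using td(2) by auto
    qed
    ultimately have zJ: "?z \<notin> path_image (chain v (m - 1))"
      using spot_on_cycle[OF cy, of i "\<beta> + t"] by (simp add: x_def \<alpha>_def \<beta>_def)
    have zT: "?z \<notin> closed_segment a b" "?z \<notin> closed_segment b c" "?z \<notin> closed_segment c a"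
      using spot_off_triangle[of t x \<beta>, OF td(1)] t(1) by (simp_all add: a_def b_def c_def)
    have zk: "?z \<notin> path_image k" using k(3) spot_ball(1) by blast
    have "W ?z = (\<Sum>j\<le>m - 1. winding_number (\<delta> (v j) (v (Suc j))) ?z)"
      unfolding W_def by (rule winding_chain[of v ?z "m - 1", OF E zJ])
    also have "\<dots> = winding_number (\<delta> x ?y) ?z + (\<Sum>j\<in>I. winding_number (\<delta> (v j) (v (Suc j))) ?z)"
      using sum.remove[OF finite_atMost k0(3), of "\<lambda>j. winding_number (\<delta> (v j) (v (Suc j))) ?z"]
      unfolding I_def k0(1,2) by simp
    also have "winding_number (\<delta> x ?y) ?z = winding_number (linepath a b) ?z + winding_number k ?z"
      unfolding k(4) using k zT(1) zk by (intro winding_number_join) auto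
    finally have 1: "W ?z = winding_number (linepath a b) ?z + winding_number k ?z +
      (\<Sum>j\<in>I. winding_number (\<delta> (v j) (v (Suc j))) ?z)" .
    have "winding_number T ?z = winding_number (linepath a b) ?z + (winding_number (linepath b c) ?z + winding_number (linepath c a) ?z)"
      unfolding T_def using zT by (simp add: winding_number_join path_image_join)
    moreover have "W ?z \<in> \<int>" unfolding W_def
      using simple zJ by (intro integer_winding_number) (auto simp: simple_path_imp_path)
    ultimately show ?thesis using 1 by (simp add: F_def)
  qed
  show ?thesis
  proof (rule that[OF d])
    fix e assume e: "0 < e" "e < d"
    have ep: "e < pi / 2" using e by (simp add: d_def)
    have T1: "winding_number T (spot x (\<beta> + e)) = 1" "winding_number T (spot x (\<beta> - e)) = 0"
      using winding_number_triangle_unit[OF r0 e(1) ep, of "p x" \<beta>]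
      by (simp_all only: T_def a_def b_def c_def spot_def)
    have 1: "W (spot x (\<beta> + e)) - 1 = F (spot x (\<beta> + e))" "W (spot x (\<beta> + e)) \<in> \<int>"
      using FW[of e] e T1 by auto
    have 2: "W (spot x (\<beta> - e)) = F (spot x (\<beta> - e))" "W (spot x (\<beta> - e)) \<in> \<int>"
      using FW[of "- e"] e T1 by auto
    have "e < d1" using e by (simp add: d_def)
    hence "cmod (F (spot x (\<beta> + e)) - F (spot x \<beta>)) < 1 / 2" "cmod (F (spot x (\<beta> - e)) - F (spot x \<beta>)) < 1 / 2"
      using e d1(2)[of "\<beta> + e"] d1(2)[of "\<beta> - e"] by simp_all
    hence "cmod (F (spot x (\<beta> + e)) - F (spot x (\<beta> - e))) < 1"
      using norm_triangle_ineq4[of "F (spot x (\<beta> + e)) - F (spot x \<beta>)" "F (spot x (\<beta> - e)) - F (spot x \<beta>)"] by simp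
    moreover have "F (spot x (\<beta> + e)) \<in> \<int>" "F (spot x (\<beta> - e)) \<in> \<int>"
      using Ints_diff[OF 1(2) Ints_1] 1(1) 2 by simp_all
    then obtain n where n: "F (spot x (\<beta> + e)) - F (spot x (\<beta> - e)) = of_int n"
      by (meson Ints_cases Ints_diff)
    ultimately have "\<bar>real_of_int n\<bar> < 1" by simp
    hence "n = 0" by linarith
    hence "F (spot x (\<beta> + e)) = F (spot x (\<beta> - e))" using n by simp
    thus "W (spot x (\<beta> + e)) - W (spot x (\<beta> - e)) = 1" using 1 2 by (simp add: algebra_simps)
  qed
qed

text \<open>
  The winding number of a simple closed curve takes two consecutive values \<open>R\<close> and \<open>R + 1\<close>, where
  \<open>R + 1\<close> is taken on the left. It is constant along edges off the cycle and on discs around vertices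
  off the cycle. At a vertex of the cycle it can change only at the two spokes of the cycle, and it does
  increase by 1 at the outgoing one.
\<close>

theorem side_function:
  assumes cy: "is_cycle E m v"
  shows "\<exists>S. is_side E ang v S"
proof -
  have E: "(v i, v (Suc i)) \<in> E" for i using cy by (simp add: is_cycle_def)
  define J where "J = chain v (m - 1)"
  have J: "simple_path J" "pathfinish J = pathstart J" "path J"
    using simple_chain[OF cy] by (auto simp: J_def simple_path_imp_path)
  have Jimg: "path_image J = (\<Union>i. path_image (\<delta> (v i) (v (Suc i))))"
    unfolding J_def by (rule cycle_image[OF cy])
  define W where "W = winding_number J"
  have const: "W y = W z" if "Topological_Spaces.connected A" "y \<in> A" "z \<in> A" "A \<inter> path_image J = {}" for A y z
    unfolding W_def using that J by (intro winding_number_eq[of J _ A]) auto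
  obtain R where R: "\<And>z. z \<notin> path_image J \<Longrightarrow> W z = R \<or> W z = R + 1"
  proof -
    have out: "W z = 0" if "z \<notin> path_image J" "z \<notin> inside (path_image J)" for z
      unfolding W_def using J that inside_Un_outside[of "path_image J"]
      by (intro winding_number_zero_in_outside) blast+
    show ?thesis
    proof (rule simple_closed_path_winding_number_inside[OF J(1)])
      assume "\<And>z. z \<in> inside (path_image J) \<Longrightarrow> winding_number J z = 1"
      thus ?thesis using out that[of 0] by (auto simp: W_def)
    next
      assume "\<And>z. z \<in> inside (path_image J) \<Longrightarrow> winding_number J z = - 1"
      thus ?thesis using out that[of "- 1"] by (auto simp: W_def)
    qed
  qed
  define S where "S x y \<longleftrightarrow> W (spot x (ang x y)) = R" for x y
  show ?thesis
    unfolding is_side_def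
  proof (intro exI[of _ S] conjI allI impI)
    fix x y assume xy: "(x, y) \<in> E" and off: "\<not> on_cycle v x y"
    define A where "A = \<delta> x y ` {0<..<1}"
    have Aimg: "path_image (\<delta> x y) = insert (p x) (insert (p y) A)"
    proof -
      have "{0..1} = insert 0 (insert 1 {0<..<1::real})" by auto
      thus ?thesis using start[OF xy] finish[OF xy] by (simp add: A_def path_image_def pathstart_def pathfinish_def)
    qed
    have inj: "inj_on (\<delta> x y) {0..1}" using arc[OF xy] by (simp add: arc_def)
    have ends: "\<delta> x y 0 = p x" "\<delta> x y 1 = p y"
      using start[OF xy] finish[OF xy] by (simp_all add: pathstart_def pathfinish_def)
    have ne: "p x \<noteq> \<delta> x y t" "p y \<noteq> \<delta> x y t" if "0 < t" "t < 1" for t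
      using inj_onD[OF inj, of 0 t] inj_onD[OF inj, of 1 t] that unfolding ends by auto
    have pA: "p x \<notin> A" "p y \<notin> A"
      unfolding A_def image_iff Bex_def greaterThanLessThan_iff using ne by blast+
    have cb: "cball (p x) r \<inter> cball (p y) r = {}" using discs[of x y] EV[OF xy] Eirr[of x] xy by auto
    have own: "p x \<in> cball (p x) r" "p y \<in> cball (p y) r" using r0 by simp_all
    have "continuous_on {0..1} (\<delta> x y)" using arc[OF xy] by (simp add: arc_def path_def)
    hence "continuous_on {0<..<1} (\<delta> x y)" by (rule continuous_on_subset) auto
    hence conn: "Topological_Spaces.connected A" unfolding A_def by (intro connected_continuous_image) auto
    have dj: "A \<inter> path_image J = {}"
    proof -
      have "A \<inter> path_image (\<delta> (v i) (v (Suc i))) = {}" for i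
      proof -
        have "path_image (\<delta> x y) \<inter> path_image (\<delta> (v i) (v (Suc i))) \<subseteq> p ` ({x, y} \<inter> {v i, v (Suc i)})"
          using off by (intro meet[OF xy E]) (auto simp: on_cycle_def)
        also have "\<dots> \<subseteq> p ` {x, y}" by (intro image_mono) simp
        finally show ?thesis using Aimg pA by auto
      qed
      thus ?thesis unfolding Jimg by blast
    qed
    have s1: "spot x (ang x y) \<in> A"
    proof -
      have "spot x (ang x y) \<in> path_image (\<delta> x y)" using spot_on[OF xy] by simp
      moreover have "spot x (ang x y) \<noteq> p x" using r0 by (simp add: spot_def)
      moreover have "p y \<notin> cball (p x) r"
        using cb own by blast
      ultimately show ?thesis using Aimg spot_ball(2)[of x "ang x y"] by auto
    qed
    have s2: "spot y (ang y x) \<in> A"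
    proof -
      have "spot y (ang y x) \<in> path_image (\<delta> x y)" using spot_on[OF Esym[OF xy]] image_sym[OF xy] by simp
      moreover have "spot y (ang y x) \<noteq> p y" using r0 by (simp add: spot_def)
      moreover have "p x \<notin> cball (p y) r"
        using cb own by blast
      ultimately show ?thesis using Aimg spot_ball(2)[of y "ang y x"] by auto
    qed
    show "S x y = S y x" unfolding S_def const[OF conn s1 s2 dj] by (rule refl)
  next
    fix x y z assume xy: "(x, y) \<in> E" "(x, z) \<in> E" and off: "x \<notin> range v"
    have "ball (p x) r \<inter> path_image (\<delta> (v i) (v (Suc i))) = {}" for i
    proof -
      have "path_image (\<delta> (v i) (v (Suc i))) \<inter> cball (p x) r = {}"
        using away[OF E[of i], of x] EV[OF xy(1)] off by blast
      thus ?thesis using ball_subset_cball[of "p x" r] by auto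
    qed
    hence dj: "ball (p x) r \<inter> path_image J = {}" unfolding Jimg by blast
    show "S x y = S x z"
      unfolding S_def const[OF connected_ball spot_ball(1)[of x "ang x y"] spot_ball(1)[of x "ang x z"] dj] by (rule refl)
  next
    fix i w
    define x \<beta> \<alpha> \<theta> where "x = v (Suc i)" and "\<beta> = ang x (v (Suc (Suc i)))" and "\<alpha> = ang x (v i)" and "\<theta> = ang x w"
    assume w: "(v (Suc i), w) \<in> E" "w \<noteq> v i" "w \<noteq> v (Suc (Suc i))"
    have xE: "(x, v i) \<in> E" "(x, v (Suc (Suc i))) \<in> E" "(x, w) \<in> E"
      using Esym[OF E[of i]] E[of "Suc i"] w by (simp_all add: x_def)
    have ne: "\<alpha> \<noteq> \<beta>" "\<theta> \<noteq> \<alpha>" "\<theta> \<noteq> \<beta>"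
      using ang_inj[of x] xE w cycle_prev_next[OF cy, of i] unfolding \<alpha>_def \<beta>_def \<theta>_def inj_on_def by auto
    have rng: "0 \<le> \<alpha>" "\<alpha> < 2 * pi" "0 \<le> \<beta>" "\<beta> < 2 * pi" "0 \<le> \<theta>" "\<theta> < 2 * pi"
      using ang xE by (auto simp: \<alpha>_def \<beta>_def \<theta>_def)
    have onJ: "spot x t \<in> path_image J \<longleftrightarrow> cis t = cis \<alpha> \<or> cis t = cis \<beta>" for t
      unfolding J_def x_def \<alpha>_def \<beta>_def by (rule spot_on_cycle[OF cy])
    have period: "cis (t + 2 * pi) = cis t" "spot x (t + 2 * pi) = spot x t" for t
      by (simp_all add: spot_def complex_eq_iff)
    \<comment> \<open>Unwind the angles into the interval from \<open>\<beta>\<close> to \<open>\<beta> + 2 pi\<close>.\<close>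
    define \<alpha>' \<theta>' where "\<alpha>' = (if \<alpha> > \<beta> then \<alpha> else \<alpha> + 2 * pi)" and "\<theta>' = (if \<theta> > \<beta> then \<theta> else \<theta> + 2 * pi)"
    have prm: "\<beta> < \<alpha>'" "\<alpha>' < \<beta> + 2 * pi" "\<beta> < \<theta>'" "\<theta>' < \<beta> + 2 * pi" "\<alpha>' \<noteq> \<theta>'"
      "cis \<alpha>' = cis \<alpha>" "spot x \<theta>' = spot x \<theta>"
      using ne rng pi_gt_zero period by (auto simp: \<alpha>'_def \<theta>'_def)
    have cyc_iff: "cyc \<alpha> \<theta> \<beta> \<longleftrightarrow> \<alpha>' < \<theta>'"
      using ne rng by (auto simp: cyc_def \<alpha>'_def \<theta>'_def)
    have arcconst: "W (spot x s) = W (spot x t)"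
      if st: "s \<le> t" "\<beta> < s" "t < \<beta> + 2 * pi" "\<alpha>' < s \<or> t < \<alpha>'" for s t
    proof -
      have "continuous_on {s..t} (spot x)" unfolding spot_def cis_conv_exp by (intro continuous_intros)
      hence "Topological_Spaces.connected (spot x ` {s..t})" by (intro connected_continuous_image) auto
      moreover have "spot x ` {s..t} \<inter> path_image J = {}"
      proof -
        have "spot x q \<notin> path_image J" if q: "s \<le> q" "q \<le> t" for q
        proof -
          have "\<bar>q - \<beta>\<bar> < 2 * pi" "q \<noteq> \<beta>" "\<bar>q - \<alpha>'\<bar> < 2 * pi" "q \<noteq> \<alpha>'" using q st prm(1,2) by linarith+
          hence "cis q \<noteq> cis \<beta>" "cis q \<noteq> cis \<alpha>'" using cis_eq_near[of q \<beta>] cis_eq_near[of q \<alpha>'] by blast+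
          thus ?thesis using onJ prm(6) by simp
        qed
        thus ?thesis by auto
      qed
      ultimately show ?thesis using st(1) by (intro const[of "spot x ` {s..t}"]) auto
    qed
    obtain d where d: "d > 0" "\<And>e. 0 < e \<Longrightarrow> e < d \<Longrightarrow> W (spot x (\<beta> + e)) - W (spot x (\<beta> - e)) = 1"
      by (rule winding_jump[OF cy, of i, folded J_def W_def x_def, folded \<beta>_def]) (rule that)
    define e where "e = min (d / 2) (min ((\<alpha>' - \<beta>) / 2) (min ((\<theta>' - \<beta>) / 2)
       (min ((\<beta> + 2 * pi - \<alpha>') / 2) ((\<beta> + 2 * pi - \<theta>') / 2))))"
    have e: "0 < e" "e < d" "\<beta> + e < \<alpha>'" "\<beta> + e < \<theta>'" "\<alpha>' < \<beta> + 2 * pi - e" "\<theta>' < \<beta> + 2 * pi - e"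
    proof -
      show "0 < e" using d(1) prm by (simp add: e_def)
      have "e \<le> d / 2" "e \<le> (\<alpha>' - \<beta>) / 2" "e \<le> (\<theta>' - \<beta>) / 2" "e \<le> (\<beta> + 2 * pi - \<alpha>') / 2"
        "e \<le> (\<beta> + 2 * pi - \<theta>') / 2" unfolding e_def by linarith+
      thus "e < d" "\<beta> + e < \<alpha>'" "\<beta> + e < \<theta>'" "\<alpha>' < \<beta> + 2 * pi - e" "\<theta>' < \<beta> + 2 * pi - e"
        using d(1) prm(1-4) by (simp_all only: le_divide_eq_numeral1 if_True)
    qed
    have jump: "W (spot x (\<beta> + e)) = W (spot x (\<beta> - e)) + 1" using d(2)[OF e(1,2)] by (simp add: algebra_simps)
    have per_e: "W (spot x (\<beta> - e)) = W (spot x (\<beta> + 2 * pi - e))"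
      using period(2)[of "\<beta> - e"] by (simp add: algebra_simps)
    have offJ: "spot x (\<beta> + e) \<notin> path_image J" "spot x (\<beta> - e) \<notin> path_image J"
    proof -
      have "\<bar>\<beta> + e - \<beta>\<bar> < 2 * pi" "\<beta> + e \<noteq> \<beta>" "\<bar>\<beta> + e - \<alpha>'\<bar> < 2 * pi" "\<beta> + e \<noteq> \<alpha>'"
        using e prm(1-4) by linarith+
      hence "cis (\<beta> + e) \<noteq> cis \<beta>" "cis (\<beta> + e) \<noteq> cis \<alpha>'"
        using cis_eq_near[of "\<beta> + e" \<beta>] cis_eq_near[of "\<beta> + e" \<alpha>'] by blast+
      thus "spot x (\<beta> + e) \<notin> path_image J" using onJ prm by simp
      have "\<bar>\<beta> + 2 * pi - e - \<beta>\<bar> < 2 * pi" "\<beta> + 2 * pi - e \<noteq> \<beta>"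
        "\<bar>\<beta> + 2 * pi - e - \<alpha>'\<bar> < 2 * pi" "\<beta> + 2 * pi - e \<noteq> \<alpha>'"
        using e prm(1-4) by linarith+
      hence "cis (\<beta> + 2 * pi - e) \<noteq> cis \<beta>" "cis (\<beta> + 2 * pi - e) \<noteq> cis \<alpha>'"
        using cis_eq_near[of "\<beta> + 2 * pi - e" \<beta>] cis_eq_near[of "\<beta> + 2 * pi - e" \<alpha>'] by blast+
      hence "spot x (\<beta> + 2 * pi - e) \<notin> path_image J" using onJ prm by simp
      thus "spot x (\<beta> - e) \<notin> path_image J" using period(2)[of "\<beta> - e"] by (simp add: algebra_simps)
    qed
    have Rm: "W (spot x (\<beta> - e)) = R"
      using R[OF offJ(1)] R[OF offJ(2)] jump by (elim disjE) simp_all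
    have "S x w \<longleftrightarrow> W (spot x \<theta>') = R" by (simp add: S_def prm(7) \<theta>_def)
    also have "\<dots> \<longleftrightarrow> \<alpha>' < \<theta>'"
    proof (cases "\<alpha>' < \<theta>'")
      case True
      have "W (spot x \<theta>') = W (spot x (\<beta> + 2 * pi - e))"
        using True e prm by (intro arcconst) auto
      thus ?thesis using True Rm per_e by simp
    next
      case False
      hence "\<theta>' < \<alpha>'" using prm by simp
      have "W (spot x (\<beta> + e)) = W (spot x \<theta>')"
        using \<open>\<theta>' < \<alpha>'\<close> e prm by (intro arcconst) auto
      hence "W (spot x \<theta>') = R + 1" using Rm jump by metis
      moreover have "R + 1 \<noteq> R" by simp
      ultimately show ?thesis using False by metis
    qed
    finally show "S (v (Suc i)) w = cyc (ang (v (Suc i)) (v i)) (ang (v (Suc i)) w) (ang (v (Suc i)) (v (Suc (Suc i))))"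
      using cyc_iff by (simp only: x_def \<alpha>_def \<beta>_def \<theta>_def)
  qed
qed

end

section \<open>Rooted spanning trees\<close>

locale rooted_graph =
  fixes V :: "'a set" and E :: "('a \<times> 'a) set" and u :: 'a and par :: "'a \<Rightarrow> 'a" and dep :: "'a \<Rightarrow> nat"
  assumes finV: "finite V" and EV: "(x, y) \<in> E \<Longrightarrow> x \<in> V \<and> y \<in> V"
    and Esym: "(x, y) \<in> E \<Longrightarrow> (y, x) \<in> E" and Eirr: "(x, x) \<notin> E"
    and rootV: "u \<in> V" and dep_root: "dep u = 0"
    and par: "x \<in> V \<Longrightarrow> x \<noteq> u \<Longrightarrow> (x, par x) \<in> E \<and> dep x = Suc (dep (par x))"
    and nontrivial: "\<exists>x\<in>V. x \<noteq> u"
begin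

definition tr :: "'a \<Rightarrow> 'a \<Rightarrow> bool" where
  "tr x y \<longleftrightarrow> x \<in> V \<and> x \<noteq> u \<and> y = par x \<or> y \<in> V \<and> y \<noteq> u \<and> x = par y"

lemma tr_sym: "tr x y \<longleftrightarrow> tr y x" by (auto simp: tr_def)

lemma tr_E: "tr x y \<Longrightarrow> (x, y) \<in> E" using par Esym by (auto simp: tr_def)

lemma finE: "finite E"
  using finV EV by (intro finite_subset[of E "V \<times> V"]) auto

definition anc :: "'a \<Rightarrow> 'a set" where "anc x = {(par ^^ i) x | i. i \<le> dep x}"

lemma anc_self: "x \<in> anc x" by (auto simp: anc_def intro!: exI[of _ 0])

lemma anc_step:
  assumes "x \<in> V" "x \<noteq> u" shows "anc x = insert x (anc (par x))"
proof -
  have d: "dep x = Suc (dep (par x))" using par assms by blast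
  show ?thesis
  proof
    show "anc x \<subseteq> insert x (anc (par x))"
    proof
      fix y assume "y \<in> anc x"
      then obtain i where i: "y = (par ^^ i) x" "i \<le> dep x" by (auto simp: anc_def)
      show "y \<in> insert x (anc (par x))"
      proof (cases i)
        case (Suc j)
        hence "y = (par ^^ j) (par x)" using i by (simp add: funpow_swap1)
        thus ?thesis using i Suc d by (auto simp: anc_def)
      qed (use i in simp)
    qed
    show "insert x (anc (par x)) \<subseteq> anc x"
    proof
      fix y assume "y \<in> insert x (anc (par x))"
      thus "y \<in> anc x"
      proof
        assume "y \<in> anc (par x)"
        then obtain i where i: "y = (par ^^ i) (par x)" "i \<le> dep (par x)" by (auto simp: anc_def)
        hence "y = (par ^^ Suc i) x" "Suc i \<le> dep x" using d by (simp_all add: funpow_swap1)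
        thus ?thesis unfolding anc_def by blast
      qed (use anc_self in simp)
    qed
  qed
qed

lemma dep_par: "x \<in> V \<Longrightarrow> x \<noteq> u \<Longrightarrow> dep (par x) < dep x" using par[of x] by simp

lemma anc_root: "anc u = {u}" by (auto simp: anc_def dep_root)

lemma parV: "x \<in> V \<Longrightarrow> x \<noteq> u \<Longrightarrow> par x \<in> V" using par EV by blast

lemma root_anc: "x \<in> V \<Longrightarrow> u \<in> anc x"
proof (induction "dep x" arbitrary: x rule: less_induct)
  case less
  show ?case
  proof (cases "x = u")
    case False
    have "dep (par x) < dep x" using dep_par less.prems False by blast
    thus ?thesis using less False parV anc_step by auto
  qed (simp add: anc_self)
qed

lemma anc_V: "x \<in> V \<Longrightarrow> anc x \<subseteq> V"
proof (induction "dep x" arbitrary: x rule: less_induct)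
  case less
  show ?case
  proof (cases "x = u")
    case True thus ?thesis using anc_root rootV by simp
  next
    case False
    have "dep (par x) < dep x" using dep_par less.prems False by blast
    thus ?thesis using less False parV anc_step by auto
  qed
qed

lemma has_neighbour: "x \<in> V \<Longrightarrow> \<exists>y. (x, y) \<in> E"
proof (cases "x = u")
  case True
  obtain y where y: "y \<in> V" "y \<noteq> u" using nontrivial by blast
  have "\<exists>z. (u, z) \<in> E" using y
  proof (induction "dep y" arbitrary: y rule: less_induct)
    case less
    show ?case
    proof (cases "par y = u")
      case True thus ?thesis using par[OF less.prems] Esym by auto
    next
      case False
      thus ?thesis using less par[OF less.prems] parV[OF less.prems] by auto
    qed
  qed
  thus ?thesis using True by simp
qed (use par in blast)

lemma tree_connected: "x \<in> V \<Longrightarrow> (x, u) \<in> {(x, y). tr x y}\<^sup>*"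
proof (induction "dep x" arbitrary: x rule: less_induct)
  case less
  show ?case
  proof (cases "x = u")
    case False
    have "dep (par x) < dep x" using dep_par less.prems False by blast
    hence "(par x, u) \<in> {(x, y). tr x y}\<^sup>*" using less False parV by auto
    moreover have "tr x (par x)" using less.prems False by (simp add: tr_def)
    ultimately show ?thesis by (auto intro: converse_rtrancl_into_rtrancl)
  qed simp
qed

lemma card_tree_arcs: "card {(x, y). tr x y} = 2 * (card V - 1)"
proof -
  let ?A = "(\<lambda>x. (x, par x)) ` (V - {u})" and ?B = "(\<lambda>x. (par x, x)) ` (V - {u})"
  have "{(x, y). tr x y} = ?A \<union> ?B" by (auto simp: tr_def)
  moreover have "?A \<inter> ?B = {}"
  proof -
    have "dep (snd d) < dep (fst d)" if "d \<in> ?A" for d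
      using that by (elim imageE) (simp add: dep_par)
    moreover have "dep (fst d) < dep (snd d)" if "d \<in> ?B" for d
      using that by (elim imageE) (simp add: dep_par)
    ultimately show ?thesis by (meson disjoint_iff order_less_asym)
  qed
  moreover have "card ?A = card (V - {u})" by (intro card_image) (auto simp: inj_on_def)
  moreover have "card ?B = card (V - {u})" by (intro card_image) (auto simp: inj_on_def)
  ultimately show ?thesis using finV rootV by (simp add: card_Un_disjoint)
qed

end

lemma rtrancl_distinct_path:
  assumes "(x, y) \<in> R\<^sup>*"
  shows "\<exists>vs. vs \<noteq> [] \<and> hd vs = x \<and> last vs = y \<and> distinct vs \<and> (\<forall>i. Suc i < length vs \<longrightarrow> (vs ! i, vs ! Suc i) \<in> R)"
  using assms
proof (induction rule: converse_rtrancl_induct)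
  case base
  show ?case by (intro exI[of _ "[y]"]) auto
next
  case (step x z)
  then obtain vs where vs: "vs \<noteq> []" "hd vs = z" "last vs = y" "distinct vs"
    "\<And>i. Suc i < length vs \<Longrightarrow> (vs ! i, vs ! Suc i) \<in> R" by blast
  show ?case
  proof (cases "x \<in> set vs")
    case False
    have "(((x # vs) ! i, (x # vs) ! Suc i) \<in> R)" if "Suc i < length (x # vs)" for i
      using that vs step(1) by (cases i) (auto simp: hd_conv_nth)
    thus ?thesis using vs False by (intro exI[of _ "x # vs"]) auto
  next
    case True
    then obtain k where k: "k < length vs" "vs ! k = x" by (auto simp: in_set_conv_nth)
    show ?thesis
      using k vs by (intro exI[of _ "drop k vs"]) (auto simp: hd_drop_conv_nth)
  qed
qed

section \<open>The contour word of a spanning tree\<close>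

text \<open>
  \<open>\<sigma> x\<close> is the counterclockwise rotation of the neighbours of \<open>x\<close>, given by the directions \<open>ang x\<close>: nothing
  lies strictly between a neighbour and its successor, and the rotation is a single cycle.
\<close>

locale rotation_tree = rooted_graph +
  fixes \<sigma> :: "'a \<Rightarrow> 'a \<Rightarrow> 'a" and ang :: "'a \<Rightarrow> 'a \<Rightarrow> real"
  assumes ang_inj: "inj_on (ang x) {y. (x, y) \<in> E}"
    and \<sigma>_bij: "bij_betw (\<sigma> x) {y. (x, y) \<in> E} {y. (x, y) \<in> E}"
    and \<sigma>_next: "(x, y) \<in> E \<Longrightarrow> (x, z) \<in> E \<Longrightarrow> \<not> cyc (ang x y) (ang x z) (ang x (\<sigma> x y))"
    and \<sigma>_single: "A \<subseteq> {y. (x, y) \<in> E} \<Longrightarrow> A \<noteq> {} \<Longrightarrow> (\<And>y. y \<in> A \<Longrightarrow> \<sigma> x y \<in> A) \<Longrightarrow> A = {y. (x, y) \<in> E}"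
begin

text \<open>
  One step of the walk around the tree. A tree arc is traversed, and the walk goes on with the next
  arc at its far end; a chord is only noted, and the walk turns to the next arc at the same vertex.
\<close>

definition nxt :: "'a \<times> 'a \<Rightarrow> 'a \<times> 'a" where
  "nxt d = (let (x, y) = d in if tr x y then (y, \<sigma> y x) else (x, \<sigma> x y))"

lemma \<sigma>E: "(x, y) \<in> E \<Longrightarrow> (x, \<sigma> x y) \<in> E"
  using \<sigma>_bij[of x] by (auto simp: bij_betw_def)

lemma \<sigma>inj: "(x, y) \<in> E \<Longrightarrow> (x, z) \<in> E \<Longrightarrow> \<sigma> x y = \<sigma> x z \<Longrightarrow> y = z"
  using \<sigma>_bij[of x] by (auto simp: bij_betw_def inj_on_def)

lemma nxtE: "d \<in> E \<Longrightarrow> nxt d \<in> E"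
  using \<sigma>E Esym by (cases d) (auto simp: nxt_def)

lemma nxt_inj: "inj_on nxt E"
proof (rule inj_onI)
  fix d e assume de: "d \<in> E" "e \<in> E" "nxt d = nxt e"
  obtain x y x' y' where d: "d = (x, y)" and e: "e = (x', y')" by (cases d, cases e)
  show "d = e"
    using de \<sigma>inj Esym tr_sym unfolding d e nxt_def by (auto split: if_splits) (metis Esym \<sigma>inj tr_sym)+
qed

text \<open>
  An orbit that enters a vertex from its parent comes back to the parent: by induction from the
  deepest level upwards, it returns from each child and hence turns through all arcs at the
  vertex. So a single orbit contains all arcs.
\<close>

lemma orbit_all:
  assumes O: "O' \<subseteq> E" "\<And>d. d \<in> O' \<Longrightarrow> nxt d \<in> O'" and d0: "(u, w0) \<in> O'"
  shows "O' = E"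
proof -
  define D where "D = Max (dep ` V)"
  have D: "dep x \<le> D" if "x \<in> V" for x using that finV by (simp add: D_def)
  have sub: "(x, y) \<in> O'" if "x \<in> V" "x \<noteq> u" "(par x, x) \<in> O'" "(x, y) \<in> E" for x y
    using that
  proof (induction "D - dep x" arbitrary: x y rule: less_induct)
    case less
    define A where "A = {w. (x, w) \<in> E \<and> (x, w) \<in> O'}"
    have trp: "tr x (par x)" "tr (par x) x" using less.prems by (auto simp: tr_def)
    have st: "\<sigma> x (par x) \<in> A"
      using O(2)[OF less.prems(3)] trp \<sigma>E[of x "par x"] par[OF less.prems(1,2)] by (simp add: nxt_def A_def)
    have "\<sigma> x w \<in> A" if w: "w \<in> A" for w
    proof (cases "w = par x")
      case False
      show ?thesis
      proof (cases "tr x w")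
        case True
        hence wp: "w \<in> V" "w \<noteq> u" "par w = x" using False by (auto simp: tr_def)
        have "dep w = Suc (dep x)" using par wp by auto
        hence "D - dep w < D - dep x" using D[OF wp(1)] by simp
        hence "(w, x) \<in> O'" using less.hyps[of w x] wp w Esym by (auto simp: A_def)
        thus ?thesis using O(2)[of "(w, x)"] True tr_sym \<sigma>E w by (auto simp: nxt_def A_def)
      next
        case False
        thus ?thesis using O(2)[of "(x, w)"] w \<sigma>E by (auto simp: nxt_def A_def)
      qed
    qed (use st in simp)
    hence "A = {w. (x, w) \<in> E}" using st by (intro \<sigma>_single) (auto simp: A_def)
    thus ?case using less.prems by (auto simp: A_def)
  qed
  have child: "(x, par x) \<in> O'" if "x \<in> V" "x \<noteq> u" "(par x, x) \<in> O'" for x using sub that par by blast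
  have root: "(u, w) \<in> O'" if "(u, w) \<in> E" for w
  proof -
    define A where "A = {w. (u, w) \<in> E \<and> (u, w) \<in> O'}"
    have "\<sigma> u w \<in> A" if w: "w \<in> A" for w
    proof (cases "tr u w")
      case True
      hence wp: "w \<in> V" "w \<noteq> u" "par w = u" by (auto simp: tr_def)
      hence "(w, u) \<in> O'" using child[of w] w by (auto simp: A_def)
      thus ?thesis using O(2)[of "(w, u)"] True tr_sym \<sigma>E w by (auto simp: nxt_def A_def)
    next
      case False
      thus ?thesis using O(2)[of "(u, w)"] w \<sigma>E by (auto simp: nxt_def A_def)
    qed
    hence "A = {w. (u, w) \<in> E}" using d0 O(1) by (intro \<sigma>_single) (auto simp: A_def)
    thus ?thesis using that by (auto simp: A_def)
  qed
  have "(x, y) \<in> O'" if "(x, y) \<in> E" for x y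
    using that
  proof (induction "dep x" arbitrary: x y rule: less_induct)
    case less
    have xV: "x \<in> V" using EV less.prems by blast
    show ?case
    proof (cases "x = u")
      case False
      have "(par x, x) \<in> O'" using less.hyps[of "par x" x] par[OF xV False] Esym by auto
      thus ?thesis using sub xV False less.prems by blast
    qed (use root less.prems in simp)
  qed
  thus ?thesis using O(1) by auto
qed

lemma contour_word:
  obtains W :: "nat \<Rightarrow> 'a \<times> 'a" where "\<And>k. W (Suc k) = nxt (W k)" "\<And>k. W (k + card E) = W k"
    "bij_betw W {..<card E} E" "fst (W 0) = u"
proof -
  obtain w0 where w0: "(u, w0) \<in> E" using has_neighbour rootV by blast
  define W where "W k = (nxt ^^ k) (u, w0)" for k
  have WE: "W k \<in> E" for k by (induction k) (auto simp: W_def w0 nxtE)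
  have WS: "W (Suc k) = nxt (W k)" for k by (simp add: W_def)
  have "range W = E"
  proof (rule orbit_all)
    show "range W \<subseteq> E" using WE by blast
    show "nxt d \<in> range W" if d: "d \<in> range W" for d
    proof -
      obtain k where "d = W k" using d by blast
      hence "nxt d = W (Suc k)" by (simp add: WS)
      thus ?thesis by blast
    qed
    show "(u, w0) \<in> range W" by (rule range_eqI[of _ W 0]) (simp add: W_def)
  qed
  have shift: "W (j - i) = W 0" if "W i = W j" "i \<le> j" for i j
    using that
  proof (induction i arbitrary: j)
    case (Suc i)
    then obtain j' where j: "j = Suc j'" by (cases j) auto
    have "W i = W j'" using inj_onD[OF nxt_inj _ WE WE] Suc.prems j WS by metis
    thus ?case using Suc j by simp
  qed simp
  have "\<not> inj W" using \<open>range W = E\<close> finE by (metis finite_imageD infinite_UNIV_nat)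
  then obtain i j where "i < j" "W i = W j" by (metis injI linorder_neqE_nat)
  hence "W (j - i) = W 0 \<and> 0 < j - i" using shift by simp
  define P where "P = (LEAST k. W k = W 0 \<and> 0 < k)"
  have P: "W P = W 0" "0 < P" and Pmin: "\<And>k. W k = W 0 \<Longrightarrow> 0 < k \<Longrightarrow> P \<le> k"
    using LeastI[of "\<lambda>k. W k = W 0 \<and> 0 < k", OF \<open>W (j - i) = W 0 \<and> 0 < j - i\<close>] 
    by (auto simp: P_def intro: Least_le)
  have per: "W (k + P) = W k" for k by (induction k) (auto simp: P WS)
  have inj: "inj_on W {..<P}"
  proof (rule inj_onI, rule ccontr)
    fix i j assume ij: "i \<in> {..<P}" "j \<in> {..<P}" "W i = W j" "i \<noteq> j"
    show False
    proof (cases "i < j")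
      case True
      thus False using shift[OF ij(3)] Pmin[of "j - i"] ij by auto
    next
      case False
      thus False using shift[OF ij(3)[symmetric]] Pmin[of "i - j"] ij by auto
    qed
  qed
  have modP: "W k = W (k mod P)" for k
  proof (induction k rule: less_induct)
    case (less k)
    show ?case
    proof (cases "k < P")
      case False
      hence "W k = W (k - P)" using per[of "k - P"] by simp
      also have "\<dots> = W ((k - P) mod P)" using less[of "k - P"] False P by simp
      finally show ?thesis using False by (simp add: le_mod_geq)
    qed simp
  qed
  have "W ` {..<P} = E"
  proof -
    have "range W \<subseteq> W ` {..<P}"
    proof
      fix d assume "d \<in> range W"
      then obtain k where "d = W k" by blast
      thus "d \<in> W ` {..<P}" using modP[of k] P by auto
    qed
    thus ?thesis using \<open>range W = E\<close> by auto
  qed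
  moreover from this have "card E = P" using card_image[OF inj] by simp
  ultimately show ?thesis using that[of W] WS per inj by (auto simp: bij_betw_def W_def)
qed

lemma \<sigma>_other: "(x, p) \<in> E \<Longrightarrow> (x, q) \<in> E \<Longrightarrow> p \<noteq> q \<Longrightarrow> \<sigma> x p \<noteq> p"
  using \<sigma>_single[of "{p}" x] by auto

lemma cyc_facts:
  "cyc a b c \<Longrightarrow> cyc b c a" "cyc a b c \<Longrightarrow> \<not> cyc a c b"
  "a \<noteq> b \<Longrightarrow> b \<noteq> c \<Longrightarrow> a \<noteq> c \<Longrightarrow> \<not> cyc a b c \<Longrightarrow> cyc a c b"
  "cyc p y q \<Longrightarrow> cyc y w q \<Longrightarrow> cyc p w q"
  by (auto simp: cyc_def)

text \<open>
  \<open>F\<close> is the set of arcs of a directed cycle and \<open>S\<close> its right-hand side; only these properties are required of them, so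
  that the lemma also applies to the reversed cycle with the complementary side. After arriving
  along the cycle, or looking along an arc on the right, the counterclockwise turn leads to an arc
  on the right or to the forward arc of the cycle, because the sector on the right ends
  with the forward arc.
\<close>

lemma right_step:
  assumes FE: "F \<subseteq> E"
    and F1: "\<And>p x p'. (p, x) \<in> F \<Longrightarrow> (p', x) \<in> F \<Longrightarrow> p = p'"
    and F2: "\<And>x q q'. (x, q) \<in> F \<Longrightarrow> (x, q') \<in> F \<Longrightarrow> q = q'"
    and F3: "\<And>x. x \<in> Domain F \<longleftrightarrow> x \<in> Range F"
    and F4: "\<And>p x q. (p, x) \<in> F \<Longrightarrow> (x, q) \<in> F \<Longrightarrow> p \<noteq> q"
    and S2: "\<And>x y z. (x, y) \<in> E \<Longrightarrow> (x, z) \<in> E \<Longrightarrow> x \<notin> Domain F \<Longrightarrow> S x y = S x z"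
    and S3: "\<And>p x q w. (p, x) \<in> F \<Longrightarrow> (x, q) \<in> F \<Longrightarrow> (x, w) \<in> E \<Longrightarrow> w \<noteq> p \<Longrightarrow> w \<noteq> q \<Longrightarrow>
      S x w = cyc (ang x p) (ang x w) (ang x q)"
    and xy: "(x, y) \<in> E"
    and inc: "(y, x) \<in> F \<or> (x, y) \<notin> F \<union> F\<inverse> \<and> S x y"
  shows "(x, \<sigma> x y) \<in> F \<or> (x, \<sigma> x y) \<notin> F \<union> F\<inverse> \<and> S x (\<sigma> x y)"
proof (cases "x \<in> Domain F")
  case False
  hence "x \<notin> Range F" using F3 by blast
  thus ?thesis using False inc S2[OF xy \<sigma>E[OF xy]] by auto
next
  case True
  then obtain p q where pq: "(p, x) \<in> F" "(x, q) \<in> F" using F3 by blast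
  have E: "(x, p) \<in> E" "(x, q) \<in> E" "(x, \<sigma> x y) \<in> E" using pq FE Esym \<sigma>E[OF xy] by blast+
  have pqne: "p \<noteq> q" using F4 pq by blast
  have neq: "ang x a \<noteq> ang x b" if "(x, a) \<in> E" "(x, b) \<in> E" "a \<noteq> b" for a b
    using ang_inj[of x] that by (auto simp: inj_on_def)
  have y: "y = p \<or> y \<noteq> p \<and> y \<noteq> q \<and> cyc (ang x p) (ang x y) (ang x q)"
    using inc pq F1 S3[OF pq xy] by blast
  define w where "w = \<sigma> x y"
  have wy: "w \<noteq> y" using \<sigma>_other[OF xy E(1)] \<sigma>_other[OF xy E(2)] pqne unfolding w_def by metis
  have Ew: "(x, w) \<in> E" using E(3) by (simp add: w_def)
  have nb: "\<not> cyc (ang x y) (ang x q) (ang x w)" unfolding w_def by (rule \<sigma>_next[OF xy E(2)])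
  show ?thesis
  proof (cases "w = q")
    case True thus ?thesis using pq w_def by simp
  next
    case wq: False
    have wp: "w \<noteq> p"
    proof
      assume "w = p"
      hence "y \<noteq> p" using wy by simp
      thus False using y nb \<open>w = p\<close> cyc_facts(1) by blast
    qed
    have "cyc (ang x p) (ang x w) (ang x q)"
    proof (cases "y = p")
      case True
      thus ?thesis
        using cyc_facts(3)[OF neq[OF E(1,2) pqne] neq[OF E(2) Ew not_sym[OF wq]] neq[OF E(1) Ew not_sym[OF wp]]] nb
        by simp
    next
      case False
      hence "y \<noteq> q" using y by blast
      hence "cyc (ang x y) (ang x w) (ang x q)"
        using cyc_facts(3)[OF neq[OF xy E(2)] neq[OF E(2) Ew not_sym[OF wq]] neq[OF xy Ew not_sym[OF wy]]] nb
        by simp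
      thus ?thesis using y False cyc_facts(4) by blast
    qed
    hence "S x w" using S3[OF pq _ wp wq] E by (simp add: w_def)
    moreover have "(x, w) \<notin> F \<union> F\<inverse>" using wp wq pq F1 F2 by blast
    ultimately show ?thesis by (simp add: w_def)
  qed
qed

text \<open>
  From the chord \<open>(z, z')\<close> on, the contour follows the cycle forwards or stays on its right, until the
  opposite arc \<open>(z', z)\<close> comes up: the cycle has no other chord at which the walk could fail to traverse
  a forward arc.
\<close>

lemma right_run:
  assumes FE: "F \<subseteq> E"
    and F1: "\<And>p x p'. (p, x) \<in> F \<Longrightarrow> (p', x) \<in> F \<Longrightarrow> p = p'"
    and F2: "\<And>x q q'. (x, q) \<in> F \<Longrightarrow> (x, q') \<in> F \<Longrightarrow> q = q'"
    and F3: "\<And>x. x \<in> Domain F \<longleftrightarrow> x \<in> Range F"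
    and F4: "\<And>p x q. (p, x) \<in> F \<Longrightarrow> (x, q) \<in> F \<Longrightarrow> p \<noteq> q"
    and F5: "\<And>x y. (x, y) \<in> F \<Longrightarrow> (x, y) = (z', z) \<or> tr x y"
    and F6: "(z', z) \<in> F" "\<not> tr z z'"
    and S1: "\<And>x y. (x, y) \<in> E \<Longrightarrow> (x, y) \<notin> F \<union> F\<inverse> \<Longrightarrow> S x y = S y x"
    and S2: "\<And>x y z. (x, y) \<in> E \<Longrightarrow> (x, z) \<in> E \<Longrightarrow> x \<notin> Domain F \<Longrightarrow> S x y = S x z"
    and S3: "\<And>p x q w. (p, x) \<in> F \<Longrightarrow> (x, q) \<in> F \<Longrightarrow> (x, w) \<in> E \<Longrightarrow> w \<noteq> p \<Longrightarrow> w \<noteq> q \<Longrightarrow>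
      S x w = cyc (ang x p) (ang x w) (ang x q)"
    and W: "\<And>k. W (Suc k) = nxt (W k)" "\<And>k. W k \<in> E" "W i = (z, z')"
    and no: "\<And>s. 0 < s \<Longrightarrow> s < t \<Longrightarrow> W (i + s) \<noteq> (z', z)" and t: "0 < t"
  shows "W (i + t) \<in> F \<or> W (i + t) \<notin> F \<union> F\<inverse> \<and> case_prod S (W (i + t))"
  using no t
proof (induction t)
  case (Suc t)
  note step = right_step[of F S, OF FE F1 F2 F3 F4 S2 S3]
  show ?case
  proof (cases "t = 0")
    case True
    have "(z, z') \<in> E" using F6 FE Esym by blast
    hence "(z, \<sigma> z z') \<in> F \<or> (z, \<sigma> z z') \<notin> F \<union> F\<inverse> \<and> S z (\<sigma> z z')"
      using F6(1) by (intro step) auto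
    thus ?thesis using W(1)[of i] W(3) F6(2) True by (simp add: nxt_def)
  next
    case False
    obtain x y where d: "W (i + t) = (x, y)" by (cases "W (i + t)")
    have xy: "(x, y) \<in> E" using W(2)[of "i + t"] d by simp
    have IH: "(x, y) \<in> F \<or> (x, y) \<notin> F \<union> F\<inverse> \<and> S x y" using Suc False d by auto
    have stop: "(x, y) \<noteq> (z', z)" using Suc.prems(1)[of t] False d by simp
    have WS: "W (i + Suc t) = nxt (x, y)" using W(1)[of "i + t"] d by simp
    show ?thesis
    proof (cases "tr x y")
      case True
      have "(x, y) \<in> F \<or> (y, x) \<notin> F \<union> F\<inverse> \<and> S y x" using IH S1[OF xy] by blast
      hence "(y, \<sigma> y x) \<in> F \<or> (y, \<sigma> y x) \<notin> F \<union> F\<inverse> \<and> S y (\<sigma> y x)" using Esym[OF xy] by (intro step) auto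
      thus ?thesis using WS True by (simp add: nxt_def)
    next
      case False
      hence "(x, y) \<notin> F" using F5 stop by blast
      hence "(x, y) \<notin> F \<union> F\<inverse> \<and> S x y" using IH by blast
      hence "(x, \<sigma> x y) \<in> F \<or> (x, \<sigma> x y) \<notin> F \<union> F\<inverse> \<and> S x (\<sigma> x y)" using xy by (intro step) auto
      thus ?thesis using WS False by (simp add: nxt_def)
    qed
  qed
qed simp

section \<open>Chords do not cross\<close>

lemma fundamental_cycle:
  assumes zz: "(z, z') \<in> E" and nt: "\<not> tr z z'"
  obtains m v where "is_cycle E m v" "v 0 = z" "v (m - 1) = z'"
    "\<And>i. (v i, v (Suc i)) = (z', z) \<or> tr (v i) (v (Suc i))"
proof -
  let ?T = "{(x, y). tr x y}"
  have "sym ?T" using tr_sym by (auto simp: sym_def)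
  hence "sym (?T\<^sup>*)" by (rule sym_rtrancl)
  hence "(u, z') \<in> ?T\<^sup>*" using tree_connected[of z'] EV[OF zz] by (auto dest: symD)
  moreover have "(z, u) \<in> ?T\<^sup>*" using tree_connected[of z] EV[OF zz] by blast
  ultimately have "(z, z') \<in> ?T\<^sup>*" by (rule rtrancl_trans[rotated])
  then obtain vs where vs: "vs \<noteq> []" "hd vs = z" "last vs = z'" "distinct vs"
    "\<And>i. Suc i < length vs \<Longrightarrow> (vs ! i, vs ! Suc i) \<in> ?T"
    using rtrancl_distinct_path[of z z' ?T] by blast
  define m where "m = length vs"
  define v where "v i = vs ! (i mod m)" for i
  have m0: "m > 0" using vs by (simp add: m_def)
  have ends: "v 0 = z" "v (m - 1) = z'" using vs m0 by (simp_all add: v_def m_def hd_conv_nth last_conv_nth)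
  have m1: "m \<noteq> 1" using ends Eirr zz by auto
  have "m \<noteq> 2"
  proof
    assume "m = 2"
    hence "tr (v 0) (v 1)" using vs(5)[of 0] by (simp add: v_def m_def)
    thus False using ends nt \<open>m = 2\<close> by simp
  qed
  hence m3: "3 \<le> m" using m0 m1 by linarith
  have step: "(v i, v (Suc i)) = (z', z) \<or> tr (v i) (v (Suc i))" for i
  proof (cases "Suc (i mod m) = m")
    case True
    hence "i mod m = m - 1" by simp
    hence "v i = z'" using ends(2) m0 by (simp add: v_def)
    moreover have "Suc i mod m = 0" using True by (metis mod_Suc)
    ultimately show ?thesis using ends(1) by (simp add: v_def)
  next
    case False
    hence "Suc i mod m = Suc (i mod m)" by (simp add: mod_Suc)
    moreover have "Suc (i mod m) < m" using False m0 mod_less_divisor[of m i] by linarith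
    ultimately show ?thesis using vs(5)[of "i mod m"] by (simp add: v_def m_def)
  qed
  have "is_cycle E m v" unfolding is_cycle_def
  proof (intro conjI allI m3)
    show "v (i + m) = v i" for i by (simp add: v_def)
    show "inj_on v {..<m}" using vs(4) by (auto simp: inj_on_def v_def m_def nth_eq_iff_index_eq)
    show "(v i, v (Suc i)) \<in> E" for i using step[of i] Esym[OF zz] tr_E by auto
  qed
  thus ?thesis using that ends step by blast
qed

text \<open>
  The chord \<open>(z, z')\<close> closes the tree path from \<open>z\<close> to \<open>z'\<close> to a cycle. Between the positions \<open>i\<close> and \<open>j\<close> the word
  lies on the right of this cycle, and in the rest of the period, by the same argument for the
  reversed cycle, on its left. The two occurrences of another chord are on the same side.
\<close>

lemma noncrossing:
  assumes sides: "\<And>m v. is_cycle E m v \<Longrightarrow> \<exists>S. is_side E ang v S"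
    and W: "\<And>k. W (Suc k) = nxt (W k)" "\<And>k. W (k + N) = W k" "bij_betw W {..<N} E"
    and ikj: "i < k" "k < j" "j < N" "l < N"
    and Wi: "W i = (z, z')" and Wj: "W j = (z', z)" and nt: "\<not> tr z z'"
    and Wk: "W k = (a, b)" and Wl: "W l = (b, a)" and ab: "\<not> tr a b"
  shows "i < l \<and> l < j"
proof -
  have WE: "W k \<in> E" for k
  proof (induction k rule: less_induct)
    case (less k)
    show ?case
    proof (cases "k < N")
      case True thus ?thesis using W(3) by (auto simp: bij_betw_def)
    next
      case False
      thus ?thesis using less[of "k - N"] W(2)[of "k - N"] ikj by simp
    qed
  qed
  have Winj: "p = q" if "W p = W q" "p < N" "q < N" for p q
    using W(3) that by (auto simp: bij_betw_def inj_on_def)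
  have zz: "(z, z') \<in> E" using WE[of i] Wi by simp
  have abE: "(a, b) \<in> E" using WE[of k] Wk by simp
  obtain m v where cy: "is_cycle E m v" and v0: "v 0 = z" "v (m - 1) = z'"
    and fw: "\<And>i. (v i, v (Suc i)) = (z', z) \<or> tr (v i) (v (Suc i))"
    using fundamental_cycle[OF zz nt] by blast
  obtain S where S: "is_side E ang v S" using sides[OF cy] by blast
  note S1 = S[unfolded is_side_def, THEN conjunct1, rule_format]
    and S2 = S[unfolded is_side_def, THEN conjunct2, THEN conjunct1, rule_format]
    and S3 = S[unfolded is_side_def, THEN conjunct2, THEN conjunct2, rule_format]
  define F where "F = range (\<lambda>i. (v i, v (Suc i)))"
  have cE: "(v i, v (Suc i)) \<in> E" for i using cy by (simp add: is_cycle_def)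
  have m: "m > 0" "v m = v 0" and per: "\<And>i. v (i + m) = v i"
    using cy by (auto simp: is_cycle_def dest: spec[of _ 0])
  have FE: "F \<subseteq> E" using cE by (auto simp: F_def)
  have F1: "p = p'" if "(p, x) \<in> F" "(p', x) \<in> F" for p x p'
    using that cycle_Suc[OF cy] unfolding F_def by auto
  have F2: "q = q'" if "(x, q) \<in> F" "(x, q') \<in> F" for x q q'
    using that cycle_Suc[OF cy] unfolding F_def by auto
  have dom: "Domain F = range v" by (auto simp: F_def)
  have ran: "Range F = range v"
  proof -
    have "v i \<in> Range F" for i
    proof -
      have "v i = v (Suc (i + (m - 1)))" using per[of i] m(1) by simp
      thus ?thesis unfolding F_def by blast
    qed
    thus ?thesis by (auto simp: F_def)
  qed
  have F4: "p \<noteq> q" if pq: "(p, x) \<in> F" "(x, q) \<in> F" for p x q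
  proof -
    obtain i j where ij: "p = v i" "x = v (Suc i)" "x = v j" "q = v (Suc j)" using pq by (auto simp: F_def)
    hence "q = v (Suc (Suc i))" using cycle_Suc[OF cy, of j "Suc i"] by simp
    thus ?thesis using ij cycle_prev_next[OF cy] by simp
  qed
  have F5: "(x, y) = (z', z) \<or> tr x y" if "(x, y) \<in> F" for x y
    using that fw unfolding F_def by blast
  have F6: "(z', z) \<in> F"
  proof -
    have "(z', z) = (v (m - 1), v (Suc (m - 1)))" using v0 m by simp
    thus ?thesis unfolding F_def by blast
  qed
  have T1: "S x y = S y x" if "(x, y) \<in> E" "(x, y) \<notin> F \<union> F\<inverse>" for x y
  proof -
    have "\<not> on_cycle v x y" using that(2) unfolding on_cycle_def F_def doubleton_eq_iff by blast
    thus ?thesis using S1 that(1) by blast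
  qed
  have T3: "S x w = cyc (ang x p) (ang x w) (ang x q)"
    if pq: "(p, x) \<in> F" "(x, q) \<in> F" and w: "(x, w) \<in> E" "w \<noteq> p" "w \<noteq> q" for p x q w
  proof -
    obtain i j where ij: "p = v i" "x = v (Suc i)" "x = v j" "q = v (Suc j)" using pq by (auto simp: F_def)
    hence "q = v (Suc (Suc i))" using cycle_Suc[OF cy, of j "Suc i"] by simp
    thus ?thesis using S3[of i w] w ij by simp
  qed
  have T2: "S x y = S x z" if "(x, y) \<in> E" "(x, z) \<in> E" "x \<notin> Domain F" for x y z
    using S2 that dom by blast
  have T3': "(\<not> S x w) = cyc (ang x p) (ang x w) (ang x q)"
    if pq: "(p, x) \<in> F\<inverse>" "(x, q) \<in> F\<inverse>" and w: "(x, w) \<in> E" "w \<noteq> p" "w \<noteq> q" for p x q w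
  proof -
    have qp: "(q, x) \<in> F" "(x, p) \<in> F" using pq by auto
    have "q \<noteq> p" using F4 qp by blast
    have E: "(x, p) \<in> E" "(x, q) \<in> E" using qp FE Esym by blast+
    have ne: "ang x p \<noteq> ang x q" "ang x p \<noteq> ang x w" "ang x w \<noteq> ang x q"
      using ang_inj[of x] E w \<open>q \<noteq> p\<close> by (auto simp: inj_on_def)
    have "S x w = cyc (ang x q) (ang x w) (ang x p)" by (rule T3[OF qp w(1,3,2)])
    thus ?thesis using cyc_swap[OF ne(2,3,1)] by simp
  qed
  have Wno: "W (i + s) \<noteq> (z', z)" if "0 < s" "s < k - i" for s
  proof
    assume "W (i + s) = (z', z)"
    hence "i + s = j" using Winj[of "i + s" j] Wj that ikj by simp
    thus False using that ikj by linarith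
  qed
  have kF: "(a, b) \<notin> F"
  proof
    assume "(a, b) \<in> F"
    hence "W k = W j" using F5[of a b] ab Wk Wj by simp
    thus False using Winj[of k j] ikj by simp
  qed
  have "W (i + (k - i)) \<in> F \<or> W (i + (k - i)) \<notin> F \<union> F\<inverse> \<and> case_prod S (W (i + (k - i)))"
    by (rule right_run[of F z' z S, OF FE F1 F2 _ F4 F5 F6 nt T1 T2 T3 W(1) WE Wi Wno]) (use dom ran ikj in auto)
  hence kS: "(a, b) \<notin> F \<union> F\<inverse>" "S a b" using ikj Wk kF by auto
  hence lS: "S b a" using T1 abE by blast
  \<comment> \<open>Running on from \<open>j\<close>, the word stays on the cycle or its left-hand side until it returns to \<open>(z, z')\<close>.\<close>
  have no_left: False if t: "0 < t" "\<And>s. 0 < s \<Longrightarrow> s < t \<Longrightarrow> W (j + s) \<noteq> (z, z')" "W (j + t) = (b, a)" for t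
  proof -
    have "W (j + t) \<in> F\<inverse> \<or> W (j + t) \<notin> F\<inverse> \<union> (F\<inverse>)\<inverse> \<and> case_prod (\<lambda>x y. \<not> S x y) (W (j + t))"
    proof (rule right_run[of "F\<inverse>" z z' "\<lambda>x y. \<not> S x y" W j t])
      show "F\<inverse> \<subseteq> E" using FE Esym by blast
      show "(z, z') \<in> F\<inverse>" using F6 by blast
      show "\<not> tr z' z" using nt by (simp add: tr_sym[of z' z])
      show "(x, y) = (z, z') \<or> tr x y" if "(x, y) \<in> F\<inverse>" for x y using F5[of y x] that tr_sym[of x y] by blast
      show "(x \<in> Domain (F\<inverse>)) = (x \<in> Range (F\<inverse>))" for x using dom ran by simp
      show "(\<not> S x y) = (\<not> S y x)" if "(x, y) \<in> E" "(x, y) \<notin> F\<inverse> \<union> (F\<inverse>)\<inverse>" for x y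
        using T1[of x y] that by blast
      show "(\<not> S x y) = (\<not> S x z)" if "(x, y) \<in> E" "(x, z) \<in> E" "x \<notin> Domain (F\<inverse>)" for x y z
        using T2[of x y z] that dom ran by simp
      show "p = p'" if "(p, x) \<in> F\<inverse>" "(p', x) \<in> F\<inverse>" for p x p' using F2 that by blast
      show "q = q'" if "(x, q) \<in> F\<inverse>" "(x, q') \<in> F\<inverse>" for x q q' using F1 that by blast
      show "p \<noteq> q" if "(p, x) \<in> F\<inverse>" "(x, q) \<in> F\<inverse>" for p x q using F4[of q x p] that by blast
      show "(\<not> S x w) = cyc (ang x p) (ang x w) (ang x q)" if "(p, x) \<in> F\<inverse>" "(x, q) \<in> F\<inverse>"
        "(x, w) \<in> E" "w \<noteq> p" "w \<noteq> q" for p x q w by (rule T3'[OF that])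
    qed (fact W(1) WE Wj t(2) t(1))+
    thus False using t(3) kS lS by auto
  qed
  have "l \<noteq> i"
  proof
    assume "l = i"
    hence "W k = W j" using Wl Wi Wk Wj by simp
    thus False using Winj[of k j] ikj by simp
  qed
  moreover have "l \<noteq> j"
  proof
    assume "l = j"
    hence "W k = W i" using Wl Wi Wk Wj by simp
    thus False using Winj[of k i] ikj by simp
  qed
  moreover have "\<not> j < l"
  proof
    assume jl: "j < l"
    show False
    proof (rule no_left[of "l - j"])
      show "W (j + s) \<noteq> (z, z')" if "0 < s" "s < l - j" for s
      proof
        assume "W (j + s) = (z, z')"
        moreover have "j + s < N" "i < N" using that ikj by linarith+
        ultimately have "j + s = i" using Winj[of "j + s" i] Wi by simp
        thus False using ikj by simp
      qed
      show "0 < l - j" using jl by simp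
      show "W (j + (l - j)) = (b, a)" using jl Wl by simp
    qed
  qed
  moreover have "\<not> l < i"
  proof
    assume li: "l < i"
    show False
    \<comment> \<open>Positions before \<open>i\<close> are reached from \<open>j\<close> by continuing into the next period.\<close>
    proof (rule no_left[of "l + N - j"])
      show "W (j + s) \<noteq> (z, z')" if "0 < s" "s < l + N - j" for s
      proof
        assume eq: "W (j + s) = (z, z')"
        show False
        proof (cases "j + s < N")
          case True
          hence "j + s = i" using Winj[of "j + s" i] Wi eq ikj by simp
          thus False using ikj by simp
        next
          case False
          have "W (j + s - N) = W i" using W(2)[of "j + s - N"] False eq Wi by simp
          moreover have "j + s - N < l" using that False by linarith
          moreover have "j + s - N < N" "i < N" using \<open>j + s - N < l\<close> ikj by linarith+
          ultimately have "j + s - N = i" using Winj[of "j + s - N" i] by simp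
          thus False using \<open>j + s - N < l\<close> li by simp
        qed
      qed
      show "W (j + (l + N - j)) = (b, a)" using W(2)[of l] Wl ikj by simp
      show "0 < l + N - j" using ikj by linarith
    qed
  qed
  ultimately show ?thesis by linarith
qed

end

text \<open>
  One period of the contour, with \<open>cur k\<close> the vertex at which the walk stands before step \<open>k\<close>. The last
  condition is the absence of crossing chords; it is all that is used of planarity from here on.
\<close>

locale contour = rooted_graph +
  fixes W :: "nat \<Rightarrow> 'a \<times> 'a" and cur :: "nat \<Rightarrow> 'a" and N :: nat
  assumes W_bij: "bij_betw W {..<N} E"
    and cur_ends: "cur 0 = u" "cur N = u"
    and cur_fst: "k < N \<Longrightarrow> fst (W k) = cur k"
    and cur_Suc: "k < N \<Longrightarrow> cur (Suc k) = (if tr (fst (W k)) (snd (W k)) then snd (W k) else fst (W k))"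
    and planar: "i < k \<Longrightarrow> k < j \<Longrightarrow> j < N \<Longrightarrow> l < N \<Longrightarrow> W i = (z, z') \<Longrightarrow> W j = (z', z) \<Longrightarrow> \<not> tr z z' \<Longrightarrow>
      W k = (a, b) \<Longrightarrow> W l = (b, a) \<Longrightarrow> \<not> tr a b \<Longrightarrow> i < l \<and> l < j"

theorem contour_exists:
  assumes sd: "star_drawing V E p r ang \<delta>" and rg: "rooted_graph V E u par dep"
  obtains W cur where "contour V E u par dep W cur (card E)"
proof -
  interpret star_drawing V E p r ang \<delta> by (rule sd)
  interpret rooted_graph V E u par dep by (rule rg)
  have "finite {y. (x, y) \<in> E}" for x
    by (rule finite_subset[OF _ finV]) (use EV in blast)
  hence "\<exists>s. bij_betw s {y. (x, y) \<in> E} {y. (x, y) \<in> E} \<and>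
    (\<forall>y z. (x, y) \<in> E \<longrightarrow> (x, z) \<in> E \<longrightarrow> \<not> cyc (ang x y) (ang x z) (ang x (s y))) \<and>
    (\<forall>A. A \<subseteq> {y. (x, y) \<in> E} \<longrightarrow> A \<noteq> {} \<longrightarrow> (\<forall>y\<in>A. s y \<in> A) \<longrightarrow> A = {y. (x, y) \<in> E})" for x
    using cyclic_successor[OF _ ang_inj[of x]] by (metis mem_Collect_eq)
  then obtain \<sigma> where \<sigma>: "\<And>x. bij_betw (\<sigma> x) {y. (x, y) \<in> E} {y. (x, y) \<in> E}"
    "\<And>x y z. (x, y) \<in> E \<Longrightarrow> (x, z) \<in> E \<Longrightarrow> \<not> cyc (ang x y) (ang x z) (ang x (\<sigma> x y))"
    "\<And>x A. A \<subseteq> {y. (x, y) \<in> E} \<Longrightarrow> A \<noteq> {} \<Longrightarrow> (\<And>y. y \<in> A \<Longrightarrow> \<sigma> x y \<in> A) \<Longrightarrow> A = {y. (x, y) \<in> E}"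
    by metis
  interpret rotation_tree V E u par dep \<sigma> ang
    by unfold_locales (fact ang_inj \<sigma>)+
  obtain W where W: "\<And>k. W (Suc k) = nxt (W k)" "\<And>k. W (k + card E) = W k"
    "bij_betw W {..<card E} E" "fst (W 0) = u" using contour_word by blast
  have "contour V E u par dep W (fst \<circ> W) (card E)"
  proof unfold_locales
    show "bij_betw W {..<card E} E" by (rule W(3))
    show "(fst \<circ> W) 0 = u" using W(4) by simp
    show "(fst \<circ> W) (card E) = u" using W(2)[of 0] W(4) by simp
    show "(fst \<circ> W) (Suc k) = (if tr (fst (W k)) (snd (W k)) then snd (W k) else fst (W k))" for k
      by (simp add: W(1) nxt_def split: prod.split)
    show "i < l \<and> l < j" if "i < k" "k < j" "j < card E" "l < card E" "W i = (z, z')" "W j = (z', z)" "\<not> tr z z'"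
      "W k = (a, b)" "W l = (b, a)" "\<not> tr a b" for i k j l z z' a b
    proof (rule noncrossing[OF _ W(1-3) that(1-6) that(7-10)])
      show "\<exists>S. is_side E ang v S" if "is_cycle E m v" for m v by (rule side_function[OF that])
    qed
  qed auto
  thus ?thesis using that by blast
qed

context contour begin

section \<open>Compatible intervals and balanced separators\<close>

text \<open>
  Both occurrences of a chord belong to the interval, or none. Such an interval can be cut at a tree
  arc or at a chord into shorter ones of the same kind, which drives the inductions.
\<close>

definition compat :: "nat \<Rightarrow> nat \<Rightarrow> bool" where
  "compat a b \<longleftrightarrow> a \<le> b \<and> b \<le> N \<and>
    (\<forall>k l x y. a \<le> k \<longrightarrow> k < b \<longrightarrow> l < N \<longrightarrow> W k = (x, y) \<longrightarrow> \<not> tr x y \<longrightarrow> W l = (y, x) \<longrightarrow> a \<le> l \<and> l < b)"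

lemma W_inj: "W k = W l \<Longrightarrow> k < N \<Longrightarrow> l < N \<Longrightarrow> k = l"
  using W_bij by (auto simp: bij_betw_def inj_on_def)

lemma W_in: "k < N \<Longrightarrow> W k \<in> E"
  using W_bij by (auto simp: bij_betw_def)

lemma W_onto: assumes "d \<in> E" obtains k where "k < N" "W k = d"
proof -
  have "d \<in> W ` {..<N}" using assms W_bij by (simp add: bij_betw_def)
  thus ?thesis using that by auto
qed

lemma step_tree: "k < N \<Longrightarrow> W k = (x, y) \<Longrightarrow> tr x y \<Longrightarrow> cur k = x \<and> cur (Suc k) = y"
  using cur_fst[of k] cur_Suc[of k] by simp

lemma step_chord: "k < N \<Longrightarrow> W k = (x, y) \<Longrightarrow> \<not> tr x y \<Longrightarrow> cur k = x \<and> cur (Suc k) = x"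
  using cur_fst[of k] cur_Suc[of k] by simp

lemma compatD: "compat a b \<Longrightarrow> a \<le> k \<Longrightarrow> k < b \<Longrightarrow> l < N \<Longrightarrow> W k = (x, y) \<Longrightarrow> \<not> tr x y \<Longrightarrow> W l = (y, x) \<Longrightarrow> a \<le> l \<and> l < b"
  unfolding compat_def by blast

lemma compat_all: "compat 0 N" by (simp add: compat_def)

lemma compat_tree:
  assumes c: "compat a b" and ab: "a < b" and Wa: "W a = (x, y)" "tr x y"
  shows "compat (Suc a) b"
  unfolding compat_def
proof (intro conjI allI impI)
  fix k l p q assume k: "Suc a \<le> k" "k < b" "l < N" "W k = (p, q)" "\<not> tr p q" "W l = (q, p)"
  have "a \<le> l \<and> l < b" using compatD[OF c _ k(2-6)] k(1) by simp
  moreover have "l \<noteq> a" using k Wa tr_sym by auto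
  ultimately show "Suc a \<le> l" "l < b" by auto
qed (use c ab in \<open>auto simp: compat_def\<close>)

text \<open>
  A compatible interval that begins with a chord is cut at the opposite occurrence of the chord into compatible
  intervals; the inner one is compatible because chords do not cross.
\<close>

lemma chord_mate:
  assumes c: "compat a b" and ab: "a < b" and Wa: "W a = (x, z)" "\<not> tr x z"
  obtains m where "a < m" "m < b" "W m = (z, x)" "compat (Suc a) m" "compat (Suc m) b" "compat a (Suc m)"
proof -
  have bN: "b \<le> N" using c by (simp add: compat_def)
  have aN: "a < N" using ab bN by simp
  obtain m where m: "m < N" "W m = (z, x)" using W_onto[OF Esym] W_in[OF aN] Wa by metis
  have am: "a \<le> m" "m < b" using compatD[OF c _ ab m(1) Wa m(2)] by auto
  have "x \<noteq> z" using W_in[OF aN] Wa Eirr by auto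
  hence "m \<noteq> a" using Wa m by auto
  hence am': "a < m" using am by simp
  have mate: "W k = (p, q) \<Longrightarrow> l < N \<Longrightarrow> W l = (q, p) \<Longrightarrow> \<not> tr p q \<Longrightarrow> k < N \<Longrightarrow> k = a \<longleftrightarrow> l = m" for k l p q
    using Wa m W_inj aN by (metis prod.inject)
  have inner: "a < l \<and> l < m" if "a < k" "k < m" "l < N" "W k = (p, q)" "\<not> tr p q" "W l = (q, p)" for k l p q
    using planar[OF that(1,2) m(1) that(3) Wa(1) m(2) Wa(2) that(4,6,5)] .
  have 1: "compat (Suc a) m"
    unfolding compat_def
  proof (intro conjI allI impI)
    fix k l p q assume k: "Suc a \<le> k" "k < m" "l < N" "W k = (p, q)" "\<not> tr p q" "W l = (q, p)"
    have "a < l \<and> l < m" by (rule inner[OF _ k(2-6)]) (use k(1) in simp)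
    thus "Suc a \<le> l" "l < m" by simp_all
  qed (use am' m(1) in simp_all)
  have 2: "compat (Suc m) b"
    unfolding compat_def
  proof (intro conjI allI impI)
    fix k l p q assume k: "Suc m \<le> k" "k < b" "l < N" "W k = (p, q)" "\<not> tr p q" "W l = (q, p)"
    have kN: "k < N" using k bN by simp
    have l: "a \<le> l \<and> l < b" using compatD[OF c _ k(2-6)] k(1) am by simp
    have "l \<noteq> m" using mate[OF k(4,3,6,5) kN] k(1) am by auto
    moreover have "l \<noteq> a" using mate[of l q p k] k kN tr_sym by auto
    moreover have "\<not> l < m"
    proof
      assume "l < m"
      hence "a < k \<and> k < m" using inner[of l k q p] l \<open>l \<noteq> a\<close> k kN tr_sym by auto
      thus False using k by simp
    qed
    ultimately show "Suc m \<le> l" "l < b" using l by auto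
  qed (use am bN in auto)
  have 3: "compat a (Suc m)"
    unfolding compat_def
  proof (intro conjI allI impI)
    fix k l p q assume k: "a \<le> k" "k < Suc m" "l < N" "W k = (p, q)" "\<not> tr p q" "W l = (q, p)"
    have kN: "k < N" using k m by simp
    consider "k = a" | "k = m" | "a < k" "k < m" using k by linarith
    hence "a \<le> l \<and> l < Suc m"
    proof cases
      case 1
      hence "l = m" using mate[OF k(4,3,6,5) kN] by simp
      thus ?thesis using am by auto
    next
      case 2
      hence "l = a" using mate[of l q p k] k kN tr_sym by auto
      thus ?thesis using am by auto
    next
      case 3
      thus ?thesis using inner[OF 3 k(3,4,5,6)] by auto
    qed
    thus "a \<le> l" "l < Suc m" by simp_all
  qed (use am m in auto)
  show ?thesis using that[OF am' am(2) m(2) 1 2 3] .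
qed

lemma cur_V: "k \<le> N \<Longrightarrow> cur k \<in> V"
proof (cases "k = N")
  case False
  moreover assume "k \<le> N"
  ultimately have k: "k < N" by simp
  obtain x y where "W k = (x, y)" by (cases "W k")
  thus ?thesis using W_in[OF k] EV cur_fst[OF k] by auto
qed (use cur_ends rootV in simp)

lemma cur_onto: assumes "x \<in> V" shows "\<exists>k<N. cur k = x"
proof -
  obtain y where "(x, y) \<in> E" using has_neighbour assms by blast
  then obtain k where "k < N" "W k = (x, y)" by (rule W_onto)
  thus ?thesis using cur_fst[of k] by auto
qed

lemma leave_subtree:
  assumes k: "k < N" and v: "v \<noteq> u" "v \<in> V" and ne: "(v \<in> anc (cur k)) \<noteq> (v \<in> anc (cur (Suc k)))"
  shows "if v \<in> anc (cur k) then W k = (v, par v) else W k = (par v, v)"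
proof -
  obtain x y where xy: "W k = (x, y)" by (cases "W k")
  have t: "tr x y"
  proof (rule ccontr)
    assume "\<not> tr x y"
    hence "cur k = cur (Suc k)" using step_chord[OF k xy] by simp
    thus False using ne by simp
  qed
  have c: "cur k = x" "cur (Suc k) = y" using step_tree[OF k xy t] by auto
  from t consider "x \<in> V" "x \<noteq> u" "y = par x" | "y \<in> V" "y \<noteq> u" "x = par y" by (auto simp: tr_def)
  thus ?thesis
  proof cases
    case 1
    have "anc x = insert x (anc y)" using anc_step 1 by simp
    thus ?thesis using ne c xy 1 by auto
  next
    case 2
    have "anc y = insert y (anc x)" using anc_step 2 by simp
    thus ?thesis using ne c xy 2 by auto
  qed
qed

lemma change_point:
  fixes P :: "nat \<Rightarrow> bool"
  assumes "P s" "\<not> P t" "s \<le> t"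
  obtains k where "s \<le> k" "k < t" "P k" "\<not> P (Suc k)"
proof -
  have "\<exists>k. s \<le> k \<and> k < t \<and> P k \<and> \<not> P (Suc k)"
  proof (rule ccontr)
    assume n: "\<not> ?thesis"
    have "P (s + j)" if "s + j \<le> t" for j
      using that
    proof (induction j)
      case (Suc j)
      thus ?case using n by (metis Suc_le_lessD add_Suc_right le_add1 less_imp_le)
    qed (use assms in simp)
    thus False using assms(2,3) by (metis le_add_diff_inverse order_refl)
  qed
  thus ?thesis using that by blast
qed

text \<open>
  Between two visits to \<open>v\<close> the walk stays below \<open>v\<close>: it enters the subtree of \<open>v\<close> only along the arc from the
  parent of \<open>v\<close>, which occurs once.
\<close>

lemma between_anc:
  assumes ts: "t \<le> a" "a \<le> s" "s \<le> N" and v: "cur t = v" "cur s = v"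
  shows "v \<in> anc (cur a)"
proof (rule ccontr)
  assume n: "v \<notin> anc (cur a)"
  have vV: "v \<in> V" using cur_V[of s] ts v by simp
  have vu: "v \<noteq> u" using n root_anc[of "cur a"] cur_V[of a] ts by auto
  let ?P = "\<lambda>k. v \<notin> anc (cur k)"
  have p0: "?P 0" using cur_ends anc_root vu by simp
  have pt: "\<not> ?P t" "\<not> ?P s" using v anc_self by auto
  obtain k where k: "0 \<le> k" "k < t" "?P k" "\<not> ?P (Suc k)"
    by (rule change_point[of ?P 0 t]) (use p0 pt in auto)
  obtain l where l: "a \<le> l" "l < s" "?P l" "\<not> ?P (Suc l)"
    by (rule change_point[of ?P a s]) (use n pt ts in auto)
  have kN: "k < N" "l < N" using k l ts by auto
  have "W k = (par v, v)" using leave_subtree[OF kN(1) vu vV] k by simp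
  moreover have "W l = (par v, v)" using leave_subtree[OF kN(2) vu vV] l by simp
  ultimately have "k = l" using W_inj kN by simp
  thus False using k l ts by simp
qed

text \<open>
  A vertex met inside the interval that is no ancestor of an end of the interval is met only inside, by
  \<open>between_anc\<close>. Its tree neighbours are adjacent stops of the walk, and its other neighbours are met at
  the opposite occurrences of chords, which compatibility keeps inside.
\<close>

lemma compat_separates:
  assumes c: "compat a b"
  defines "P \<equiv> anc (cur a) \<union> anc (cur b)" and "I \<equiv> cur ` {a..b}"
  shows "(x, y) \<in> E \<Longrightarrow> x \<in> I - P \<Longrightarrow> y \<in> I \<union> P"
proof -
  assume xy: "(x, y) \<in> E" and x: "x \<in> I - P"
  have ab: "a \<le> b" "b \<le> N" using c by (auto simp: compat_def)
  have inside: "a < k \<and> k < b" if "k \<le> N" "cur k = x" for k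
  proof -
    obtain s where s: "a \<le> s" "s \<le> b" "cur s = x" using x by (auto simp: I_def)
    have "\<not> k \<le> a"
    proof
      assume "k \<le> a"
      hence "x \<in> anc (cur a)" using between_anc[of k a s x] s ab that by simp
      thus False using x by (simp add: P_def)
    qed
    moreover have "\<not> b \<le> k"
    proof
      assume "b \<le> k"
      hence "x \<in> anc (cur b)" using between_anc[of s b k x] s ab that by simp
      thus False using x by (simp add: P_def)
    qed
    ultimately show ?thesis by simp
  qed
  obtain k where k: "k < N" "W k = (x, y)" by (rule W_onto[OF xy])
  have kab: "a < k" "k < b" using inside[of k] k cur_fst[of k] by auto
  show "y \<in> I \<union> P"
  proof (cases "tr x y")
    case True
    thus ?thesis using step_tree[OF k True] kab by (auto simp: I_def intro!: image_eqI[of _ _ "Suc k"])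
  next
    case False
    obtain l where l: "l < N" "W l = (y, x)" by (rule W_onto[OF Esym[OF xy]])
    have "a \<le> l \<and> l < b" using compatD[OF c _ _ l(1) k(2) False l(2)] kab by simp
    thus ?thesis using cur_fst[of l] l by (auto simp: I_def intro!: image_eqI[of _ _ l])
  qed
qed

text \<open>
  Take a shortest compatible interval that meets at least a third of the vertices. Shortening it
  by a tree arc loses at most one vertex, and cutting it at a chord leaves two shorter intervals, so it meets at
  most two thirds; if the chord spans all of it, it could be shortened without loss. The ends of the interval give the two root paths.
\<close>

theorem balanced_separator:
  assumes n3: "card V \<ge> 3"
  obtains x y A B where "x \<in> V" "y \<in> V" "A \<inter> B = {}" "A \<union> B = V - (anc x \<union> anc y)"
    "\<And>s t. s \<in> A \<Longrightarrow> t \<in> B \<Longrightarrow> (s, t) \<notin> E" "card V \<le> 3 * card (V - A)" "card V \<le> 3 * card (V - B)"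
proof -
  define f where "f a b = card (cur ` {a..b})" for a b
  define Q where "Q d \<longleftrightarrow> (\<exists>a b. compat a b \<and> b - a = d \<and> card V \<le> 3 * f a b)" for d
  have allV: "cur ` {0..N} = V"
  proof (rule equalityI)
    show "V \<subseteq> cur ` {0..N}"
    proof
      fix x assume "x \<in> V"
      then obtain k where "k < N" "cur k = x" using cur_onto by blast
      thus "x \<in> cur ` {0..N}" by (intro image_eqI[of _ _ k]) auto
    qed
  qed (use cur_V in auto)
  have "Q N" unfolding Q_def f_def
    by (intro exI[of _ 0] exI[of _ N]) (simp add: compat_all allV)
  define d where "d = (LEAST d. Q d)"
  have Qd: "Q d" unfolding d_def by (rule LeastI[of Q, OF \<open>Q N\<close>])
  have min: "\<not> Q d'" if "d' < d" for d'
    using not_less_Least[of d' Q] that unfolding d_def .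
  obtain a b where c: "compat a b" and bd: "b - a = d" and big: "card V \<le> 3 * f a b"
    using Qd unfolding Q_def by blast
  have small: "3 * f a' b' < card V" if "compat a' b'" "b' - a' < d" for a' b'
    using min[of "b' - a'"] that unfolding Q_def by (metis not_le)
  have ab: "a \<le> b" "b \<le> N" using c by (auto simp: compat_def)
  have up: "3 * f a b \<le> 2 * card V"
  proof (cases "a = b")
    case True
    thus ?thesis using n3 by (simp add: f_def)
  next
    case False
    hence ab': "a < b" using ab by simp
    hence aN: "a < N" using ab by simp
    obtain x z where Wa: "W a = (x, z)" by (cases "W a")
    show ?thesis
    proof (cases "tr x z")
      case True
      have "3 * f (Suc a) b < card V"
        by (rule small[OF compat_tree[OF c ab' Wa True]]) (use bd ab' in auto)
      moreover have "cur ` {a..b} = insert (cur a) (cur ` {Suc a..b})"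
        using ab' by (simp add: atLeastAtMost_insertL[symmetric])
      hence "f a b \<le> Suc (f (Suc a) b)" unfolding f_def by (simp add: card_insert_le_m1 card_insert_if)
      ultimately show ?thesis using n3 by linarith
    next
      case ch: False
      obtain m where m: "a < m" "m < b" "W m = (z, x)" "compat (Suc a) m" "compat (Suc m) b" "compat a (Suc m)"
        using chord_mate[OF c ab' Wa ch] by blast
      show ?thesis
      proof (cases "Suc m = b")
        case True
        have mN: "m < N" using m ab by simp
        have e1: "cur (Suc a) = cur a" using step_chord[OF aN Wa ch] by simp
        have "\<not> tr z x" using ch tr_sym[of x z] by simp
        hence e2: "cur b = cur m" using step_chord[OF mN m(3)] True by simp
        have "Suc a \<in> {Suc a..m}" "m \<in> {Suc a..m}" using m(1) by simp_all
        hence "cur a \<in> cur ` {Suc a..m}" "cur b \<in> cur ` {Suc a..m}"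
          using imageI[of "Suc a" "{Suc a..m}" cur] imageI[of m "{Suc a..m}" cur] e1 e2 by simp_all
        moreover have "{a..b} = insert a (insert b {Suc a..m})" using m True by auto
        ultimately have "cur ` {a..b} = cur ` {Suc a..m}" by auto
        hence "f a b = f (Suc a) m" by (simp add: f_def)
        moreover have "3 * f (Suc a) m < card V" by (rule small[OF m(4)]) (use m bd in auto)
        ultimately show ?thesis using big by simp
      next
        case False
        have "3 * f a (Suc m) < card V" by (rule small[OF m(6)]) (use m bd False in auto)
        moreover have "3 * f (Suc m) b < card V" by (rule small[OF m(5)]) (use m bd in auto)
        moreover have "{a..b} = {a..Suc m} \<union> {Suc m..b}" using m by auto
        hence "f a b \<le> f a (Suc m) + f (Suc m) b"
          unfolding f_def by (simp add: image_Un card_Un_le)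
        ultimately show ?thesis by linarith
      qed
    qed
  qed
  define P where "P = anc (cur a) \<union> anc (cur b)"
  define I where "I = cur ` {a..b}"
  have IV: "I \<subseteq> V" using ab cur_V by (auto simp: I_def)
  have fI: "card I = f a b" by (simp add: I_def f_def)
  show ?thesis
  proof (rule that[of "cur a" "cur b" "I - P" "V - I - P"])
    show "cur a \<in> V" "cur b \<in> V" using ab cur_V by auto
    show "(I - P) \<inter> (V - I - P) = {}" by blast
    show "I - P \<union> (V - I - P) = V - (anc (cur a) \<union> anc (cur b))"
      unfolding P_def[symmetric] using IV by blast
    show "(s, t) \<notin> E" if "s \<in> I - P" "t \<in> V - I - P" for s t
      using compat_separates[OF c, of s t, folded I_def P_def] that by blast
    have "card (V - I) \<le> card (V - (I - P))" using finV by (intro card_mono) auto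
    moreover have "card (V - I) = card V - card I" using IV finV by (intro card_Diff_subset finite_subset[OF IV]) auto
    ultimately show "card V \<le> 3 * card (V - (I - P))" using up fI by linarith
    have "card I \<le> card (V - (V - I - P))" using IV finV by (intro card_mono) auto
    thus "card V \<le> 3 * card (V - (V - I - P))" using big fI by linarith
  qed
qed

end

section \<open>Edges and triangles\<close>

definition C4_free :: "('a \<times> 'a) set \<Rightarrow> bool" where
  "C4_free E \<longleftrightarrow> (\<forall>a b c d. (a, b) \<in> E \<longrightarrow> (b, c) \<in> E \<longrightarrow> (c, d) \<in> E \<longrightarrow> (d, a) \<in> E \<longrightarrow> a = c \<or> b = d)"

definition triangle_arcs :: "('a \<times> 'a) set \<Rightarrow> ('a \<times> 'a) set" where
  "triangle_arcs E = {(x, y) \<in> E. \<exists>z. (x, z) \<in> E \<and> (y, z) \<in> E}"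

definition is_triangle :: "('a \<times> 'a) set \<Rightarrow> 'a set \<Rightarrow> bool" where
  "is_triangle E t \<longleftrightarrow> (\<exists>x y z. t = {x, y, z} \<and> (x, y) \<in> E \<and> (y, z) \<in> E \<and> (x, z) \<in> E)"

context contour begin

definition ntree :: "nat \<Rightarrow> nat \<Rightarrow> nat" where
  "ntree a b = (\<Sum>k=a..<b. if case_prod tr (W k) then 1 else 0)"

definition nchord :: "nat \<Rightarrow> nat \<Rightarrow> nat" where
  "nchord a b = (\<Sum>k=a..<b. if case_prod tr (W k) then 0 else 1)"

definition arcs_in :: "nat \<Rightarrow> nat \<Rightarrow> ('a \<times> 'a) set" where "arcs_in a b = W ` {a..<b}"

text \<open>
  A triangle is assigned to an interval through its chords. The existence of a chord makes sure that
  disjoint intervals have different triangles.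
\<close>

definition face_ok :: "nat \<Rightarrow> nat \<Rightarrow> 'a set \<Rightarrow> bool" where
  "face_ok a b t \<longleftrightarrow> is_triangle E t \<and> (\<exists>x\<in>t. \<exists>y\<in>t. (x, y) \<in> E \<and> \<not> tr x y) \<and>
     (\<forall>x\<in>t. \<forall>y\<in>t. (x, y) \<in> E \<longrightarrow> \<not> tr x y \<longrightarrow> (x, y) \<in> arcs_in a b)"

definition faces_ok :: "nat \<Rightarrow> nat \<Rightarrow> 'a set set \<Rightarrow> bool" where
  "faces_ok a b T \<longleftrightarrow> finite T \<and> (\<forall>t\<in>T. face_ok a b t)"

definition steps_in :: "('a \<times> 'a) set \<Rightarrow> 'a list \<Rightarrow> bool" where
  "steps_in R ws \<longleftrightarrow> (\<forall>i. Suc i < length ws \<longrightarrow> (ws ! i, ws ! Suc i) \<in> R)"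

lemma steps_in_Cons: "steps_in R (x # w # ws) \<longleftrightarrow> (x, w) \<in> R \<and> steps_in R (w # ws)"
proof
  assume s: "steps_in R (x # w # ws)"
  have "(x, w) \<in> R" using s[unfolded steps_in_def, rule_format, of 0] by simp
  moreover have "steps_in R (w # ws)" unfolding steps_in_def
  proof (intro allI impI)
    fix i assume "Suc i < length (w # ws)"
    thus "((w # ws) ! i, (w # ws) ! Suc i) \<in> R" using s[unfolded steps_in_def, rule_format, of "Suc i"] by simp
  qed
  ultimately show "(x, w) \<in> R \<and> steps_in R (w # ws)" ..
next
  assume s: "(x, w) \<in> R \<and> steps_in R (w # ws)"
  show "steps_in R (x # w # ws)" unfolding steps_in_def
  proof (intro allI impI)
    fix i assume i: "Suc i < length (x # w # ws)"
    show "((x # w # ws) ! i, (x # w # ws) ! Suc i) \<in> R"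
    proof (cases i)
      case (Suc j)
      thus ?thesis using s i unfolding steps_in_def by auto
    qed (use s in simp)
  qed
qed

lemma steps_in_mono: "steps_in R ws \<Longrightarrow> R \<subseteq> R' \<Longrightarrow> steps_in R' ws"
  unfolding steps_in_def by blast

lemma arcs_in_mono: "a \<le> a' \<Longrightarrow> b' \<le> b \<Longrightarrow> arcs_in a' b' \<subseteq> arcs_in a b"
  unfolding arcs_in_def by (intro image_mono) auto

lemma arcs_in_disjoint:
  assumes "b \<le> a'" "b' \<le> N" "d \<in> arcs_in a b" shows "d \<notin> arcs_in a' b'"
proof
  assume "d \<in> arcs_in a' b'"
  then obtain k l where "k \<in> {a..<b}" "l \<in> {a'..<b'}" "W k = W l" using assms(3) unfolding arcs_in_def by auto
  moreover from this have "k < N" "l < N" using assms by auto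
  ultimately have "k = l" using W_inj by blast
  thus False using \<open>k \<in> {a..<b}\<close> \<open>l \<in> {a'..<b'}\<close> assms by simp
qed

lemma compat_le: "compat a b \<Longrightarrow> a \<le> b \<and> b \<le> N" unfolding compat_def by blast

lemma arcs_in_rev:
  assumes c: "compat a b" and d: "(x, y) \<in> arcs_in a b" "\<not> tr x y" shows "(y, x) \<in> arcs_in a b"
proof -
  obtain k where k: "a \<le> k" "k < b" "W k = (x, y)" using d(1) unfolding arcs_in_def by auto
  have "k < N" using k compat_le[OF c] by linarith
  hence "(y, x) \<in> E" using W_in[of k] k Esym[of x y] by simp
  then obtain l where l: "l < N" "W l = (y, x)" by (rule W_onto)
  have "a \<le> l \<and> l < b" by (rule compatD[OF c k(1,2) l(1) k(3) d(2) l(2)])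
  thus ?thesis using l unfolding arcs_in_def by (intro image_eqI[of _ _ l]) auto
qed

lemma faces_ok_mono: "faces_ok a' b' T \<Longrightarrow> a \<le> a' \<Longrightarrow> b' \<le> b \<Longrightarrow> faces_ok a b T"
  unfolding faces_ok_def face_ok_def using arcs_in_mono[of a a' b' b] by blast

lemma face_chord:
  "faces_ok a b T \<Longrightarrow> t \<in> T \<Longrightarrow> x \<in> t \<Longrightarrow> y \<in> t \<Longrightarrow> (x, y) \<in> E \<Longrightarrow> \<not> tr x y \<Longrightarrow> (x, y) \<in> arcs_in a b"
  unfolding faces_ok_def face_ok_def by blast

text \<open>
  Here \<open>length ws - 1\<close> is the number of steps of the walk \<open>ws\<close>, which runs along the outer boundary of the part of
  the graph drawn in the interval. A tree arc lengthens the walk by one step. A chord, which counts twice in \<open>nchord\<close>,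
  replaces the walk \<open>ws1\<close> over the inner interval by one step. If \<open>ws1\<close> has at least four steps, the shortening pays for
  the chord. One step would repeat the chord and three would close a 4-cycle, so the other case is two steps,
  when chord and walk form a new triangle, which pays the difference of 4.
\<close>

lemma interval_count:
  assumes C4: "C4_free E"
  shows "compat a b \<Longrightarrow> \<exists>ws T. ws \<noteq> [] \<and> hd ws = cur a \<and> last ws = cur b \<and> steps_in (arcs_in a b) ws \<and>
    faces_ok a b T \<and> 3 * nchord a b + 2 * length ws \<le> 4 * card T + 2 * ntree a b + 2"
proof (induction "b - a" arbitrary: a b rule: less_induct)
  case less
  note c = less.prems
  have ab: "a \<le> b" "b \<le> N" using compat_le[OF c] by auto
  show ?case
  proof (cases "a = b")
    case True
    thus ?thesis
      by (intro exI[of _ "[cur a]"] exI[of _ "{}"]) (simp add: steps_in_def faces_ok_def face_ok_def nchord_def ntree_def)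
  next
    case False
    hence ab': "a < b" using ab by simp
    hence aN: "a < N" using ab by simp
    obtain x z where Wa: "W a = (x, z)" by (cases "W a")
    have xz: "(x, z) \<in> E" using W_in[OF aN] Wa by simp
    have a_in: "(x, z) \<in> arcs_in a b" unfolding arcs_in_def using Wa ab' by (intro image_eqI[of _ _ a]) auto
    show ?thesis
    proof (cases "tr x z")
      case True
      have cu: "cur a = x" "cur (Suc a) = z" using step_tree[OF aN Wa True] by auto
      obtain ws T where IH: "ws \<noteq> []" "hd ws = cur (Suc a)" "last ws = cur b" "steps_in (arcs_in (Suc a) b) ws"
        "faces_ok (Suc a) b T" "3 * nchord (Suc a) b + 2 * length ws \<le> 4 * card T + 2 * ntree (Suc a) b + 2"
        using less.hyps[OF _ compat_tree[OF c ab' Wa True]] ab' by (metis Suc_diff_Suc lessI)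
      obtain w ws' where ws: "ws = w # ws'" using IH(1) by (cases ws) auto
      have "steps_in (arcs_in a b) (x # ws)"
        using steps_in_mono[OF IH(4) arcs_in_mono[of a "Suc a" b b]] a_in IH(2) cu
        unfolding ws steps_in_Cons by simp
      moreover have "nchord a b = nchord (Suc a) b" "ntree a b = Suc (ntree (Suc a) b)"
        using True Wa ab' by (simp_all add: nchord_def ntree_def sum.atLeast_Suc_lessThan)
      ultimately show ?thesis
        using IH cu faces_ok_mono[OF IH(5), of a b]
        by (intro exI[of _ "x # ws"] exI[of _ T]) simp
    next
      case ch: False
      obtain m where m: "a < m" "m < b" "W m = (z, x)" "compat (Suc a) m" "compat (Suc m) b" "compat a (Suc m)"
        by (rule chord_mate[OF c ab' Wa ch])
      have mN: "m < N" using m ab by simp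
      have chz: "\<not> tr z x" using ch tr_sym[of x z] by simp
      have cu: "cur a = x" "cur (Suc a) = x" "cur m = z" "cur (Suc m) = z"
        using step_chord[OF aN Wa ch] step_chord[OF mN m(3) chz] by auto
      have "m - Suc a < b - a" "b - Suc m < b - a" using m by auto
      obtain ws1 T1 where I1: "ws1 \<noteq> []" "hd ws1 = x" "last ws1 = z" "steps_in (arcs_in (Suc a) m) ws1"
        "faces_ok (Suc a) m T1" "3 * nchord (Suc a) m + 2 * length ws1 \<le> 4 * card T1 + 2 * ntree (Suc a) m + 2"
        using less.hyps[OF \<open>m - Suc a < b - a\<close> m(4)] unfolding cu by blast
      obtain ws2 T2 where I2: "ws2 \<noteq> []" "hd ws2 = z" "last ws2 = cur b" "steps_in (arcs_in (Suc m) b) ws2"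
        "faces_ok (Suc m) b T2" "3 * nchord (Suc m) b + 2 * length ws2 \<le> 4 * card T2 + 2 * ntree (Suc m) b + 2"
        using less.hyps[OF \<open>b - Suc m < b - a\<close> m(5)] unfolding cu by blast
      obtain w ws' where ws2: "ws2 = w # ws'" using I2(1) by (cases ws2) auto
      have walk: "steps_in (arcs_in a b) (x # ws2)"
        using steps_in_mono[OF I2(4) arcs_in_mono[of a "Suc m" b b]] a_in I2(2) m(1)
        unfolding ws2 steps_in_Cons by simp
      have split: "(\<Sum>k=a..<b. f k) = f a + (\<Sum>k=Suc a..<m. f k) + f m + (\<Sum>k=Suc m..<b. f k)" for f :: "nat \<Rightarrow> nat"
      proof -
        have "(\<Sum>k=a..<b. f k) = f a + (\<Sum>k=Suc a..<b. f k)" using ab' by (simp add: sum.atLeast_Suc_lessThan)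
        also have "(\<Sum>k=Suc a..<b. f k) = (\<Sum>k=Suc a..<m. f k) + (\<Sum>k=m..<b. f k)"
          using m by (simp add: sum.atLeastLessThan_concat)
        also have "(\<Sum>k=m..<b. f k) = f m + (\<Sum>k=Suc m..<b. f k)" using m by (simp add: sum.atLeast_Suc_lessThan)
        finally show ?thesis by simp
      qed
      have num: "nchord a b = 2 + nchord (Suc a) m + nchord (Suc m) b" "ntree a b = ntree (Suc a) m + ntree (Suc m) b"
        unfolding nchord_def ntree_def split using Wa m(3) ch chz by simp_all
      have no: "(x, z) \<notin> arcs_in (Suc a) m"
        using arcs_in_disjoint[of "Suc a" "Suc a" m "(x, z)" a] Wa mN by (auto simp: arcs_in_def)
      have inE: "arcs_in (Suc a) m \<subseteq> E" using W_in mN by (auto simp: arcs_in_def)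
      have disj: "T1 \<inter> T2 = {}"
      proof (rule ccontr)
        assume "T1 \<inter> T2 \<noteq> {}"
        then obtain t where t: "t \<in> T1" "t \<in> T2" by blast
        obtain p q where pq: "p \<in> t" "q \<in> t" "(p, q) \<in> E" "\<not> tr p q" using I1(5) t unfolding faces_ok_def face_ok_def by blast
        have "(p, q) \<in> arcs_in (Suc a) m" "(p, q) \<in> arcs_in (Suc m) b"
          using I1(5) I2(5) t pq unfolding faces_ok_def face_ok_def by blast+
        thus False using arcs_in_disjoint[of m "Suc m" b "(p, q)" "Suc a"] ab by simp
      qed
      have fin: "finite T1" "finite T2" using I1(5) I2(5) by (auto simp: faces_ok_def face_ok_def)
      have ok12: "faces_ok a b (T1 \<union> T2)"
        using faces_ok_mono[OF I1(5), of a b] faces_ok_mono[OF I2(5), of a b] m fin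
        unfolding faces_ok_def by auto
      have len: "length ws1 = 3 \<or> 5 \<le> length ws1"
      proof (rule ccontr)
        assume "\<not> ?thesis"
        moreover have "length ws1 \<noteq> 0" using I1(1) by simp
        ultimately have "length ws1 = 1 \<or> length ws1 = 2 \<or> length ws1 = 4" by linarith
        thus False
        proof (elim disjE)
          assume "length ws1 = 1"
          then obtain p where "ws1 = [p]" by (auto simp: length_Suc_conv)
          thus False using I1(2,3) xz Eirr by auto
        next
          assume "length ws1 = 2"
          then obtain p q where "ws1 = [p, q]" by (auto simp: length_Suc_conv numeral_2_eq_2)
          thus False using I1(2-4) no by (auto simp: steps_in_Cons)
        next
          assume "length ws1 = 4"
          then obtain p q r s where ws: "ws1 = [p, q, r, s]" by (auto simp: length_Suc_conv eval_nat_numeral)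
          hence st: "(x, q) \<in> arcs_in (Suc a) m" "(q, r) \<in> arcs_in (Suc a) m" "(r, z) \<in> arcs_in (Suc a) m"
            using I1(2-4) by (auto simp: steps_in_Cons)
          hence "x = r \<or> q = z" using C4[unfolded C4_free_def, rule_format, of x q r z] inE Esym[OF xz] by blast
          thus False using st no by auto
        qed
      qed
      show ?thesis
      proof (cases "length ws1 = 3")
        case False
        have "3 * nchord a b + 2 * length (x # ws2) \<le> 4 * card (T1 \<union> T2) + 2 * ntree a b + 2"
          using I1(6) I2(6) num card_Un_disjoint[OF fin disj] len False by simp
        thus ?thesis using walk ok12 I2 cu by (intro exI[of _ "x # ws2"] exI[of _ "T1 \<union> T2"]) simp
      next
        case True
        then obtain p q r where "ws1 = [p, q, r]" by (auto simp: length_Suc_conv eval_nat_numeral)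
        hence st: "(x, q) \<in> arcs_in (Suc a) m" "(q, z) \<in> arcs_in (Suc a) m"
          using I1(2-4) by (auto simp: steps_in_Cons)
        define t where "t = {x, q, z}"
        have tri: "is_triangle E t" unfolding is_triangle_def t_def using st inE xz by blast
        have tin: "(y, w) \<in> arcs_in a b" if "y \<in> t" "w \<in> t" "(y, w) \<in> E" "\<not> tr y w" for y w
        proof -
          have sub: "arcs_in (Suc a) m \<subseteq> arcs_in a b" by (rule arcs_in_mono) (use m in auto)
          have zx: "(z, x) \<in> arcs_in a b" using arcs_in_rev[OF c a_in ch] .
          have r1: "\<not> tr q x \<Longrightarrow> (q, x) \<in> arcs_in (Suc a) m" using arcs_in_rev[OF m(4) st(1)] tr_sym[of x q] by simp
          have r2: "\<not> tr z q \<Longrightarrow> (z, q) \<in> arcs_in (Suc a) m" using arcs_in_rev[OF m(4) st(2)] tr_sym[of q z] by simp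
          have "y \<noteq> w" using that Eirr by auto
          thus ?thesis using that sub zx r1 r2 st a_in unfolding t_def by blast
        qed
        have new: "t \<notin> T1 \<union> T2"
        proof
          have no2: "(x, z) \<notin> arcs_in (Suc m) b"
            using arcs_in_disjoint[of "Suc a" "Suc m" b "(x, z)" a] Wa m ab by (auto simp: arcs_in_def)
          have "x \<in> t" "z \<in> t" by (auto simp: t_def)
          moreover assume "t \<in> T1 \<union> T2"
          ultimately have "(x, z) \<in> arcs_in (Suc a) m \<or> (x, z) \<in> arcs_in (Suc m) b"
            using face_chord[OF I1(5) _ _ _ xz ch, of t] face_chord[OF I2(5) _ _ _ xz ch, of t] by blast
          thus False using no no2 by simp
        qed
        have "faces_ok a b (insert t (T1 \<union> T2))"
        proof -
          have "x \<in> t" "z \<in> t" by (auto simp: t_def)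
          hence "face_ok a b t" unfolding face_ok_def using tri tin xz ch by blast
          thus ?thesis using ok12 unfolding faces_ok_def by simp
        qed
        moreover have "3 * nchord a b + 2 * length (x # ws2) \<le> 4 * card (insert t (T1 \<union> T2)) + 2 * ntree a b + 2"
          using I1(6) I2(6) num card_Un_disjoint[OF fin disj] True new fin by simp
        ultimately show ?thesis using walk I2 cu by (intro exI[of _ "x # ws2"] exI[of _ "insert t (T1 \<union> T2)"]) simp
      qed
    qed
  qed
qed

text \<open>
  Triangles sharing an edge would contain a 4-cycle, so each triangle has six arcs of its own.
\<close>

lemma card_triangles:
  assumes C4: "C4_free E" and T: "finite T" "\<And>t. t \<in> T \<Longrightarrow> is_triangle E t"
  shows "6 * card T \<le> card (triangle_arcs E)"
proof -
  define A where "A t = {(x, y). x \<in> t \<and> y \<in> t \<and> x \<noteq> y}" for t :: "'a set"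
  have tri: "card (A t) = 6 \<and> A t \<subseteq> triangle_arcs E \<and> finite (A t)" if tT: "t \<in> T" for t
  proof -
    obtain x y z where t: "t = {x, y, z}" "(x, y) \<in> E" "(y, z) \<in> E" "(x, z) \<in> E"
      using T(2)[OF tT] unfolding is_triangle_def by blast
    have ne: "x \<noteq> y" "y \<noteq> z" "x \<noteq> z" using t Eirr by auto
    have A: "A t = {(x, y), (y, x), (y, z), (z, y), (x, z), (z, x)}"
      unfolding A_def t using ne by auto
    have "card (A t) = 6" unfolding A using ne by simp
    moreover have "A t \<subseteq> triangle_arcs E" unfolding A triangle_arcs_def using t Esym by blast
    moreover have "finite (A t)" unfolding A by simp
    ultimately show ?thesis by blast
  qed
  have same: "s = t" if st: "s \<in> T" "t \<in> T" "A s \<inter> A t \<noteq> {}" for s t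
  proof -
    obtain x y where xy: "x \<in> s" "y \<in> s" "x \<in> t" "y \<in> t" "x \<noteq> y" using st(3) by (auto simp: A_def)
    have third: "\<exists>z. t = {x, y, z} \<and> (x, z) \<in> E \<and> (z, y) \<in> E" if tT: "t \<in> T" "x \<in> t" "y \<in> t" for t
    proof -
      obtain p q r where t: "t = {p, q, r}" "(p, q) \<in> E" "(q, r) \<in> E" "(p, r) \<in> E"
        using T(2)[OF tT(1)] unfolding is_triangle_def by blast
      note e = t(2-4) Esym[OF t(2)] Esym[OF t(3)] Esym[OF t(4)]
      consider "x = p" "y = q" | "x = q" "y = p" | "x = p" "y = r" | "x = r" "y = p" | "x = q" "y = r" | "x = r" "y = q"
        using tT(2,3) xy(5) unfolding t(1) by blast
      thus ?thesis
      proof cases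
        case 1 show ?thesis unfolding 1 using e t(1) by (intro exI[of _ r]) auto next
        case 2 show ?thesis unfolding 2 using e t(1) by (intro exI[of _ r]) auto next
        case 3 show ?thesis unfolding 3 using e t(1) by (intro exI[of _ q]) auto next
        case 4 show ?thesis unfolding 4 using e t(1) by (intro exI[of _ q]) auto next
        case 5 show ?thesis unfolding 5 using e t(1) by (intro exI[of _ p]) auto next
        case 6 show ?thesis unfolding 6 using e t(1) by (intro exI[of _ p]) auto
      qed
    qed
    obtain z1 where z1: "s = {x, y, z1}" "(x, z1) \<in> E" "(z1, y) \<in> E" using third[OF st(1)] xy by blast
    obtain z2 where z2: "t = {x, y, z2}" "(x, z2) \<in> E" "(z2, y) \<in> E" using third[OF st(2)] xy by blast
    have "x = y \<or> z1 = z2"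
      using C4[unfolded C4_free_def, rule_format, of x z1 y z2] z1 z2 Esym by blast
    thus ?thesis using xy z1 z2 by simp
  qed
  have "card (\<Union>t\<in>T. A t) = (\<Sum>t\<in>T. card (A t))"
    using T(1) tri same by (intro card_UN_disjoint) blast+
  also have "\<dots> = 6 * card T" using tri by simp
  finally have "card (\<Union>t\<in>T. A t) = 6 * card T" .
  moreover have "card (\<Union>t\<in>T. A t) \<le> card (triangle_arcs E)"
    using tri finE by (intro card_mono) (auto simp: triangle_arcs_def intro: finite_subset[of _ E])
  ultimately show ?thesis by simp
qed

theorem edge_bound:
  assumes C4: "C4_free E"
  shows "9 * card E \<le> 2 * card (triangle_arcs E) + 30 * (card V - 1)"
proof -
  obtain ws :: "'a list" and T where ws: "ws \<noteq> []" and T: "faces_ok 0 N T"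
    and le: "3 * nchord 0 N + 2 * length ws \<le> 4 * card T + 2 * ntree 0 N + 2"
    using interval_count[OF C4 compat_all] by metis
  have "length ws \<ge> 1" using ws by (cases ws) auto
  hence le': "3 * nchord 0 N \<le> 4 * card T + 2 * ntree 0 N" using le by linarith
  have "ntree 0 N = (\<Sum>d\<in>E. if case_prod tr d then 1 else 0)"
    unfolding ntree_def using sum.reindex_bij_betw[OF W_bij, of "\<lambda>d. if case_prod tr d then 1 else 0 :: nat"]
    by (simp add: atLeast0LessThan)
  also have "\<dots> = card {(x, y). tr x y}"
  proof -
    have "{d \<in> E. case_prod tr d} = {(x, y). tr x y}" using tr_E by auto
    thus ?thesis using finE by (simp add: sum.If_cases Int_def)
  qed
  finally have nt: "ntree 0 N = 2 * (card V - 1)" using card_tree_arcs by simp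
  have "nchord 0 N + ntree 0 N = (\<Sum>k=0..<N. 1)"
    unfolding nchord_def ntree_def sum.distrib[symmetric] by (intro sum.cong) auto
  moreover have "card E = N" using bij_betw_same_card[OF W_bij] by simp
  ultimately have "nchord 0 N + ntree 0 N = card E" by simp
  moreover have "6 * card T \<le> card (triangle_arcs E)"
    using T by (intro card_triangles[OF C4]) (auto simp: faces_ok_def face_ok_def)
  ultimately show ?thesis using le' nt by linarith
qed

end

section \<open>Guarding a set against the fire\<close>

definition nbrs :: "'a pair_pre_digraph \<Rightarrow> 'a \<Rightarrow> 'a set" where "nbrs G x = {y. (x, y) \<in> parcs G}"

definition leaves_at :: "'a pair_pre_digraph \<Rightarrow> 'a \<Rightarrow> 'a set" where
  "leaves_at G x = {y \<in> nbrs G x. card (nbrs G y) = 1}"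

text \<open>
  Together with the tree condition, \<open>bfs\<close> says that \<open>dep\<close> is the distance from the source \<open>u\<close> of the fire.
\<close>

locale fire = rooted_graph "pverts G" "parcs G" u par dep
  for G :: "'a pair_pre_digraph" and u :: 'a and par :: "'a \<Rightarrow> 'a" and dep :: "'a \<Rightarrow> nat" +
  assumes bfs: "(x, y) \<in> parcs G \<Longrightarrow> dep y \<le> Suc (dep x)"
begin

abbreviation "V \<equiv> pverts G"
abbreviation "E \<equiv> parcs G"
abbreviation "N \<equiv> nbrs G u"
abbreviation "L \<equiv> leaves_at G u"

lemma finN: "finite (nbrs G x)"
  by (rule finite_subset[OF _ finV]) (use EV in \<open>auto simp: nbrs_def\<close>)

lemma nbrs_sym: "y \<in> nbrs G x \<longleftrightarrow> x \<in> nbrs G y" using Esym by (auto simp: nbrs_def)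

lemma dep_pos: "x \<in> V \<Longrightarrow> x \<noteq> u \<Longrightarrow> 0 < dep x" using dep_par[of x] by simp

lemma leaf_nbr: "y \<in> L \<Longrightarrow> nbrs G y = {u}"
proof -
  assume y: "y \<in> L"
  hence "u \<in> nbrs G y" "card (nbrs G y) = 1" using nbrs_sym by (auto simp: leaves_at_def)
  thus ?thesis by (auto simp: card_1_singleton_iff)
qed

lemma burning_dep: "w \<in> burning G D u t \<Longrightarrow> w \<in> V \<and> dep w \<le> t"
proof (induction t arbitrary: w)
  case 0
  thus ?case using rootV dep_root by simp
next
  case (Suc t)
  show ?case
  proof (cases "w \<in> burning G D u t")
    case True thus ?thesis using Suc.IH[OF True] by simp
  next
    case False
    then obtain z where "z \<in> burning G D u t" "(z, w) \<in> E" using Suc.prems by auto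
    thus ?thesis using Suc.IH[of z] bfs[of z w] EV[of z w] by auto
  qed
qed

definition inner_boundary :: "'a set \<Rightarrow> 'a set" where
  "inner_boundary X = {w \<in> X. \<exists>z\<in>V - X. (z, w) \<in> E}"

text \<open>
  The set \<open>X\<close> is saved if its boundary vertices are protected in time: \<open>w\<close> is protected in round \<open>s w\<close>, rounds being
  counted from 0, and the fire cannot reach \<open>w\<close> before round \<open>dep w - 1\<close>.
\<close>

theorem guard_saves:
  assumes X: "X \<subseteq> V - {u}"
    and early: "\<And>w. w \<in> inner_boundary X \<Longrightarrow> s w < dep w"
    and two: "\<And>t. card {w \<in> inner_boundary X. s w = t} \<le> 2"
  shows "card X \<le> sn 2 G u"
proof -
  define D where "D t = {w \<in> inner_boundary X. s w = t}" for t
  have bdX: "inner_boundary X \<subseteq> X" by (auto simp: inner_boundary_def)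
  have strat: "strategy G 2 u D"
    unfolding strategy_def
  proof (intro allI conjI)
    show "D t \<subseteq> V - burning G D u t" for t
    proof
      fix w assume w: "w \<in> D t"
      hence "w \<in> inner_boundary X" "s w = t" by (auto simp: D_def)
      hence "t < dep w" "w \<in> V" using early[of w] bdX X by auto
      thus "w \<in> V - burning G D u t" using burning_dep[of w D t] by auto
    qed
    show "card (D t) \<le> 2" for t using two by (simp add: D_def)
  qed
  have disj: "burning G D u t \<inter> X = {}" for t
  proof (induction t)
    case 0 thus ?case using X by auto
  next
    case (Suc t)
    show ?case
    proof (rule ccontr)
      assume "\<not> ?thesis"
      then obtain w where w: "w \<in> burning G D u (Suc t)" "w \<in> X" by blast
      hence "w \<notin> burning G D u t" using Suc by blast
      then obtain z where z: "z \<in> burning G D u t" "(z, w) \<in> E" "w \<notin> (\<Union>s\<le>t. D s)" using w(1) by auto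
      have "z \<in> V - X" using z(1) Suc burning_dep by blast
      hence "w \<in> inner_boundary X" using z(2) w(2) by (auto simp: inner_boundary_def)
      moreover have "dep w \<le> Suc t" using burning_dep[OF w(1)] by simp
      ultimately have "s w \<le> t" using early[of w] by simp
      hence "w \<in> (\<Union>s\<le>t. D s)" using \<open>w \<in> inner_boundary X\<close> by (auto simp: D_def)
      thus False using z(3) by simp
    qed
  qed
  have "X \<subseteq> saved G D u" unfolding saved_def using X disj by auto
  moreover have "finite (saved G D u)" unfolding saved_def using finV by auto
  ultimately have "card X \<le> card (saved G D u)" by (intro card_mono) auto
  also have "\<dots> \<le> sn 2 G u"
    unfolding sn_def
  proof (rule Max_ge)
    have "card (saved G D u) \<le> card V" for D unfolding saved_def using finV by (intro card_mono) auto
    hence "{card (saved G D u) |D. strategy G 2 u D} \<subseteq> {..card V}" by auto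
    thus "finite {card (saved G D u) |D. strategy G 2 u D}" by (rule finite_subset) simp
    show "card (saved G D u) \<in> {card (saved G D u) |D. strategy G 2 u D}" using strat by blast
  qed
  finally show ?thesis .
qed

lemma nbr_dep: "w \<in> N \<Longrightarrow> w \<in> V \<and> w \<noteq> u \<and> dep w = 1"
proof -
  assume w: "w \<in> N"
  hence "w \<in> V" "w \<noteq> u" using EV Eirr by (auto simp: nbrs_def)
  moreover have "dep w \<le> Suc (dep u)" using w bfs by (auto simp: nbrs_def)
  ultimately show ?thesis using dep_pos[of w] dep_root by simp
qed

lemma dep1_nbr: "w \<in> V \<Longrightarrow> dep w = 1 \<Longrightarrow> w \<in> N"
proof -
  assume w: "w \<in> V" "dep w = 1"
  hence wu: "w \<noteq> u" using dep_root by auto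
  have "dep (par w) = 0" using par[OF w(1) wu] w(2) by simp
  hence "par w = u" using dep_pos[OF parV[OF w(1) wu]] by auto
  thus ?thesis using par[OF w(1) wu] Esym by (auto simp: nbrs_def)
qed

lemma saves_one: "1 \<le> sn 2 G u"
proof -
  obtain w where w: "w \<in> V" "w \<noteq> u" using nontrivial by blast
  have "card {w} \<le> sn 2 G u"
  proof (rule guard_saves[of _ "\<lambda>_. 0"])
    show "{w} \<subseteq> V - {u}" using w by simp
    show "0 < dep x" if "x \<in> inner_boundary {w}" for x using that w dep_pos by (auto simp: inner_boundary_def)
    show "card {x \<in> inner_boundary {w}. 0 = t} \<le> 2" for t :: nat
    proof -
      have "card {x \<in> inner_boundary {w}. 0 = t} \<le> card {w}" by (intro card_mono) (auto simp: inner_boundary_def)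
      thus ?thesis by simp
    qed
  qed
  thus ?thesis by simp
qed

lemma saves_all_but_leaves:
  assumes "card (N - L) \<le> 2"
  shows "card V - 1 - card L \<le> sn 2 G u"
proof -
  define X where "X = V - {u} - L"
  have b: "inner_boundary X \<subseteq> N - L"
  proof
    fix w assume "w \<in> inner_boundary X"
    then obtain z where w: "w \<in> X" and z: "z \<in> V" "z \<notin> X" "(z, w) \<in> E" by (auto simp: inner_boundary_def)
    have "z \<notin> L"
    proof
      assume "z \<in> L"
      hence "w = u" using leaf_nbr[of z] z by (auto simp: nbrs_def)
      thus False using w by (simp add: X_def)
    qed
    hence "z = u" using z by (simp add: X_def)
    thus "w \<in> N - L" using z w by (simp add: nbrs_def X_def)
  qed
  have "card X \<le> sn 2 G u"
  proof (rule guard_saves[of _ "\<lambda>_. 0"])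
    show "X \<subseteq> V - {u}" by (auto simp: X_def)
    show "0 < dep x" if "x \<in> inner_boundary X" for x using that dep_pos by (auto simp: inner_boundary_def X_def)
    show "card {x \<in> inner_boundary X. 0 = t} \<le> 2" for t :: nat
    proof -
      have "card {x \<in> inner_boundary X. 0 = t} \<le> card (N - L)" using b finN by (intro card_mono) auto
      thus ?thesis using assms by simp
    qed
  qed
  moreover have "card (V - {u}) - card L \<le> card X"
    unfolding X_def by (intro diff_card_le_card_Diff finite_subset[OF _ finN[of u]]) (auto simp: leaves_at_def)
  moreover have "card (V - {u}) = card V - 1" using rootV by simp
  ultimately show ?thesis by simp
qed

text \<open>
  Give up one neighbour \<open>a\<close>. The other two, one of them \<open>b\<close>, are protected at once, and in the next round the
  at most two neighbours of \<open>a\<close> besides \<open>u\<close> and \<open>b\<close>.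
\<close>

lemma saves_deg3_triangle:
  assumes N: "card N \<le> 3" and ab: "a \<in> N" "b \<in> N" "(a, b) \<in> E" and dega: "card (nbrs G a) \<le> 4"
  shows "card V - 2 \<le> sn 2 G u"
proof -
  define X where "X = V - {u, a}"
  define O' where "O' = nbrs G a - {u, b}"
  have "u \<in> nbrs G a" "b \<in> nbrs G a" "u \<noteq> b" using ab nbrs_sym nbr_dep by (auto simp: nbrs_def)
  hence O2: "card O' \<le> 2" using dega finN unfolding O'_def by (simp add: card_Diff_subset)
  have Na: "card (N - {a}) \<le> 2" using N ab finN by simp
  have finO: "finite O'" using finN by (simp add: O'_def)
  have b: "inner_boundary X \<subseteq> (N - {a}) \<union> O'"
  proof
    fix w assume "w \<in> inner_boundary X"
    then obtain z where w: "w \<in> X" and z: "z \<in> V" "z \<notin> X" "(z, w) \<in> E" by (auto simp: inner_boundary_def)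
    thus "w \<in> (N - {a}) \<union> O'" using ab by (auto simp: X_def O'_def nbrs_def)
  qed
  have "card X \<le> sn 2 G u"
  proof (rule guard_saves[of _ "\<lambda>w. if w \<in> N then 0 else 1"])
    show "X \<subseteq> V - {u}" by (auto simp: X_def)
    show "(if x \<in> N then 0 else 1) < dep x" if "x \<in> inner_boundary X" for x
    proof -
      have x: "x \<in> V" "x \<noteq> u" using that by (auto simp: inner_boundary_def X_def)
      thus ?thesis using dep_pos[OF x] dep1_nbr[OF x(1)] by (cases "dep x = 1") auto
    qed
    show "card {x \<in> inner_boundary X. (if x \<in> N then 0 else 1) = t} \<le> 2" for t :: nat
    proof (cases "t = 0")
      case True
      have "card {x \<in> inner_boundary X. (if x \<in> N then 0 else 1) = t} \<le> card (N - {a})"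
        using b finN True by (intro card_mono) (auto simp: inner_boundary_def X_def)
      thus ?thesis using Na by simp
    next
      case False
      have "card {x \<in> inner_boundary X. (if x \<in> N then 0 else 1) = t} \<le> card O'"
        using b finO False by (intro card_mono) auto
      thus ?thesis using O2 by simp
    qed
  qed
  moreover have "card X = card V - 2"
  proof -
    have "u \<noteq> a" "a \<in> V" using nbr_dep[OF ab(1)] by auto
    thus ?thesis using rootV finV unfolding X_def by (simp add: card_Diff_subset)
  qed
  ultimately show ?thesis by simp
qed

lemma anc_dep:
  "x \<in> V \<Longrightarrow> w \<in> anc x \<Longrightarrow> dep w \<le> dep x \<and> (dep w = dep x \<longrightarrow> w = x)"
proof (induction "dep x" arbitrary: x rule: less_induct)
  case less
  show ?case
  proof (cases "x = u")
    case True thus ?thesis using less.prems anc_root by simp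
  next
    case False
    have lt: "dep (par x) < dep x" by (rule dep_par[OF less.prems(1) False])
    have "w = x \<or> w \<in> anc (par x)" using less.prems anc_step[OF less.prems(1) False] by simp
    thus ?thesis
    proof
      assume "w \<in> anc (par x)"
      thus ?thesis using less.hyps[OF lt parV[OF less.prems(1) False]] lt by auto
    qed simp
  qed
qed

lemma anc_level:
  "x \<in> V \<Longrightarrow> w \<in> anc x \<Longrightarrow> w' \<in> anc x \<Longrightarrow> dep w = dep w' \<Longrightarrow> w = w'"
proof (induction "dep x" arbitrary: x rule: less_induct)
  case less
  show ?case
  proof (cases "x = u")
    case True thus ?thesis using less.prems anc_root by simp
  next
    case False
    note x = less.prems(1)
    have lt: "dep (par x) < dep x" by (rule dep_par[OF x False])
    have w: "w = x \<or> w \<in> anc (par x)" "w' = x \<or> w' \<in> anc (par x)"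
      using less.prems anc_step[OF x False] by simp_all
    show ?thesis
    proof (cases "w = x \<or> w' = x")
      case True
      thus ?thesis using anc_dep[OF x less.prems(2)] anc_dep[OF x less.prems(3)] less.prems(4) by auto
    next
      case F: False
      thus ?thesis using less.hyps[OF lt parV[OF x False]] w less.prems(4) by blast
    qed
  qed
qed

lemma anc_par: "x \<in> V \<Longrightarrow> w \<in> anc x \<Longrightarrow> w \<noteq> u \<Longrightarrow> par w \<in> anc x"
proof (induction "dep x" arbitrary: x rule: less_induct)
  case less
  show ?case
  proof (cases "x = u")
    case True thus ?thesis using less.prems anc_root by simp
  next
    case False
    note x = less.prems(1)
    have lt: "dep (par x) < dep x" by (rule dep_par[OF x False])
    have "w = x \<or> w \<in> anc (par x)" using less.prems anc_step[OF x False] by simp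
    thus ?thesis
      using less.hyps[OF lt parV[OF x False] _ less.prems(3)] anc_step[OF x False] anc_self[of "par x"] by auto
  qed
qed

lemma fin_anc: "x \<in> V \<Longrightarrow> finite (anc x)" using anc_V finV finite_subset by blast

lemma card_anc_level: "x \<in> V \<Longrightarrow> card {w \<in> anc x. dep w = k} \<le> 1"
  using anc_level[of x] fin_anc[of x] by (subst card_le_Suc0_iff_eq[unfolded One_nat_def[symmetric]]) auto

text \<open>
  This is what makes a separator of two root paths defensible by two firefighters.
\<close>

lemma card_path_level:
  assumes "x \<in> V" "y \<in> V" shows "card {w \<in> anc x \<union> anc y. dep w = k} \<le> 2"
proof -
  have "{w \<in> anc x \<union> anc y. dep w = k} = {w \<in> anc x. dep w = k} \<union> {w \<in> anc y. dep w = k}" by blast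
  hence "card {w \<in> anc x \<union> anc y. dep w = k} \<le> card {w \<in> anc x. dep w = k} + card {w \<in> anc y. dep w = k}"
    by (simp add: card_Un_le)
  thus ?thesis using card_anc_level[OF assms(1), of k] card_anc_level[OF assms(2), of k] by linarith
qed

end

section \<open>Saving a third of the graph\<close>

context fire begin

text \<open>
  Save the side \<open>C\<close> together with the paths \<open>P\<close>, without \<open>u\<close> and its leaves. Neighbours of \<open>u\<close> are protected in round
  0, and the path vertices of depth \<open>k\<close> in round \<open>k - 1\<close>, just before the fire can reach them.
\<close>

lemma saves_side:
  assumes xy: "x \<in> V" "y \<in> V"
  defines "P \<equiv> anc x \<union> anc y"
  assumes CV: "C \<subseteq> V - P" and sep: "\<And>s t. s \<in> C \<Longrightarrow> t \<in> V - P - C \<Longrightarrow> (s, t) \<notin> E"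
    and few: "card ((N - L) \<inter> C) + card ((N - L) \<inter> P) \<le> 2"
  shows "card (V - (V - P - C)) \<le> sn 2 G u + 1 + card L"
proof -
  have PV: "P \<subseteq> V" using xy anc_V by (auto simp: P_def)
  define X where "X = (C \<union> P) - {u} - L"
  define s where "s w = (if w \<in> P then dep w - 1 else 0)" for w
  have b: "w \<in> P \<or> w \<in> (N - L) \<inter> C" "w \<in> V" "w \<noteq> u" "w \<notin> L" if wb: "w \<in> inner_boundary X" for w
  proof -
    obtain z where w: "w \<in> X" and z: "z \<in> V" "z \<notin> X" "(z, w) \<in> E" using wb by (auto simp: inner_boundary_def)
    show wV: "w \<in> V" "w \<noteq> u" "w \<notin> L" using w CV PV by (auto simp: X_def)
    have zL: "z \<notin> L"
    proof
      assume "z \<in> L"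
      hence "w = u" using leaf_nbr[of z] z by (auto simp: nbrs_def)
      thus False using wV by simp
    qed
    show "w \<in> P \<or> w \<in> (N - L) \<inter> C"
    proof (rule disjCI)
      assume n: "w \<notin> (N - L) \<inter> C"
      show "w \<in> P"
      proof (rule ccontr)
        assume wP: "w \<notin> P"
        hence wC: "w \<in> C" using w by (simp add: X_def)
        hence "w \<notin> N" using n wV by blast
        hence "z \<noteq> u" using z by (auto simp: nbrs_def)
        hence "z \<in> V - P - C" using z zL by (simp add: X_def)
        thus False using sep[OF wC] Esym[OF z(3)] by blast
      qed
    qed
  qed
  have "card X \<le> sn 2 G u"
  proof (rule guard_saves[of X s])
    show "X \<subseteq> V - {u}" using CV PV by (auto simp: X_def)
    show "s w < dep w" if "w \<in> inner_boundary X" for w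
      using dep_pos[OF b(2,3)[OF that]] by (simp add: s_def)
    show "card {w \<in> inner_boundary X. s w = t} \<le> 2" for t
    proof (cases "t = 0")
      case True
      have "{w \<in> inner_boundary X. s w = t} \<subseteq> ((N - L) \<inter> C) \<union> ((N - L) \<inter> P)"
      proof
        fix w assume w: "w \<in> {w \<in> inner_boundary X. s w = t}"
        hence wb: "w \<in> inner_boundary X" by simp
        show "w \<in> ((N - L) \<inter> C) \<union> ((N - L) \<inter> P)"
        proof (cases "w \<in> P")
          case True
          have "dep w = 1" using w True \<open>t = 0\<close> dep_pos[OF b(2,3)[OF wb]] by (simp add: s_def)
          thus ?thesis using True dep1_nbr[OF b(2)[OF wb]] b(4)[OF wb] by simp
        qed (use b(1)[OF wb] in simp)
      qed
      hence "card {w \<in> inner_boundary X. s w = t} \<le> card (((N - L) \<inter> C) \<union> ((N - L) \<inter> P))"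
        using finN by (intro card_mono) auto
      also have "\<dots> \<le> card ((N - L) \<inter> C) + card ((N - L) \<inter> P)" by (rule card_Un_le)
      finally show ?thesis using few by simp
    next
      case False
      have "{w \<in> inner_boundary X. s w = t} \<subseteq> {w \<in> P. dep w = Suc t}"
      proof
        fix w assume w: "w \<in> {w \<in> inner_boundary X. s w = t}"
        thus "w \<in> {w \<in> P. dep w = Suc t}" using False by (auto simp: s_def split: if_splits)
      qed
      hence "card {w \<in> inner_boundary X. s w = t} \<le> card {w \<in> P. dep w = Suc t}"
        using finite_subset[OF PV finV] by (intro card_mono) auto
      thus ?thesis using card_path_level[OF xy, of "Suc t"] by (simp add: P_def)
    qed
  qed
  moreover have "card (C \<union> P) - 1 - card L \<le> card X"
  proof -
    have finL: "finite L" using finN[of u] by (rule finite_subset[rotated]) (auto simp: leaves_at_def)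
    have "card (C \<union> P) - 1 \<le> card (C \<union> P - {u})" using diff_card_le_card_Diff[of "{u}" "C \<union> P"] by simp
    moreover have "card (C \<union> P - {u}) - card L \<le> card X"
      unfolding X_def using finL by (rule diff_card_le_card_Diff)
    ultimately show ?thesis by linarith
  qed
  moreover have "V - (V - P - C) = C \<union> P" using CV PV by auto
  ultimately show ?thesis by simp
qed

lemma P_nbrs_le:
  assumes "x \<in> V" "y \<in> V" shows "card ((N - L) \<inter> (anc x \<union> anc y)) \<le> 2"
proof -
  have "card ((N - L) \<inter> (anc x \<union> anc y)) \<le> card {w \<in> anc x \<union> anc y. dep w = 1}"
    using nbr_dep fin_anc assms by (intro card_mono) auto
  thus ?thesis using card_path_level[OF assms, of 1] by simp
qed

lemma separation_counts:
  assumes xy: "x \<in> V" "y \<in> V" and AB: "A \<inter> B = {}" "A \<union> B = V - (anc x \<union> anc y)"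
  shows "card ((N - L) \<inter> A) + card ((N - L) \<inter> B) + card ((N - L) \<inter> (anc x \<union> anc y)) = card (N - L)"
proof -
  let ?P = "anc x \<union> anc y"
  have fin: "finite (N - L)" using finN by simp
  have NV: "N \<subseteq> V" using nbr_dep by blast
  have "N - L = ((N - L) \<inter> A \<union> (N - L) \<inter> B) \<union> (N - L) \<inter> ?P" using AB NV by blast
  hence "card (N - L) = card (((N - L) \<inter> A \<union> (N - L) \<inter> B) \<union> (N - L) \<inter> ?P)" by simp
  also have "\<dots> = card ((N - L) \<inter> A \<union> (N - L) \<inter> B) + card ((N - L) \<inter> ?P)"
    using fin AB by (intro card_Un_disjoint) auto
  also have "card ((N - L) \<inter> A \<union> (N - L) \<inter> B) = card ((N - L) \<inter> A) + card ((N - L) \<inter> B)"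
    using fin AB by (intro card_Un_disjoint) auto
  finally show ?thesis by simp
qed

text \<open>
  Counted with the path vertices in both, the two sides contain at most \<open>3 + 2\<close> non-leaf neighbours of \<open>u\<close>, so one
  of them contains at most two.
\<close>

lemma saves_third_deg3:
  assumes xy: "x \<in> V" "y \<in> V" and AB: "A \<inter> B = {}" "A \<union> B = V - (anc x \<union> anc y)"
    and sep: "\<And>s t. s \<in> A \<Longrightarrow> t \<in> B \<Longrightarrow> (s, t) \<notin> E"
    and big: "card V \<le> 3 * card (V - A)" "card V \<le> 3 * card (V - B)"
    and N3: "card (N - L) \<le> 3"
  shows "card V \<le> 3 * (sn 2 G u + 1 + card L)"
proof -
  let ?P = "anc x \<union> anc y"
  have VA: "V - ?P - A = B" "V - ?P - B = A" using AB by auto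
  have "card ((N - L) \<inter> A) + card ((N - L) \<inter> ?P) \<le> 2 \<or> card ((N - L) \<inter> B) + card ((N - L) \<inter> ?P) \<le> 2"
    using separation_counts[OF xy AB] P_nbrs_le[OF xy] N3 by linarith
  thus ?thesis
  proof
    assume h: "card ((N - L) \<inter> A) + card ((N - L) \<inter> ?P) \<le> 2"
    have "card (V - (V - ?P - A)) \<le> sn 2 G u + 1 + card L"
    proof (rule saves_side[OF xy])
      show "A \<subseteq> V - ?P" using AB by blast
      show "(s, t) \<notin> E" if "s \<in> A" "t \<in> V - ?P - A" for s t using sep[of s t] that VA by blast
    qed (use h in simp)
    thus ?thesis using big(2) VA by simp
  next
    assume h: "card ((N - L) \<inter> B) + card ((N - L) \<inter> ?P) \<le> 2"
    have "card (V - (V - ?P - B)) \<le> sn 2 G u + 1 + card L"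
    proof (rule saves_side[OF xy])
      show "B \<subseteq> V - ?P" using AB by blast
      show "(s, t) \<notin> E" if "s \<in> B" "t \<in> V - ?P - B" for s t
        using sep[of t s] Esym[of s t] that VA by blast
    qed (use h in simp)
    thus ?thesis using big(1) VA by simp
  qed
qed

text \<open>
  Three neighbours of \<open>u\<close> lie on \<open>P\<close> and \<open>C\<close>, one too many for the first round. Let the path vertex \<open>n1\<close> burn.
  In round 1 one firefighter continues on the path to \<open>y\<close>; the other is free for the next vertex on the path to
  \<open>x\<close> and the neighbours of \<open>n1\<close> in \<open>C\<close>, of which there is at most one in total. From round 2 on everything is as in
  \<open>saves_side\<close>.
\<close>

lemma saves_side_through:
  assumes xy: "x \<in> V" "y \<in> V"
  defines "P \<equiv> anc x \<union> anc y"
  assumes CV: "C \<subseteq> V - P" and sep: "\<And>s t. s \<in> C \<Longrightarrow> t \<in> V - P - C \<Longrightarrow> (s, t) \<notin> E"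
    and NP: "(N - L) \<inter> P = {n1, n3}" and NC: "(N - L) \<inter> C = {c}"
    and n1: "n1 \<in> anc x" and n3: "n3 \<in> anc y"
    and K: "card ({w \<in> P. dep w = 2 \<and> par w = n1} \<union> (nbrs G n1 \<inter> C - N)) \<le> 1"
    and ne: "n1 \<noteq> n3"
  shows "card (V - (V - P - C)) \<le> sn 2 G u + 2 + card L"
proof -
  have PV: "P \<subseteq> V" using xy anc_V by (auto simp: P_def)
  have finP: "finite P" using PV finV finite_subset by blast
  have d1: "dep n1 = 1" "dep n3 = 1" "n1 \<in> N" "n1 \<notin> L" using NP nbr_dep by blast+
  define X where "X = (C \<union> P) - {u, n1} - L"
  define s where "s w = (if w \<in> P then dep w - 1 else if w \<in> N then 0 else 1)" for w
  have b: "w \<in> P \<or> w = c \<or> w \<in> nbrs G n1 \<inter> C - N" "w \<in> V" "w \<noteq> u" "w \<notin> L" "w \<noteq> n1" "w \<in> C \<union> P"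
    if wb: "w \<in> inner_boundary X" for w
  proof -
    obtain z where w: "w \<in> X" and z: "z \<in> V" "z \<notin> X" "(z, w) \<in> E" using wb by (auto simp: inner_boundary_def)
    show wV: "w \<in> V" "w \<noteq> u" "w \<notin> L" "w \<noteq> n1" "w \<in> C \<union> P" using w CV PV by (auto simp: X_def)
    have zL: "z \<notin> L"
    proof
      assume "z \<in> L"
      hence "w = u" using leaf_nbr[of z] z by (auto simp: nbrs_def)
      thus False using wV by simp
    qed
    show "w \<in> P \<or> w = c \<or> w \<in> nbrs G n1 \<inter> C - N"
    proof (cases "w \<in> P")
      case False
      hence wC: "w \<in> C" using w by (simp add: X_def)
      hence "z \<notin> V - P - C" using sep[OF wC] Esym[OF z(3)] by blast
      hence "z = u \<or> z = n1" using z zL by (auto simp: X_def)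
      thus ?thesis
      proof
        assume "z = u"
        hence "w \<in> (N - L) \<inter> C" using z wV wC by (simp add: nbrs_def)
        thus ?thesis using NC by simp
      next
        assume "z = n1"
        hence "w \<in> nbrs G n1" using z by (simp add: nbrs_def)
        moreover have "w \<in> N \<Longrightarrow> w = c" using NC wV wC by blast
        ultimately show ?thesis using wC by blast
      qed
    qed simp
  qed
  have finNn: "finite (nbrs G n1 \<inter> C - N)" using finN by simp
  have "card X \<le> sn 2 G u"
  proof (rule guard_saves[of X s])
    show "X \<subseteq> V - {u}" using CV PV by (auto simp: X_def)
    show "s w < dep w" if "w \<in> inner_boundary X" for w
      using dep_pos[OF b(2,3)[OF that]] dep1_nbr[OF b(2)[OF that]] by (cases "dep w = 1") (auto simp: s_def)
    show "card {w \<in> inner_boundary X. s w = t} \<le> 2" for t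
    proof -
      consider "t = 0" | "t = 1" | "t \<ge> 2" by linarith
      thus ?thesis
      proof cases
        case 1
        have "{w \<in> inner_boundary X. s w = t} \<subseteq> {n3, c}"
        proof
          fix w assume w: "w \<in> {w \<in> inner_boundary X. s w = t}"
          hence wb: "w \<in> inner_boundary X" and s0: "s w = 0" using 1 by auto
          show "w \<in> {n3, c}"
          proof (cases "w \<in> P")
            case True
            have "dep w = 1" using s0 True dep_pos[OF b(2,3)[OF wb]] by (simp add: s_def)
            hence "w \<in> (N - L) \<inter> P" using dep1_nbr[OF b(2)[OF wb]] b(4)[OF wb] True by simp
            thus ?thesis using NP b(5)[OF wb] by simp
          next
            case False
            hence "w \<in> N" using s0 by (simp add: s_def split: if_splits)
            thus ?thesis using b(1)[OF wb] False by blast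
          qed
        qed
        hence "card {w \<in> inner_boundary X. s w = t} \<le> card {n3, c}" by (intro card_mono) auto
        also have "\<dots> \<le> 2" by (simp add: card_insert_if)
        finally show ?thesis .
      next
        case 2
        let ?K = "{w \<in> P. dep w = 2 \<and> par w = n1} \<union> (nbrs G n1 \<inter> C - N)"
        have "{w \<in> inner_boundary X. s w = t} \<subseteq> ?K \<union> {w \<in> anc y. dep w = 2}"
        proof
          fix w assume w: "w \<in> {w \<in> inner_boundary X. s w = t}"
          hence wb: "w \<in> inner_boundary X" and s1: "s w = 1" using 2 by auto
          show "w \<in> ?K \<union> {w \<in> anc y. dep w = 2}"
          proof (cases "w \<in> P")
            case True
            have d2: "dep w = 2" using s1 True by (simp add: s_def)
            show ?thesis
            proof (cases "w \<in> anc y")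
              case F: False
              hence wx: "w \<in> anc x" using True by (simp add: P_def)
              have "dep (par w) = 1" using par[OF b(2,3)[OF wb]] d2 by simp
              hence "par w = n1" using anc_level[OF xy(1) anc_par[OF xy(1) wx b(3)[OF wb]] n1] d1 by simp
              thus ?thesis using True d2 by simp
            qed (use d2 in simp)
          next
            case False
            hence "w \<notin> N" using s1 by (simp add: s_def split: if_splits)
            moreover have "w = c \<Longrightarrow> w \<in> N" using NC by blast
            ultimately show ?thesis using b(1)[OF wb] False by blast
          qed
        qed
        hence "card {w \<in> inner_boundary X. s w = t} \<le> card (?K \<union> {w \<in> anc y. dep w = 2})"
          using finP finNn fin_anc[OF xy(2)] by (intro card_mono) auto
        also have "\<dots> \<le> card ?K + card {w \<in> anc y. dep w = 2}" by (rule card_Un_le)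
        also have "\<dots> \<le> 2" using K card_anc_level[OF xy(2), of 2] by linarith
        finally show ?thesis .
      next
        case 3
        have "{w \<in> inner_boundary X. s w = t} \<subseteq> {w \<in> P. dep w = Suc t}"
          using 3 by (auto simp: s_def split: if_splits)
        hence "card {w \<in> inner_boundary X. s w = t} \<le> card {w \<in> P. dep w = Suc t}"
          using finP by (intro card_mono) auto
        thus ?thesis using card_path_level[OF xy, of "Suc t"] by (simp add: P_def)
      qed
    qed
  qed
  moreover have "card (C \<union> P) - 2 - card L \<le> card X"
  proof -
    have finL: "finite L" using finN[of u] by (rule finite_subset[rotated]) (auto simp: leaves_at_def)
    have "u \<noteq> n1" using d1 dep_root by auto
    hence "card (C \<union> P) - 2 \<le> card (C \<union> P - {u, n1})" using diff_card_le_card_Diff[of "{u, n1}" "C \<union> P"] by simp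
    moreover have "card (C \<union> P - {u, n1}) - card L \<le> card X"
      unfolding X_def using finL by (rule diff_card_le_card_Diff)
    ultimately show ?thesis by linarith
  qed
  moreover have "V - (V - P - C) = C \<union> P" using CV PV by auto
  ultimately show ?thesis by simp
qed

text \<open>
  Besides \<open>u\<close> and \<open>q\<close>, the vertex \<open>n1\<close> has at most two neighbours. The vertices to be protected in its place form a
  subset of these for either side, and the two subsets share at most the continuation of the path; so one of
  them has at most one element.
\<close>

lemma saves_third_through:
  assumes xy: "x \<in> V" "y \<in> V" and AB: "A \<inter> B = {}" "A \<union> B = V - (anc x \<union> anc y)"
    and sep: "\<And>s t. s \<in> A \<Longrightarrow> t \<in> B \<Longrightarrow> (s, t) \<notin> E"
    and big: "card V \<le> 3 * card (V - A)" "card V \<le> 3 * card (V - B)"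
    and NP: "(N - L) \<inter> (anc x \<union> anc y) = {n1, n3}" and ne: "n1 \<noteq> n3"
    and n1: "n1 \<in> anc x" and n3: "n3 \<in> anc y"
    and NA: "(N - L) \<inter> A = {a}" and NB: "(N - L) \<inter> B = {b}"
    and q: "q = a \<or> q = b" "(n1, q) \<in> E" and deg: "card (nbrs G n1) \<le> 4"
  shows "card V \<le> 3 * (sn 2 G u + 2 + card L)"
proof -
  let ?P = "anc x \<union> anc y"
  have VA: "V - ?P - A = B" "V - ?P - B = A" using AB by auto
  define X1 where "X1 = {w \<in> ?P. dep w = 2 \<and> par w = n1}"
  define KA where "KA = X1 \<union> (nbrs G n1 \<inter> A - N)"
  define KB where "KB = X1 \<union> (nbrs G n1 \<inter> B - N)"
  have PV: "?P \<subseteq> V" using xy anc_V by auto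
  have n1N: "n1 \<in> N" "n3 \<in> N" "a \<in> N" "b \<in> N" using NP NA NB by blast+
  hence d1: "dep n1 = 1" "dep n3 = 1" using nbr_dep by blast+
  define O' where "O' = nbrs G n1 - {u, q}"
  have "u \<in> nbrs G n1" "q \<in> nbrs G n1" "u \<noteq> q" using n1N nbrs_sym q nbr_dep by (auto simp: nbrs_def)
  hence O2: "card O' \<le> 2" using deg finN unfolding O'_def by (simp add: card_Diff_subset)
  have finO: "finite O'" using finN by (simp add: O'_def)
  have X1O: "X1 \<subseteq> O'"
  proof
    fix w assume w: "w \<in> X1"
    hence wV: "w \<in> V" and wd: "dep w = 2" "par w = n1" using PV by (auto simp: X1_def)
    have wu: "w \<noteq> u" using wd dep_root by auto
    have "w \<in> nbrs G n1" using par[OF wV wu] wd Esym by (auto simp: nbrs_def)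
    moreover have "w \<noteq> q" using wd q n1N nbr_dep by fastforce
    ultimately show "w \<in> O'" using wu by (simp add: O'_def)
  qed
  have X1x: "X1 \<subseteq> {w \<in> anc x. dep w = 2}"
  proof
    fix w assume w: "w \<in> X1"
    hence wV: "w \<in> V" and wd: "dep w = 2" "par w = n1" "w \<in> ?P" using PV by (auto simp: X1_def)
    have wu: "w \<noteq> u" using wd dep_root by auto
    have "w \<notin> anc y"
    proof
      assume "w \<in> anc y"
      hence "n1 \<in> anc y" using anc_par[OF xy(2) _ wu] wd by auto
      thus False using anc_level[OF xy(2) _ n3] d1 ne by simp
    qed
    thus "w \<in> {w \<in> anc x. dep w = 2}" using wd by simp
  qed
  have X1c: "card X1 \<le> 1"
    using card_mono[OF _ X1x] fin_anc[OF xy(1)] card_anc_level[OF xy(1), of 2] by simp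
  have KO: "KA \<subseteq> O'" "KB \<subseteq> O'"
    using X1O q n1N nbr_dep[OF n1N(1)] AB root_anc[OF xy(1)] unfolding KA_def KB_def O'_def by auto
  have "card KA \<le> 1 \<or> card KB \<le> 1"
  proof (rule ccontr)
    assume "\<not> ?thesis"
    hence "card O' \<le> card KA" "card O' \<le> card KB" using O2 by auto
    hence "KA = O'" "KB = O'" using card_seteq[OF finO] KO by auto
    moreover have "KA \<inter> KB \<subseteq> X1" using AB unfolding KA_def KB_def by auto
    ultimately have "KA \<subseteq> X1" by auto
    hence "card KA \<le> 1" using X1c card_mono[of X1 KA] finite_subset[OF X1O finO] by linarith
    thus False using \<open>\<not> (card KA \<le> 1 \<or> card KB \<le> 1)\<close> by simp
  qed
  thus ?thesis
  proof
    assume K: "card KA \<le> 1"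
    have "card (V - (V - ?P - A)) \<le> sn 2 G u + 2 + card L"
    proof (rule saves_side_through[OF xy _ _ NP NA n1 n3 _ ne])
      show "A \<subseteq> V - ?P" using AB by blast
      show "(s, t) \<notin> E" if "s \<in> A" "t \<in> V - ?P - A" for s t using sep that VA by blast
      show "card ({w \<in> ?P. dep w = 2 \<and> par w = n1} \<union> (nbrs G n1 \<inter> A - N)) \<le> 1"
        using K by (simp add: KA_def X1_def)
    qed
    thus ?thesis using big(2) VA by simp
  next
    assume K: "card KB \<le> 1"
    have "card (V - (V - ?P - B)) \<le> sn 2 G u + 2 + card L"
    proof (rule saves_side_through[OF xy _ _ NP NB n1 n3 _ ne])
      show "B \<subseteq> V - ?P" using AB by blast
      show "(s, t) \<notin> E" if "s \<in> B" "t \<in> V - ?P - B" for s t using sep Esym that VA by blast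
      show "card ({w \<in> ?P. dep w = 2 \<and> par w = n1} \<union> (nbrs G n1 \<inter> B - N)) \<le> 1"
        using K by (simp add: KB_def X1_def)
    qed
    thus ?thesis using big(1) VA by simp
  qed
qed

text \<open>
  If no side admits \<open>saves_side\<close>, the four neighbours are split as one in \<open>A\<close>, one in \<open>B\<close> and one on each path. In the
  absence of 4-cycles each of them has only one partner, and the partners of the two side vertices are on the paths.
  So the triangle with two small degrees contains a path vertex of degree at most 4 and a side vertex.
\<close>

lemma saves_third_deg4:
  assumes C4: "C4_free E"
    and xy: "x \<in> V" "y \<in> V" and AB: "A \<inter> B = {}" "A \<union> B = V - (anc x \<union> anc y)"
    and sep: "\<And>s t. s \<in> A \<Longrightarrow> t \<in> B \<Longrightarrow> (s, t) \<notin> E"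
    and big: "card V \<le> 3 * card (V - A)" "card V \<le> 3 * card (V - B)"
    and N4: "card (N - L) = 4"
    and tri: "\<And>w. w \<in> N - L \<Longrightarrow> \<exists>w'\<in>N. (w, w') \<in> E"
    and ab: "a \<in> N" "b \<in> N" "(a, b) \<in> E" "card (nbrs G a) \<le> 4" "card (nbrs G b) \<le> 4"
  shows "card V \<le> 3 * (sn 2 G u + 2 + card L)"
proof -
  let ?P = "anc x \<union> anc y"
  have VA: "V - ?P - A = B" "V - ?P - B = A" using AB by auto
  have sum: "card ((N - L) \<inter> A) + card ((N - L) \<inter> B) + card ((N - L) \<inter> ?P) = 4"
    using separation_counts[OF xy AB] N4 by simp
  have P2: "card ((N - L) \<inter> ?P) \<le> 2" by (rule P_nbrs_le[OF xy])
  consider "card ((N - L) \<inter> A) + card ((N - L) \<inter> ?P) \<le> 2" | "card ((N - L) \<inter> B) + card ((N - L) \<inter> ?P) \<le> 2"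
    | "card ((N - L) \<inter> A) = 1" "card ((N - L) \<inter> B) = 1" "card ((N - L) \<inter> ?P) = 2"
    using sum P2 by linarith
  thus ?thesis
  proof cases
    case h: 1
    have "card (V - (V - ?P - A)) \<le> sn 2 G u + 1 + card L"
    proof (rule saves_side[OF xy])
      show "A \<subseteq> V - ?P" using AB by blast
      show "(s, t) \<notin> E" if "s \<in> A" "t \<in> V - ?P - A" for s t using sep[of s t] that VA by blast
    qed (use h in simp)
    thus ?thesis using big(2) VA by simp
  next
    case h: 2
    have "card (V - (V - ?P - B)) \<le> sn 2 G u + 1 + card L"
    proof (rule saves_side[OF xy])
      show "B \<subseteq> V - ?P" using AB by blast
      show "(s, t) \<notin> E" if "s \<in> B" "t \<in> V - ?P - B" for s t
        using sep[of t s] Esym[of s t] that VA by blast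
    qed (use h in simp)
    thus ?thesis using big(1) VA by simp
  next
    case 3
    obtain nA where nA: "(N - L) \<inter> A = {nA}" using 3(1) by (auto simp: card_1_singleton_iff)
    obtain nB where nB: "(N - L) \<inter> B = {nB}" using 3(2) by (auto simp: card_1_singleton_iff)
    obtain p p' where pp: "(N - L) \<inter> ?P = {p, p'}" "p \<noteq> p'" using 3(3) by (auto simp: card_2_iff)
    have "p \<in> (N - L) \<inter> ?P" "p' \<in> (N - L) \<inter> ?P" unfolding pp(1) by simp_all
    hence pN: "p \<in> N" "p' \<in> N" "p \<in> ?P" "p' \<in> ?P" "p \<in> N - L" "p' \<in> N - L" by (simp_all only: Int_iff Diff_iff simp_thms)
    have dp: "dep p = dep p'" using nbr_dep[OF pN(1)] nbr_dep[OF pN(2)] by linarith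
    have NLeq: "N - L = {nA, nB, p, p'}"
    proof -
      have NV: "N \<subseteq> V" using nbr_dep by blast
      have "N - L = (N - L) \<inter> A \<union> (N - L) \<inter> B \<union> (N - L) \<inter> ?P"
      proof (rule set_eqI)
        fix w
        have "w \<in> V \<Longrightarrow> w \<in> A \<or> w \<in> B \<or> w \<in> ?P" using AB(2) by blast
        thus "w \<in> N - L \<longleftrightarrow> w \<in> (N - L) \<inter> A \<union> (N - L) \<inter> B \<union> (N - L) \<inter> ?P" using NV by blast
      qed
      also have "\<dots> = {nA} \<union> {nB} \<union> {p, p'}" by (simp only: nA nB pp(1))
      also have "\<dots> = {nA, nB, p, p'}" by blast
      finally show ?thesis .
    qed
    have "nA \<in> (N - L) \<inter> A" "nB \<in> (N - L) \<inter> B" unfolding nA nB by simp_all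
    hence nAB: "nA \<in> A" "nB \<in> B" "nA \<in> N" "nB \<in> N" "nA \<in> N - L" "nB \<in> N - L" by (simp_all only: Int_iff Diff_iff simp_thms)
    have neAB: "nA \<noteq> nB" "(nA, nB) \<notin> E" using nAB(1,2) AB(1) sep[of nA nB] by blast+
    have notleaf: "w \<notin> L" if "w \<in> N" "w' \<in> N" "(w, w') \<in> E" for w w'
    proof
      assume "w \<in> L"
      hence "w' = u" using leaf_nbr[of w] that by (auto simp: nbrs_def)
      thus False using that nbr_dep by blast
    qed
    have uniq: "w1 = w2" if "w \<in> N" "w1 \<in> N" "w2 \<in> N" "(w, w1) \<in> E" "(w, w2) \<in> E" for w w1 w2
    proof -
      have "(u, w1) \<in> E" "(w1, w) \<in> E" "(w, w2) \<in> E" "(w2, u) \<in> E"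
        using that Esym[of w w1] Esym[of u w2] by (simp_all add: nbrs_def)
      hence "u = w \<or> w1 = w2" using C4 unfolding C4_free_def by blast
      thus ?thesis using that nbr_dep by blast
    qed
    have partner: "(nA, p) \<in> E \<or> (nA, p') \<in> E" "(nB, p) \<in> E \<or> (nB, p') \<in> E"
    proof -
      obtain w where w: "w \<in> N" "(nA, w) \<in> E" using tri[OF nAB(5)] by blast
      hence "w \<in> N - L" using notleaf[of w nA] nAB(3) Esym[of nA w] by blast
      moreover have "w \<noteq> nA" using w Eirr by blast
      moreover have "w \<noteq> nB" using w neAB by blast
      ultimately show "(nA, p) \<in> E \<or> (nA, p') \<in> E" using w NLeq by auto
      obtain w where w: "w \<in> N" "(nB, w) \<in> E" using tri[OF nAB(6)] by blast
      hence "w \<in> N - L" using notleaf[of w nB] nAB(4) Esym[of nB w] by blast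
      moreover have "w \<noteq> nB" using w Eirr by blast
      moreover have "w \<noteq> nA" using w neAB Esym[of nB nA] by blast
      ultimately show "(nB, p) \<in> E \<or> (nB, p') \<in> E" using w NLeq by auto
    qed
    have abNL: "a \<in> N - L" "b \<in> N - L" using notleaf[of a b] notleaf[of b a] ab Esym[of a b] by blast+
    have pp': "(p, p') \<notin> E"
    proof
      assume e: "(p, p') \<in> E"
      have nP: "nA \<notin> ?P" using nAB(1) AB(2) by blast
      have "(p, nA) \<notin> E" using uniq[of p nA p'] e pN(1,2,4) nAB(3) nP by blast
      moreover have "(p', nA) \<notin> E" using uniq[of p' nA p] Esym[OF e] pN(1,2,3) nAB(3) nP by blast
      ultimately show False using partner(1) Esym[of nA p] Esym[of nA p'] by blast
    qed
    have key: "\<exists>n. n \<in> {p, p'} \<and> card (nbrs G n) \<le> 4 \<and> (\<exists>q\<in>{nA, nB}. (n, q) \<in> E)"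
    proof -
      have i: "a \<in> {nA, nB, p, p'}" "b \<in> {nA, nB, p, p'}" using abNL by (simp_all only: NLeq)
      have e: "(b, a) \<in> E" by (rule Esym[OF ab(3)])
      have no: "(p', p) \<notin> E" "(nB, nA) \<notin> E" "\<And>z. (z, z) \<notin> E"
        using pp' neAB(2) Esym[of p' p] Esym[of nB nA] Eirr by blast+
      have "a \<in> {p, p'} \<and> b \<in> {nA, nB} \<or> b \<in> {p, p'} \<and> a \<in> {nA, nB}"
        using i ab(3) no pp' neAB(2) by auto
      thus ?thesis using ab(3,4,5) e by blast
    qed
    then obtain n q where n: "n \<in> {p, p'}" "card (nbrs G n) \<le> 4" "q = nA \<or> q = nB" "(n, q) \<in> E" by blast
    obtain n' where n': "(N - L) \<inter> ?P = {n, n'}" "n \<noteq> n'" "n' \<in> {p, p'}" using n(1) pp by blast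
    have nn: "n \<in> ?P" "n' \<in> ?P" "dep n = dep n'" using n(1) n'(3) pN dp by auto
    show ?thesis
    proof (cases "n \<in> anc x \<and> n' \<in> anc y")
      case True
      thus ?thesis
        using saves_third_through[OF xy AB sep big n'(1,2) _ _ nA nB n(3,4,2)] by blast
    next
      case False
      have "\<not> (n \<in> anc x \<and> n' \<in> anc x)" using anc_level[OF xy(1)] nn(3) n'(2) by blast
      moreover have "\<not> (n \<in> anc y \<and> n' \<in> anc y)" using anc_level[OF xy(2)] nn(3) n'(2) by blast
      ultimately have m: "n \<in> anc y" "n' \<in> anc x" using False nn by blast+
      have AB': "A \<union> B = V - (anc y \<union> anc x)" using AB(2) by (simp add: Un_commute)
      have NP': "(N - L) \<inter> (anc y \<union> anc x) = {n, n'}" using n'(1) by (simp add: Un_commute)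
      show ?thesis
        by (rule saves_third_through[OF xy(2,1) AB(1) AB' sep big NP' n'(2) m nA nB n(3,4,2)])
    qed
  qed
qed

end

section \<open>Discharging\<close>

lemma even_card_involution:
  assumes "finite A" and "\<And>x. x \<in> A \<Longrightarrow> f x \<in> A \<and> f x \<noteq> x \<and> f (f x) = x"
  shows "even (card A)"
  using assms
proof (induction "card A" arbitrary: A rule: less_induct)
  case less
  show ?case
  proof (cases "A = {}")
    case False
    then obtain x where x: "x \<in> A" by blast
    have fx: "f x \<in> A" "f x \<noteq> x" "f (f x) = x" using less.prems(2)[OF x] by auto
    have c: "card A = card (A - {x, f x}) + 2"
    proof -
      have "card (A - {x, f x}) = card A - card {x, f x}"
        using x fx by (intro card_Diff_subset) auto
      moreover have "card {x, f x} \<le> card A" using x fx less.prems(1) by (intro card_mono) auto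
      moreover have "card {x, f x} = 2" using fx by simp
      ultimately show ?thesis by linarith
    qed
    have "even (card (A - {x, f x}))"
    proof (rule less.hyps)
      show "f y \<in> A - {x, f x} \<and> f y \<noteq> y \<and> f (f y) = y" if y: "y \<in> A - {x, f x}" for y
      proof -
        have fy: "f y \<in> A" "f y \<noteq> y" "f (f y) = y" using less.prems(2)[of y] y by auto
        have "f y \<noteq> x" "f y \<noteq> f x" using fy(3) fx(3) y by auto
        thus ?thesis using fy by blast
      qed
    qed (use c less.prems(1) in auto)
    thus ?thesis using c by simp
  qed simp
qed

locale c4_free_plane_graph =
  star_drawing "pverts G" "parcs G" p r ang \<delta>
  for G :: "'a pair_pre_digraph" and p r ang \<delta> +
  assumes finV: "finite (pverts G)"
    and two: "2 \<le> card (pverts G)"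
    and conn: "x \<in> pverts G \<Longrightarrow> y \<in> pverts G \<Longrightarrow> (x, y) \<in> (parcs G)\<^sup>*"
    and C4: "C4_free (parcs G)"
begin

abbreviation "V \<equiv> pverts G"
abbreviation "E \<equiv> parcs G"
abbreviation "nb \<equiv> nbrs G"
abbreviation "lf \<equiv> leaves_at G"

lemma breadth_first_tree:
  assumes u: "u \<in> V" shows "\<exists>par dep. fire G u par dep"
proof -
  define dep where "dep x = (LEAST k. (u, x) \<in> E ^^ k)" for x
  have reach: "(u, x) \<in> E ^^ dep x" if x: "x \<in> V" for x
  proof -
    obtain k where "(u, x) \<in> E ^^ k" using conn[OF u x] by (auto simp: rtrancl_power)
    thus ?thesis unfolding dep_def by (rule LeastI)
  qed
  have least: "dep x \<le> k" if "(u, x) \<in> E ^^ k" for x k unfolding dep_def using that by (rule Least_le)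
  have step: "dep y \<le> Suc (dep x)" if "(x, y) \<in> E" for x y
  proof (rule least)
    have "x \<in> V" using EV[OF that] by simp
    thus "(u, y) \<in> E ^^ Suc (dep x)" using reach[of x] that by auto
  qed
  have ex: "\<exists>y. (x, y) \<in> E \<and> dep x = Suc (dep y)" if x: "x \<in> V" "x \<noteq> u" for x
  proof -
    have "dep x \<noteq> 0" using reach[OF x(1)] x(2) by (cases "dep x") auto
    then obtain k where k: "dep x = Suc k" by (cases "dep x") auto
    then obtain y where y: "(u, y) \<in> E ^^ k" "(y, x) \<in> E" using reach[OF x(1)] by auto
    have "dep y \<le> k" by (rule least[OF y(1)])
    hence "dep x = Suc (dep y)" using step[OF y(2)] k by linarith
    thus ?thesis using Esym[OF y(2)] by blast
  qed
  define par where "par x = (SOME y. (x, y) \<in> E \<and> dep x = Suc (dep y))" for x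
  have "dep u \<le> 0" by (rule least) simp
  moreover have "\<exists>x\<in>V. x \<noteq> u"
  proof (rule ccontr)
    assume "\<not> ?thesis"
    hence "V \<subseteq> {u}" by blast
    hence "card V \<le> card {u}" by (intro card_mono) auto
    thus False using two by simp
  qed
  moreover have "(x, par x) \<in> E \<and> dep x = Suc (dep (par x))" if "x \<in> V" "x \<noteq> u" for x
    unfolding par_def by (rule someI_ex[OF ex[OF that]])
  ultimately have "fire G u par dep"
    using finV u EV Esym Eirr step by unfold_locales blast+
  thus ?thesis by blast
qed

lemma breadth_first_contour:
  assumes "u \<in> V" shows "\<exists>par dep W cur. fire G u par dep \<and> contour V E u par dep W cur (card E)"
proof -
  obtain par dep where f: "fire G u par dep" using breadth_first_tree[OF assms] by blast
  have "rooted_graph V E u par dep" using f by (rule fire.axioms)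
  then obtain W cur where "contour V E u par dep W cur (card E)"
    using contour_exists[OF star_drawing_axioms] by blast
  thus ?thesis using f by blast
qed

lemma sn_pos: assumes "u \<in> V" shows "1 \<le> sn 2 G u"
proof -
  obtain par dep where "fire G u par dep" using breadth_first_tree[OF assms] by blast
  thus ?thesis by (rule fire.saves_one)
qed

lemma sn_two_directions:
  assumes "u \<in> V" "card (nb u - lf u) \<le> 2" shows "card V \<le> sn 2 G u + 1 + card (lf u)"
proof -
  obtain par dep where "fire G u par dep" using breadth_first_tree[OF assms(1)] by blast
  thus ?thesis using fire.saves_all_but_leaves[of G u par dep] assms(2) by linarith
qed

lemma sn_triangle:
  assumes "u \<in> V" "card (nb u) \<le> 3" "a \<in> nb u" "b \<in> nb u" "(a, b) \<in> E" "card (nb a) \<le> 4"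
  shows "card V \<le> sn 2 G u + 2"
proof -
  obtain par dep where "fire G u par dep" using breadth_first_tree[OF assms(1)] by blast
  thus ?thesis using fire.saves_deg3_triangle[of G u par dep a b] assms(2-6) by linarith
qed

lemma sn_three_directions:
  assumes u: "u \<in> V" and n: "3 \<le> card V" and N: "card (nb u - lf u) \<le> 3"
  shows "card V \<le> 3 * (sn 2 G u + 1 + card (lf u))"
proof -
  obtain par dep W cur where f: "fire G u par dep" and c: "contour V E u par dep W cur (card E)"
    using breadth_first_contour[OF u] by blast
  interpret F: fire G u par dep by (rule f)
  interpret C: contour V E u par dep W cur "card E" by (rule c)
  obtain x y A B where s: "x \<in> V" "y \<in> V" "A \<inter> B = {}" "A \<union> B = V - (F.anc x \<union> F.anc y)"
    "\<And>s t. s \<in> A \<Longrightarrow> t \<in> B \<Longrightarrow> (s, t) \<notin> E" "card V \<le> 3 * card (V - A)" "card V \<le> 3 * card (V - B)"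
    using C.balanced_separator[OF n] by metis
  show ?thesis by (rule F.saves_third_deg3[OF s N])
qed

lemma sn_four_directions:
  assumes u: "u \<in> V" and n: "3 \<le> card V" and N: "card (nb u - lf u) = 4"
    and tri: "\<And>w. w \<in> nb u - lf u \<Longrightarrow> \<exists>w'\<in>nb u. (w, w') \<in> E"
    and ab: "a \<in> nb u" "b \<in> nb u" "(a, b) \<in> E" "card (nb a) \<le> 4" "card (nb b) \<le> 4"
  shows "card V \<le> 3 * (sn 2 G u + 2 + card (lf u))"
proof -
  obtain par dep W cur where f: "fire G u par dep" and c: "contour V E u par dep W cur (card E)"
    using breadth_first_contour[OF u] by blast
  interpret F: fire G u par dep by (rule f)
  interpret C: contour V E u par dep W cur "card E" by (rule c)
  obtain x y A B where s: "x \<in> V" "y \<in> V" "A \<inter> B = {}" "A \<union> B = V - (F.anc x \<union> F.anc y)"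
    "\<And>s t. s \<in> A \<Longrightarrow> t \<in> B \<Longrightarrow> (s, t) \<notin> E" "card V \<le> 3 * card (V - A)" "card V \<le> 3 * card (V - B)"
    using C.balanced_separator[OF n] by metis
  show ?thesis by (rule F.saves_third_deg4[OF C4 s N tri ab])
qed

lemma sparse: "9 * card E \<le> 2 * card (triangle_arcs E) + 30 * (card V - 1)"
proof -
  have "V \<noteq> {}" using two by auto
  then obtain u where u: "u \<in> V" by blast
  obtain par dep W cur where f: "fire G u par dep" and c: "contour V E u par dep W cur (card E)"
    using breadth_first_contour[OF u] by blast
  interpret F: fire G u par dep by (rule f)
  interpret C: contour V E u par dep W cur "card E" by (rule c)
  show ?thesis by (rule C.edge_bound[OF C4])
qed


definition deg :: "'a \<Rightarrow> nat" where "deg v = card (nb v)"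
definition tri_nb :: "'a \<Rightarrow> 'a set" where "tri_nb v = {w \<in> nb v. \<exists>z\<in>nb v. (w, z) \<in> E}"

lemma fin_nb: "finite (nb v)"
  by (rule finite_subset[OF _ finV]) (use EV in \<open>auto simp: nbrs_def\<close>)

lemma fin_tri_nb: "finite (tri_nb v)"
  by (rule finite_subset[OF _ fin_nb[of v]]) (auto simp: tri_nb_def)

lemma nb_sym: "w \<in> nb v \<longleftrightarrow> v \<in> nb w"
  using Esym[of v w] Esym[of w v] by (auto simp: nbrs_def)

lemma arcs_Sigma: "E = Sigma V nb" using EV by (auto simp: nbrs_def)

lemma sum_deg: "(\<Sum>v\<in>V. deg v) = card E"
  unfolding deg_def arcs_Sigma[THEN arg_cong[of _ _ card]] using finV fin_nb by (simp add: card_SigmaI)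

lemma sum_tri_nb: "(\<Sum>v\<in>V. card (tri_nb v)) = card (triangle_arcs E)"
proof -
  have "triangle_arcs E = Sigma V tri_nb"
    using EV by (auto simp: triangle_arcs_def tri_nb_def nbrs_def)
  thus ?thesis using finV fin_tri_nb by (simp add: card_SigmaI)
qed

lemma tri_partner_unique:
  assumes "w \<in> nb v" "z \<in> nb v" "z' \<in> nb v" "(w, z) \<in> E" "(w, z') \<in> E" shows "z = z'"
proof -
  have "(v, z) \<in> E" "(z, w) \<in> E" "(w, z') \<in> E" "(z', v) \<in> E" "v \<noteq> w"
    using assms Esym[of w z] Esym[of v z'] Eirr[of v] by (auto simp: nbrs_def)
  thus ?thesis using C4 unfolding C4_free_def by blast
qed

lemma tri_partner:
  obtains f where "\<And>w. w \<in> tri_nb v \<Longrightarrow> f w \<in> tri_nb v \<and> f w \<noteq> w \<and> f (f w) = w \<and> (w, f w) \<in> E"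
proof -
  define f where "f w = (SOME z. z \<in> nb v \<and> (w, z) \<in> E)" for w
  have f: "f w \<in> nb v \<and> (w, f w) \<in> E" if w: "w \<in> tri_nb v" for w
  proof -
    have "\<exists>z. z \<in> nb v \<and> (w, z) \<in> E" using w by (auto simp: tri_nb_def)
    thus ?thesis unfolding f_def by (rule someI_ex)
  qed
  have "f w \<in> tri_nb v \<and> f w \<noteq> w \<and> f (f w) = w \<and> (w, f w) \<in> E" if w: "w \<in> tri_nb v" for w
  proof -
    have a: "w \<in> nb v" "f w \<in> nb v" "(w, f w) \<in> E" "(f w, w) \<in> E"
      using w f[OF w] Esym[of w "f w"] by (auto simp: tri_nb_def)
    hence i: "f w \<in> tri_nb v" by (auto simp: tri_nb_def)
    have "f (f w) = w" using tri_partner_unique[OF a(2) _ a(1) _ a(4)] f[OF i] by blast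
    moreover have "f w \<noteq> w" using a(3) Eirr[of w] by auto
    ultimately show ?thesis using i a(3) by blast
  qed
  thus thesis by (rule that)
qed

lemma tri_nb_not_leaf: "tri_nb v \<inter> lf v = {}"
proof (rule ccontr)
  assume "tri_nb v \<inter> lf v \<noteq> {}"
  then obtain w z where w: "w \<in> nb v" "z \<in> nb v" "(w, z) \<in> E" "card (nb w) = 1"
    by (auto simp: tri_nb_def leaves_at_def)
  have "v \<in> nb w" "z \<in> nb w" using w nb_sym[of w v] by (auto simp: nbrs_def)
  moreover have "v \<noteq> z" using w(2) Eirr[of v] by (auto simp: nbrs_def)
  ultimately show False using w(4) by (auto simp: card_1_singleton_iff)
qed

lemma lf_sub: "lf v \<subseteq> nb v" "finite (lf v)"
  using finite_subset[OF _ fin_nb[of v], of "lf v"] by (auto simp: leaves_at_def)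

lemma tri_leaf_deg: "card (tri_nb v) + card (lf v) \<le> deg v"
proof -
  have "card (tri_nb v \<union> lf v) \<le> card (nb v)"
    using lf_sub by (intro card_mono fin_nb) (auto simp: tri_nb_def)
  thus ?thesis unfolding deg_def
    using card_Un_disjoint[OF fin_tri_nb lf_sub(2) tri_nb_not_leaf] by simp
qed

lemma card_nonleaf: "card (nb v - lf v) = deg v - card (lf v)"
  unfolding deg_def using lf_sub by (simp add: card_Diff_subset)

definition big_tri :: "'a \<Rightarrow> 'a set" where "big_tri v = {w \<in> tri_nb v. 5 \<le> deg w}"

definition small_tri :: "'a \<Rightarrow> 'a set" where "small_tri v = {w \<in> tri_nb v. deg w \<le> 4}"

lemma card_big_small: "card (big_tri v) + card (small_tri v) = card (tri_nb v)"
proof -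
  have "tri_nb v = big_tri v \<union> small_tri v" "big_tri v \<inter> small_tri v = {}"
    by (auto simp: big_tri_def small_tri_def)
  moreover have "finite (big_tri v)" "finite (small_tri v)"
    using fin_tri_nb by (auto simp: big_tri_def small_tri_def)
  ultimately show ?thesis using card_Un_disjoint by metis
qed

text \<open>
  A leaf starts with \<open>18 - 60\<close> and may end with \<open>2 - 42\<close>, so it needs 2. A vertex of degree 4 with two triangles starts
  with \<open>-4\<close> and reaches 2 through two gifts of 3; a vertex of degree 5 with two triangles starts with 14 and
  can just afford four of them.
\<close>

definition gift :: "'a \<Rightarrow> 'a \<Rightarrow> int" where
  "gift v w = (if 5 \<le> deg v \<and> w \<in> tri_nb v \<and> deg w \<le> 4 then 3 else 0) + (if deg w = 1 then 2 else 0)"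

lemma gifts_out:
  "(\<Sum>w\<in>nb v. gift v w) = (if 5 \<le> deg v then 3 * int (card (small_tri v)) else 0) + 2 * int (card (lf v))"
proof -
  have s: "nb v \<inter> {w. 5 \<le> deg v \<and> w \<in> tri_nb v \<and> deg w \<le> 4} = (if 5 \<le> deg v then small_tri v else {})"
    by (auto simp: small_tri_def tri_nb_def)
  have l: "nb v \<inter> {w. deg w = 1} = lf v" by (auto simp: leaves_at_def deg_def)
  have "(\<Sum>w\<in>nb v. gift v w) = (\<Sum>w\<in>nb v. if 5 \<le> deg v \<and> w \<in> tri_nb v \<and> deg w \<le> 4 then 3 else 0)
      + (\<Sum>w\<in>nb v. if deg w = 1 then 2 else 0)"
    by (simp add: gift_def sum.distrib)
  also have "\<dots> = 3 * int (card (if 5 \<le> deg v then small_tri v else {})) + 2 * int (card (lf v))"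
    using fin_nb[of v] by (simp only: sum.If_cases s l) simp
  finally show ?thesis by simp
qed

lemma gifts_in:
  "(\<Sum>w\<in>nb v. gift w v) = (if deg v \<le> 4 then 3 * int (card (big_tri v)) else 0) + (if deg v = 1 then 2 else 0)"
proof -
  have t: "v \<in> tri_nb w \<longleftrightarrow> w \<in> tri_nb v" if w: "w \<in> nb v" for w
    using w nb_sym[of w v] Esym unfolding tri_nb_def nbrs_def by blast
  have s: "nb v \<inter> {w. 5 \<le> deg w \<and> v \<in> tri_nb w \<and> deg v \<le> 4} = (if deg v \<le> 4 then big_tri v else {})"
    using t by (auto simp: big_tri_def tri_nb_def[of v])
  have "(\<Sum>w\<in>nb v. gift w v) = (\<Sum>w\<in>nb v. if 5 \<le> deg w \<and> v \<in> tri_nb w \<and> deg v \<le> 4 then 3 else 0)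
      + (\<Sum>w\<in>nb v. if deg v = 1 then 2 else 0)"
    by (simp add: gift_def sum.distrib)
  also have "\<dots> = 3 * int (card (if deg v \<le> 4 then big_tri v else {})) + (\<Sum>w\<in>nb v. if deg v = 1 then 2 else 0)"
    using fin_nb[of v] by (simp add: sum.If_cases s)
  also have "(\<Sum>w\<in>nb v. if deg v = 1 then 2 else (0::int)) = (if deg v = 1 then 2 else 0)"
    by (simp add: deg_def)
  finally show ?thesis by simp
qed

lemma gifts_balance: "(\<Sum>v\<in>V. \<Sum>w\<in>nb v. gift v w) = (\<Sum>v\<in>V. \<Sum>w\<in>nb v. gift w v)"
proof -
  have "(\<Sum>v\<in>V. \<Sum>w\<in>nb v. gift v w) = (\<Sum>(v, w)\<in>E. gift v w)"
    unfolding arcs_Sigma[THEN arg_cong[of _ _ "sum _"]] using finV fin_nb by (simp add: sum.Sigma)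
  also have "\<dots> = (\<Sum>(v, w)\<in>E. gift w v)"
    by (rule sum.reindex_bij_witness[of _ prod.swap prod.swap]) (auto intro: Esym)
  also have "\<dots> = (\<Sum>v\<in>V. \<Sum>w\<in>nb v. gift w v)"
    unfolding arcs_Sigma[THEN arg_cong[of _ _ "sum _"]] using finV fin_nb by (simp add: sum.Sigma)
  finally show ?thesis .
qed

definition charge :: "'a \<Rightarrow> int" where
  "charge v = 18 * int (deg v) - 4 * int (card (tri_nb v)) - 60
     + (\<Sum>w\<in>nb v. gift w v) - (\<Sum>w\<in>nb v. gift v w)"

lemma total_charge: "(\<Sum>v\<in>V. charge v) \<le> -60"
proof -
  have "(\<Sum>v\<in>V. charge v) = 18 * int (\<Sum>v\<in>V. deg v) - 4 * int (\<Sum>v\<in>V. card (tri_nb v)) - 60 * int (card V)"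
    unfolding charge_def
    by (simp add: sum.distrib sum_subtractf gifts_balance sum_distrib_left)
  also have "\<dots> = 18 * int (card E) - 4 * int (card (triangle_arcs E)) - 60 * int (card V)"
    unfolding sum_deg sum_tri_nb ..
  also have "\<dots> \<le> -60" using sparse two by linarith
  finally show ?thesis .
qed

lemma even_tri: "even (card (tri_nb v))"
proof -
  obtain f where f: "\<And>w. w \<in> tri_nb v \<Longrightarrow> f w \<in> tri_nb v \<and> f w \<noteq> w \<and> f (f w) = w \<and> (w, f w) \<in> E"
    by (rule tri_partner[of v]) blast
  show ?thesis by (rule even_card_involution[OF fin_tri_nb, of v f]) (use f in blast)
qed

text \<open>
  Triangles at \<open>v\<close> pair up its triangle neighbours. If no pair consists of two small degrees, each small
  neighbour has a big partner.
\<close>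

lemma small_triangle_or_big_half:
  obtains a b where "a \<in> nb v" "b \<in> nb v" "(a, b) \<in> E" "deg a \<le> 4" "deg b \<le> 4"
  | "card (small_tri v) \<le> card (big_tri v)"
proof -
  obtain f where f: "\<And>w. w \<in> tri_nb v \<Longrightarrow> f w \<in> tri_nb v \<and> f w \<noteq> w \<and> f (f w) = w \<and> (w, f w) \<in> E"
    by (rule tri_partner[of v]) blast
  show thesis
  proof (cases "\<exists>w\<in>small_tri v. deg (f w) \<le> 4")
    case True
    then obtain w where w: "w \<in> small_tri v" "deg (f w) \<le> 4" by blast
    have m: "w \<in> tri_nb v" "deg w \<le> 4" using w(1) by (simp_all add: small_tri_def)
    have sub: "tri_nb v \<subseteq> nb v" by (auto simp: tri_nb_def)
    have i: "f w \<in> tri_nb v" "(w, f w) \<in> E" using f[OF m(1)] by blast+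
    show thesis by (rule that(1)[OF subsetD[OF sub m(1)] subsetD[OF sub i(1)] i(2) m(2) w(2)])
  next
    case False
    have "card (small_tri v) \<le> card (big_tri v)"
    proof (rule card_inj_on_le[of f])
      show "inj_on f (small_tri v)"
      proof (rule inj_onI)
        fix x y assume xy: "x \<in> small_tri v" "y \<in> small_tri v" "f x = f y"
        have "x \<in> tri_nb v" "y \<in> tri_nb v" using xy by (simp_all add: small_tri_def)
        hence "f (f x) = x" "f (f y) = y" using f by blast+
        thus "x = y" using xy(3) by metis
      qed
      show "f ` small_tri v \<subseteq> big_tri v"
      proof (rule image_subsetI)
        fix w assume w: "w \<in> small_tri v"
        have "w \<in> tri_nb v" using w by (simp add: small_tri_def)
        hence "f w \<in> tri_nb v" using f[of w] by blast
        moreover have "\<not> deg (f w) \<le> 4" using False w by blast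
        ultimately show "f w \<in> big_tri v" by (simp add: big_tri_def)
      qed
      show "finite (big_tri v)" using fin_tri_nb by (simp add: big_tri_def)
    qed
    thus thesis by (rule that(2))
  qed
qed

lemma deg_pos: assumes v: "v \<in> V" shows "0 < deg v"
proof -
  obtain w where w: "w \<in> V" "w \<noteq> v"
  proof (rule ccontr)
    assume "\<not> thesis"
    hence "V \<subseteq> {v}" using that by blast
    hence "card V \<le> card {v}" by (intro card_mono) auto
    thus False using two by simp
  qed
  obtain z where "(v, z) \<in> E" using conn[OF v w(1)] w(2) by (auto elim: converse_rtranclE)
  hence "nb v \<noteq> {}" by (auto simp: nbrs_def)
  thus ?thesis unfolding deg_def using fin_nb[of v] by (simp add: card_gt_0_iff)
qed

lemma leaf_next_to_leaf:
  assumes v: "v \<in> V" "deg v = 1" "card (lf v) \<noteq> 0" shows "card V \<le> 2"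
proof -
  obtain w where w: "nb v = {w}" using v(2) by (auto simp: deg_def card_1_singleton_iff)
  have "lf v \<noteq> {}" using v(3) by auto
  then obtain x where "x \<in> lf v" by blast
  moreover from this have "x = w" using w lf_sub(1)[of v] by blast
  ultimately have "card (nb w) = 1" by (simp add: leaves_at_def)
  moreover have "v \<in> nb w" using nb_sym[of w v] w by simp
  ultimately have nw: "nb w = {v}" by (auto simp: card_1_singleton_iff)
  have "x \<in> {v, w}" if "(v, x) \<in> E\<^sup>*" for x
    using that
  proof (induction rule: rtrancl_induct)
    case (step y z)
    have "z \<in> nb y" using step.hyps by (simp add: nbrs_def)
    thus ?case using step.IH w nw by auto
  qed simp
  hence "V \<subseteq> {v, w}" using conn[OF v(1)] by blast
  hence "card V \<le> card {v, w}" by (intro card_mono) auto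
  also have "\<dots> \<le> 2" by (simp add: card_insert_if)
  finally show ?thesis .
qed


text \<open>
  A case distinction on the degree. The critical vertices have degree 2 with \<open>n = 21\<close>, degree 1, and those with two triangles and
  degree 4, or degree 5 and a leaf: in the latter cases either a triangle with two small degrees allows \<open>saves_third_deg4\<close>, or big partners
  give, or save, enough charge.
\<close>

lemma charge_saves:
  assumes v: "v \<in> V" and n: "21 \<le> card V"
  shows "int (card V) * (2 - charge v) \<le> 42 * (int (sn 2 G v) + 1)"
proof -
  define n' where "n' = int (card V)"
  define s where "s = int (sn 2 G v) + 1"
  define d where "d = deg v"
  define t where "t = card (tri_nb v)"
  define k where "k = card (lf v)"
  define b where "b = card (big_tri v)"
  define m where "m = card (small_tri v)"
  note defs = n'_def s_def d_def t_def k_def b_def m_def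
  have n21: "21 \<le> n'" using n by (simp add: n'_def)
  have s0: "2 \<le> s" using sn_pos[OF v] by (simp add: s_def)
  have d0: "0 < d" using deg_pos[OF v] by (simp add: d_def)
  have tk: "t + k \<le> d" using tri_leaf_deg[of v] by (simp add: defs)
  have bm: "b + m = t" using card_big_small[of v] by (simp add: defs)
  have ev: "even t" using even_tri[of v] by (simp add: defs)
  have ch: "charge v = 18 * int d - 4 * int t - 60 + (if d \<le> 4 then 3 * int b else 0)
      + (if d = 1 then 2 else 0) - (if 5 \<le> d then 3 * int m else 0) - 2 * int k"
    unfolding charge_def gifts_in gifts_out defs by simp
  have NL: "card (nb v - lf v) = d - k" using card_nonleaf[of v] by (simp add: defs)
  \<comment> \<open>It suffices to bound the deficit \<open>2 - charge v\<close> by a number \<open>c\<close> that the saved vertices pay for.\<close>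
  have enough: "n' * (2 - charge v) \<le> 42 * s" if "2 - charge v \<le> c" "n' * c \<le> 42 * s" for c
  proof -
    have "n' * (2 - charge v) \<le> n' * c" using that(1) n21 by (intro mult_left_mono) auto
    thus ?thesis using that(2) by linarith
  qed
  have rich: ?thesis if "2 \<le> charge v"
    using enough[of 0] that s0 by (simp add: defs)
  have goal: ?thesis if "n' * (2 - charge v) \<le> 42 * s" using that by (simp add: defs)
  have two_dir: "n' \<le> s + int k" if "d - k \<le> 2"
    using sn_two_directions[OF v] NL that by (simp add: defs)
  have four_dir: "n' \<le> 3 * (s + 1 + int k)"
    if h: "d - k = 4" "t = 4" "a \<in> nb v" "z \<in> nb v" "(a, z) \<in> E" "deg a \<le> 4" "deg z \<le> 4" for a z
  proof -
    have sub: "tri_nb v \<subseteq> nb v - lf v" using tri_nb_not_leaf[of v] by (auto simp: tri_nb_def)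
    have eq: "tri_nb v = nb v - lf v"
      using card_subset_eq[OF _ sub] fin_nb[of v] NL h(1,2) by (simp add: t_def)
    have tr: "\<exists>w'\<in>nb v. (w, w') \<in> E" if w: "w \<in> nb v - lf v" for w
    proof -
      have "w \<in> tri_nb v" using eq w by simp
      thus ?thesis unfolding tri_nb_def by blast
    qed
    have "card V \<le> 3 * (sn 2 G v + 2 + card (lf v))"
      by (rule sn_four_directions[OF v _ _ tr h(3-5)]) (use NL n h(1,6,7) in \<open>simp_all add: deg_def\<close>)
    thus ?thesis by (simp add: defs)
  qed
  consider "6 \<le> d" | "d = 5" | "d = 4" | "d = 3" | "d = 2" | "d = 1" using d0 by linarith
  thus ?thesis
  proof cases
    case 1
    have "charge v = 18 * int d - 4 * int t - 60 - 3 * int m - 2 * int k" using 1 by (simp add: ch)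
    hence "2 \<le> charge v" using 1 tk bm by linarith
    thus ?thesis by (rule rich)
  next
    case 2
    have t4: "t \<le> 4" using tk ev 2 by presburger
    show ?thesis
    proof (cases "t = 4 \<and> k = 1")
      case False
      hence "t = 4 \<and> k = 0 \<or> t \<le> 2" using t4 tk ev 2 by presburger
      hence "2 \<le> charge v" using 2 tk bm by (auto simp: ch)
      thus ?thesis by (rule rich)
    next
      case True
      show ?thesis
      proof (rule small_triangle_or_big_half[of v])
        fix a z assume a: "a \<in> nb v" "z \<in> nb v" "(a, z) \<in> E" "deg a \<le> 4" "deg z \<le> 4"
        have "n' \<le> 3 * (s + 1 + int k)" by (rule four_dir[OF _ _ a]) (use True 2 in auto)
        moreover have "0 \<le> charge v" using True 2 bm by (simp add: ch)
        ultimately show ?thesis using enough[of 2] True n21 by (intro goal) simp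
      next
        assume "card (small_tri v) \<le> card (big_tri v)"
        hence "m \<le> 2" using bm True by (simp add: defs)
        hence "2 \<le> charge v" using True 2 by (simp add: ch)
        thus ?thesis by (rule rich)
      qed
    qed
  next
    case 3
    have "t = 4 \<and> k = 0 \<or> t = 2 \<and> k = 2 \<or> t \<le> 2 \<and> t + k \<le> 3 \<or> t = 0" using tk ev 3 by presburger
    then consider "t = 4" "k = 0" | "t = 2" "k = 2" | "t \<le> 2" "t + k \<le> 3" | "t = 0" by blast
    thus ?thesis
    proof cases
      case t: 1
      show ?thesis
      proof (rule small_triangle_or_big_half[of v])
        fix a z assume a: "a \<in> nb v" "z \<in> nb v" "(a, z) \<in> E" "deg a \<le> 4" "deg z \<le> 4"
        have "n' \<le> 3 * (s + 1 + int k)" by (rule four_dir[OF _ _ a]) (use t 3 in auto)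
        moreover have "-4 \<le> charge v" using t 3 by (simp add: ch)
        ultimately show ?thesis using enough[of 6] t n21 by (intro goal) simp
      next
        assume "card (small_tri v) \<le> card (big_tri v)"
        hence "2 \<le> b" using bm t by (simp add: defs)
        hence "2 \<le> charge v" using t 3 by (simp add: ch)
        thus ?thesis by (rule rich)
      qed
    next
      case t: 2
      have "n' \<le> s + 2" using two_dir t 3 by simp
      moreover have "0 \<le> charge v" using t 3 by (simp add: ch)
      ultimately show ?thesis using enough[of 2] n21 by (intro goal) simp
    next
      case t: 3
      have "t = 2 \<or> t = 0" using t ev by presburger
      hence "2 \<le> charge v" using t 3 tk by (auto simp: ch)
      thus ?thesis by (rule rich)
    next
      case t: 4
      have "2 \<le> charge v" using t 3 tk by (simp add: ch)
      thus ?thesis by (rule rich)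
    qed
  next
    case 4
    have t2: "t = 0 \<or> t = 2" using tk ev 4 by presburger
    show ?thesis
    proof (cases "k = 0")
      case False
      have "n' \<le> s + int k" using two_dir False 4 by simp
      moreover have "2 - charge v \<le> 18" using t2 False 4 tk by (auto simp: ch)
      ultimately show ?thesis using enough[of 18] n21 tk 4 by (intro goal) linarith
    next
      case k: True
      have "n' \<le> 3 * s"
        using sn_three_directions[OF v] n NL 4 k by (simp add: defs)
      hence n14: "n' * 14 \<le> 42 * s" by simp
      show ?thesis
      proof (cases "t = 0 \<or> 1 \<le> b")
        case True
        have "2 - charge v \<le> 14" using True t2 4 k by (auto simp: ch)
        thus ?thesis using enough n14 by (intro goal) blast
      next
        case False
        obtain a z where a: "a \<in> nb v" "z \<in> nb v" "(a, z) \<in> E" "deg a \<le> 4"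
          by (rule small_triangle_or_big_half[of v]) (use False t2 bm in \<open>auto simp: defs\<close>)
        have "n' \<le> s + 1"
          using sn_triangle[OF v _ a(1-3)] a(4) 4 by (simp add: deg_def defs)
        moreover have "2 - charge v \<le> 16" using t2 4 k by (auto simp: ch)
        ultimately show ?thesis using enough[of 16] n21 by (intro goal) linarith
      qed
    qed
  next
    case 5
    have "n' \<le> s + int k" using two_dir 5 by simp
    moreover have "2 - charge v \<le> 38" using 5 tk by (simp add: ch)
    ultimately show ?thesis using enough[of 38] n21 tk 5 by (intro goal) linarith
  next
    case 6
    have t0: "t = 0" using tk ev 6 by presburger
    have k0: "k = 0" using leaf_next_to_leaf[OF v] 6 n by (auto simp: defs)
    have "n' \<le> s" using two_dir 6 k0 by simp
    moreover have "2 - charge v \<le> 42" using 6 t0 k0 by (simp add: ch)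
    ultimately show ?thesis using enough[of 42] by (intro goal) linarith
  qed
qed

theorem surviving_rate_bound: "surviving_rate 2 G > 1 / 21"
proof -
  define n where "n = int (card V)"
  define S where "S = (\<Sum>v\<in>V. int (sn 2 G v))"
  have n2: "2 \<le> n" using two by (simp add: n_def)
  have "n * n < 21 * S"
  proof (cases "21 \<le> card V")
    case True
    have "n * (2 * n + 60) \<le> n * (2 * n - (\<Sum>v\<in>V. charge v))"
      using total_charge n2 by (intro mult_left_mono) auto
    also have "\<dots> = (\<Sum>v\<in>V. n * (2 - charge v))"
      unfolding sum_distrib_left[symmetric] sum_subtractf by (simp add: n_def)
    also have "\<dots> \<le> (\<Sum>v\<in>V. 42 * (int (sn 2 G v) + 1))"
      unfolding n_def using charge_saves[OF _ True] by (rule sum_mono)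
    also have "\<dots> = 42 * S + 42 * n"
      by (simp add: S_def n_def sum_distrib_left sum.distrib algebra_simps)
    finally show ?thesis using n2 by (simp add: algebra_simps)
  next
    case False
    have "(\<Sum>v\<in>V. 1) \<le> S" unfolding S_def using sn_pos by (intro sum_mono) force
    hence nS: "n \<le> S" by (simp add: n_def)
    have "n * n < 21 * n" using False n2 by (intro mult_strict_right_mono) (auto simp: n_def)
    thus ?thesis using nS by linarith
  qed
  hence "real_of_int (n * n) < real_of_int (21 * S)" by (simp only: of_int_less_iff)
  moreover have "real_of_int n = real (card V)" by (simp add: n_def)
  moreover have "real_of_int S = (\<Sum>v\<in>V. real (sn 2 G v))" by (simp add: S_def)
  ultimately have "(real (card V))\<^sup>2 < 21 * (\<Sum>v\<in>V. real (sn 2 G v))"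
    by (simp add: power2_eq_square)
  moreover have "0 < (real (card V))\<^sup>2" using two by simp
  ultimately show ?thesis unfolding surviving_rate_def by (simp add: field_simps)
qed

end

section \<open>From the hypotheses to a plane graph with spokes\<close>

lemma arcs_of_connected:
  assumes c: "Digraph_Component.connected (with_proj G)" and sym: "\<And>x y. (x, y) \<in> parcs G \<Longrightarrow> (y, x) \<in> parcs G"
    and "x \<in> pverts G" "y \<in> pverts G"
  shows "(x, y) \<in> (parcs G)\<^sup>*"
proof -
  have "parcs (mk_symmetric (with_proj G)) \<subseteq> parcs G"
    using sym by (auto simp: parcs_mk_symmetric)
  moreover have "(x, y) \<in> rtrancl_on (pverts G) (parcs (mk_symmetric (with_proj G)))"
    using c assms(3,4) by (simp add: Digraph_Component.connected_def strongly_connected_def reachable_def)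
  ultimately show ?thesis using rtrancl_mono subsetD rtrancl_on_rtranclI by metis
qed

lemma C4_free_if_no_4_cycle:
  assumes V: "\<And>x y. (x, y) \<in> parcs G \<Longrightarrow> x \<in> pverts G" and irr: "\<And>x. (x, x) \<notin> parcs G"
    and no: "\<nexists>p. pre_digraph.cycle (with_proj G) p \<and> length p = 4"
  shows "C4_free (parcs G)"
  unfolding C4_free_def
proof (intro allI impI)
  fix a b c d assume e: "(a, b) \<in> parcs G" "(b, c) \<in> parcs G" "(c, d) \<in> parcs G" "(d, a) \<in> parcs G"
  show "a = c \<or> b = d"
  proof (rule ccontr)
    assume "\<not> (a = c \<or> b = d)"
    hence "distinct [b, c, d, a]" using e irr by auto
    hence "pre_digraph.cycle (with_proj G) [(a, b), (b, c), (c, d), (d, a)]"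
      unfolding pre_digraph.cycle_def pre_digraph.awalk_def cas_with_proj_eq awalk_verts_with_proj_eq
      using e V by (intro exI[of _ a]) auto
    thus False using no by force
  qed
qed

theorem corollary1p4:
  fixes G :: "'a pair_pre_digraph"
  assumes "pair_graph G"
    and "Digraph_Component.connected (with_proj G)"
    and "card (pverts G) \<ge> 2"
    and "planar G"
    and "\<nexists>p. pre_digraph.cycle (with_proj G) p \<and> length p = 4"
  shows "surviving_rate 2 G > 1 / 21"
proof -
  interpret g: pair_graph G by (rule assms(1))
  have V: "x \<in> pverts G" "y \<in> pverts G" if "(x, y) \<in> parcs G" for x y
    using that g.in_arcsD1 g.in_arcsD2 by blast+
  have sym: "(y, x) \<in> parcs G" if "(x, y) \<in> parcs G" for x y
    using g.pair_sym_arcs that by (auto simp: symmetric_def dest: symD)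
  have irr: "(x, x) \<notin> parcs G" for x using g.pair_no_loops[of "(x, x)"] by auto
  have fin: "finite (pverts G)" by (rule g.pair_finite_verts)
  obtain p \<gamma> where D: "plane_drawing G p \<gamma>" using assms(4) by (auto simp: planar_def)
  have ed: "{x, y} \<in> edges G" if "(x, y) \<in> parcs G" for x y using that by (auto simp: edges_def)
  obtain r ang \<delta> where sd: "star_drawing (pverts G) (parcs G) p r ang \<delta>"
  proof (rule star_drawing_exists[of "pverts G" "parcs G" p \<gamma>])
    show "inj_on p (pverts G)" using D by (simp add: plane_drawing_def)
    show "arc (\<gamma> {x, y}) \<and> {pathstart (\<gamma> {x, y}), pathfinish (\<gamma> {x, y})} = {p x, p y}"
      if "(x, y) \<in> parcs G" for x y
      using D ed[OF that] by (simp add: plane_drawing_def)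
    show "path_image (\<gamma> {x, y}) \<inter> p ` pverts G = {p x, p y}" if "(x, y) \<in> parcs G" for x y
      using D ed[OF that] by (simp add: plane_drawing_def)
    show "path_image (\<gamma> {x, y}) \<inter> path_image (\<gamma> {u, w}) \<subseteq> p ` ({x, y} \<inter> {u, w})"
      if e: "(x, y) \<in> parcs G" "(u, w) \<in> parcs G" "{x, y} \<noteq> {u, w}" for x y u w
    proof -
      have "\<forall>e\<in>edges G. \<forall>f\<in>edges G. e \<noteq> f \<longrightarrow> path_image (\<gamma> e) \<inter> path_image (\<gamma> f) \<subseteq> p ` (e \<inter> f)"
        using D unfolding plane_drawing_def by (elim conjE)
      from this[rule_format, OF ed[OF e(1)] ed[OF e(2)] e(3)] show ?thesis .
    qed
    show "parcs G \<subseteq> pverts G \<times> pverts G" using V by auto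
  qed (use fin sym irr in auto)
  have C4: "C4_free (parcs G)" using V(1) irr assms(5) by (rule C4_free_if_no_4_cycle)
  have "c4_free_plane_graph G p r ang \<delta>"
    using sd fin assms(3) arcs_of_connected[OF assms(2) sym] C4
    by (intro c4_free_plane_graph.intro c4_free_plane_graph_axioms.intro)
  thus ?thesis by (rule c4_free_plane_graph.surviving_rate_bound)
qed

end
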